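(* Let $G$ be a finite group and let $T$ be a multiplicatively cohomological $(\mathcal{O}_{\mathrm{comp}},\mathcal{O}_{\mathrm{comp}})$-Tambara functor (i.e. a complete $G$-Tambara functor). Then for any compatible pair $(\mathcal{O}_m,\mathcal{O}_a)$ of $G$-transfer systems there is a homeomorphism $$\mathrm{Spec}^{(\mathcal{O}_m,\mathcal{O}_a)}(T)\;\cong\;\mathrm{Spec}^{(\mathrm{Hull}(\mathcal{O}_m),\mathcal{O}_a)}(T),$$ where $\mathrm{Hull}(\mathcal{O}_m)$ is the saturated hull of $\mathcal{O}_m$ (a self-compatible transfer system).
   Context: Transfer systems. $G$ is a finite group. A $G$-transfer system is a set $\mathcal{O}$ of pairs $(K,H)$ of subgroups with $K\le H\le G$ which contains all $(H,H)$, is transitive, is closed under simultaneous conjugation, and satisfies: $(K,H)\in\mathcal{O}$, $L\le H$ implies $(K\cap L,L)\in\mathcal{O}$. $\mathcal{O}_{\mathrm{comp}}$ is the transfer system of all pairs $K\le H$. $\mathcal{O}$ is saturated if for all $A\le B\le C\le G$, whenever two of $(A,B),(B,C),(A,C)$ lie in $\mathcal{O}$ so does the third. $\mathrm{Hull}(\mathcal{O})$ is the smallest saturated transfer system containing $\mathcal{O}$. A pair $(\mathcal{O}_m,\mathcal{O}_a)$ of transfer systems is compatible if whenever $B,C\le A\le G$, $(B,A)\in\mathcal{O}_m$ and $(B\cap C,B)\in\mathcal{O}_a$, then $(C,A)\in\mathcal{O}_a$. $\mathcal{O}$ is self-compatible if $(\mathcal{O},\mathcal{O})$ is compatible; this holds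 iff $\mathcal{O}$ is saturated. If $(\mathcal{O}_m,\mathcal{O}_a)$ is compatible, then so is $(\mathrm{Hull}(\mathcal{O}_m),\mathcal{O}_a)$. Tambara functors. $\mathbf{P}_G$ is the category with objects finite $G$-sets and morphisms $X\to Y$ the isomorphism classes of bispans $[X\leftarrow A\to B\to Y]$ of finite $G$-sets, with the usual composition of polynomials (via pullbacks and dependent products). For a compatible pair, $\mathbf{P}_G^{(\mathcal{O}_m,\mathcal{O}_a)}$ is the wide subcategory of bispans $[X\leftarrow A\xrightarrow{n}B\xrightarrow{t}Y]$ such that $(\mathrm{Stab}(a),\mathrm{Stab}(n(a)))\in\mathcal{O}_m$ for all $a\in A$ and $(\mathrm{Stab}(b),\mathrm{Stab}(t(b)))\in\mathcal{O}_a$ for all $b\in B$. An $(\mathcal{O}_m,\mathcal{O}_a)$-Tambara functor is a product-preserving functor $T:\mathbf{P}_G^{(\mathcal{O}_m,\mathcal{O}_a)}\to\mathsf{Set}$ such that each commutative semiring $T(X)$ is a commutative ring. It amounts to commutative rings $T(G/H)$, $H\le G$, with restrictions $\mathrm{res}^H_K:T(G/H)\to T(G/K)$ ($K\le H$), transfers $\mathrm{tr}_K^H:T(G/K)\to T(G/H)$ ($(K,H)\in\mathcal{O}_a$), norms $\mathrm{nm}_K^H:T(G/K)\to T(G/H)$ ($(K,H)\in\mathcal{O}_m$), and conjugations $c_{H,g}:T(G/H)\to T(G/gHg^{-1})$: with $\pi:G/K\to G/H$ the projection these are the images of $[G/H\xleftarrow{\pi}G/K=G/K=G/K]$, $[G/K=G/K=G/K\xrightarrow{\pi}G/H]$,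 $[G/K=G/K\xrightarrow{\pi}G/H=G/H]$, and of the bispan with last map the isomorphism $G/H\to G/gHg^{-1}$, $xH\mapsto xg^{-1}(gHg^{-1})$ and other maps identities. Multiplicatively cohomological. A complete Tambara functor $T$ is multiplicatively cohomological if $\mathrm{nm}_K^H\mathrm{res}_K^H(x)=x^{[H:K]}$ for all subgroups $K<H\le G$ and all $x\in T(G/H)$. Prime ideals. An ideal $I$ of an $(\mathcal{O}_m,\mathcal{O}_a)$-Tambara functor $T$ is a family of ideals $I(G/H)\subseteq T(G/H)$ closed under all restrictions, conjugations, transfers in $\mathcal{O}_a$ and norms in $\mathcal{O}_m$. For $x\in T(G/H_1)$, $y\in T(G/H_2)$, $\mathtt{Q}(I,x,y)$ is the statement: for all $K_1\le H_1$, $K_2\le H_2$, $L\le G$, $g_1,g_2\in G$ with $(g_iK_ig_i^{-1},L)\in\mathcal{O}_m$ for $i=1,2$, one has $\big(\mathrm{nm}^L_{g_1K_1g_1^{-1}}c_{K_1,g_1}\mathrm{res}^{H_1}_{K_1}(x)\big)\cdot\big(\mathrm{nm}^L_{g_2K_2g_2^{-1}}c_{K_2,g_2}\mathrm{res}^{H_2}_{K_2}(y)\big)\in I(G/L)$. An ideal $P$ is prime if $P\ne T$ and $\mathtt{Q}(P,x,y)$ implies $x\in P$ or $y\in P$ (at the respective levels). $\mathrm{Spec}^{(\mathcal{O}_m,\mathcal{O}_a)}(T)$ is the set of prime ideals with the topology whose closed sets are generated by $V(I)=\{P: I\subseteq P\}$, $I$ an ideal. A complete Tambara functor is regarded as an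 $(\mathcal{O}_m,\mathcal{O}_a)$-Tambara functor by forgetting the norms not in $\mathcal{O}_m$ and the transfers not in $\mathcal{O}_a$. *)

theory Defs
  imports "HOL-Algebra.Group_Action" "HOL-Algebra.Left_Coset" "HOL-Algebra.Ideal"
    "HOL-Analysis.Function_Topology"
begin

section \<open>Transfer systems\<close>

definition conjugate :: "('g, 'm) monoid_scheme \<Rightarrow> 'g \<Rightarrow> 'g set \<Rightarrow> 'g set" where
  "conjugate G g H = g <#\<^bsub>G\<^esub> H #>\<^bsub>G\<^esub> (inv\<^bsub>G\<^esub> g)"

definition transfer_system :: "('g, 'm) monoid_scheme \<Rightarrow> ('g set \<times> 'g set) set \<Rightarrow> bool" where
  "transfer_system G \<O> \<longleftrightarrow>
     (\<forall>(K, H) \<in> \<O>. subgroup K G \<and> subgroup H G \<and> K \<subseteq> H) \<and>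
     (\<forall>H. subgroup H G \<longrightarrow> (H, H) \<in> \<O>) \<and>
     (\<forall>L K H. (L, K) \<in> \<O> \<and> (K, H) \<in> \<O> \<longrightarrow> (L, H) \<in> \<O>) \<and>
     (\<forall>K H. \<forall>g\<in>carrier G. (K, H) \<in> \<O> \<longrightarrow> (conjugate G g K, conjugate G g H) \<in> \<O>) \<and>
     (\<forall>K H L. (K, H) \<in> \<O> \<and> subgroup L G \<and> L \<subseteq> H \<longrightarrow> (K \<inter> L, L) \<in> \<O>)"

definition complete_ts :: "('g, 'm) monoid_scheme \<Rightarrow> ('g set \<times> 'g set) set" where
  "complete_ts G = {(K, H). subgroup K G \<and> subgroup H G \<and> K \<subseteq> H}"

definition saturated :: "('g, 'm) monoid_scheme \<Rightarrow> ('g set \<times> 'g set) set \<Rightarrow> bool" where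
  "saturated G \<O> \<longleftrightarrow>
     (\<forall>A B C. subgroup A G \<and> subgroup B G \<and> subgroup C G \<and> A \<subseteq> B \<and> B \<subseteq> C \<longrightarrow>
        ((A, B) \<in> \<O> \<and> (B, C) \<in> \<O> \<longrightarrow> (A, C) \<in> \<O>) \<and>
        ((A, B) \<in> \<O> \<and> (A, C) \<in> \<O> \<longrightarrow> (B, C) \<in> \<O>) \<and>
        ((B, C) \<in> \<O> \<and> (A, C) \<in> \<O> \<longrightarrow> (A, B) \<in> \<O>))"

definition Hull :: "('g, 'm) monoid_scheme \<Rightarrow> ('g set \<times> 'g set) set \<Rightarrow> ('g set \<times> 'g set) set" where
  "Hull G \<O> = (\<lambda>\<S>. transfer_system G \<S> \<and> saturated G \<S>) hull \<O>"

definition compatible ::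
    "('g, 'm) monoid_scheme \<Rightarrow> ('g set \<times> 'g set) set \<Rightarrow> ('g set \<times> 'g set) set \<Rightarrow> bool" where
  "compatible G \<O>m \<O>a \<longleftrightarrow>
     transfer_system G \<O>m \<and> transfer_system G \<O>a \<and>
     (\<forall>A B C. subgroup A G \<and> subgroup B G \<and> subgroup C G \<and> B \<subseteq> A \<and> C \<subseteq> A \<and>
        (B, A) \<in> \<O>m \<and> (B \<inter> C, B) \<in> \<O>a \<longrightarrow> (C, A) \<in> \<O>a)"


section \<open>Finite G-sets\<close>

record ('g, 'x) gset =
  points :: "'x set"
  act :: "'g \<Rightarrow> 'x \<Rightarrow> 'x"

definition finite_gset :: "('g, 'm) monoid_scheme \<Rightarrow> ('g, 'x) gset \<Rightarrow> bool" where
  "finite_gset G X \<longleftrightarrow> finite (points X) \<and> group_action G (points X) (act X)"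

definition equivariant ::
    "('g, 'm) monoid_scheme \<Rightarrow> ('g, 'x) gset \<Rightarrow> ('g, 'y) gset \<Rightarrow> ('x \<Rightarrow> 'y) \<Rightarrow> bool" where
  "equivariant G X Y f \<longleftrightarrow>
     f \<in> points X \<rightarrow> points Y \<and>
     (\<forall>g\<in>carrier G. \<forall>x\<in>points X. f (act X g x) = act Y g (f x))"

definition gset_iso ::
    "('g, 'm) monoid_scheme \<Rightarrow> ('g, 'x) gset \<Rightarrow> ('g, 'y) gset \<Rightarrow> ('x \<Rightarrow> 'y) \<Rightarrow> bool" where
  "gset_iso G X Y f \<longleftrightarrow> equivariant G X Y f \<and> bij_betw f (points X) (points Y)"

definition pullback_gset ::
    "('g, 'x) gset \<Rightarrow> ('x \<Rightarrow> 'z) \<Rightarrow> ('g, 'y) gset \<Rightarrow> ('y \<Rightarrow> 'z) \<Rightarrow> ('g, 'x \<times> 'y) gset" where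
  "pullback_gset X f Y h =
     (let P = {(x, y). x \<in> points X \<and> y \<in> points Y \<and> f x = h y}
      in \<lparr>points = P, act = (\<lambda>g. \<lambda>(x, y)\<in>P. (act X g x, act Y g y))\<rparr>)"

text \<open>The dependent product of \<open>f : C \<rightarrow> A\<close> along \<open>n : A \<rightarrow> B\<close>: pairs of a point \<open>b\<close> of \<open>B\<close>
  and a section \<open>s\<close> of \<open>f\<close> over the fibre of \<open>n\<close> at \<open>b\<close>, with \<open>G\<close> acting on sections by
  conjugation.\<close>

definition dep_prod_gset ::
    "('g, 'm) monoid_scheme \<Rightarrow> ('g, 'c) gset \<Rightarrow> ('c \<Rightarrow> 'a) \<Rightarrow> ('g, 'a) gset \<Rightarrow> ('a \<Rightarrow> 'b) \<Rightarrow>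
     ('g, 'b) gset \<Rightarrow> ('g, 'b \<times> ('a \<Rightarrow> 'c)) gset" where
  "dep_prod_gset G C f A n B =
     (let fib = (\<lambda>b. {a \<in> points A. n a = b});
          D = {(b, s). b \<in> points B \<and> s \<in> (\<Pi>\<^sub>E a\<in>fib b. {c \<in> points C. f c = a})}
      in \<lparr>points = D,
          act = (\<lambda>g. \<lambda>(b, s)\<in>D.
            (act B g b, \<lambda>a\<in>fib (act B g b). act C g (s (act A (inv\<^bsub>G\<^esub> g) a))))\<rparr>)"

text \<open>Objects of the category of bispans are the finite \<open>G\<close>-sets whose points lie in the following
  type. It is infinite, so every finite \<open>G\<close>-set is isomorphic to such an object, and it contains the
  cosets, so that \<open>G/H\<close> has a canonical representative.\<close>

type_synonym 'g pt = "'g set \<times> nat"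

definition coset_gset :: "('g, 'm) monoid_scheme \<Rightarrow> 'g set \<Rightarrow> ('g, 'g pt) gset" where
  "coset_gset G H =
     (let P = (lcosets\<^bsub>G\<^esub> H) \<times> {0}
      in \<lparr>points = P, act = (\<lambda>g. \<lambda>(C, i)\<in>P. (g <#\<^bsub>G\<^esub> C, i))\<rparr>)"

definition coset_proj :: "('g, 'm) monoid_scheme \<Rightarrow> 'g set \<Rightarrow> 'g pt \<Rightarrow> 'g pt" where
  "coset_proj G H = (\<lambda>(C, i). (C <#>\<^bsub>G\<^esub> H, i))"

text \<open>The isomorphism \<open>xH \<mapsto> x g\<^sup>-\<^sup>1 (g H g\<^sup>-\<^sup>1)\<close>, noting that the target coset is the set
  \<open>x H g\<^sup>-\<^sup>1\<close>.\<close>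

definition coset_conj :: "('g, 'm) monoid_scheme \<Rightarrow> 'g \<Rightarrow> 'g pt \<Rightarrow> 'g pt" where
  "coset_conj G g = (\<lambda>(C, i). (C #>\<^bsub>G\<^esub> (inv\<^bsub>G\<^esub> g), i))"

definition empty_gset :: "('g, 'x) gset" where
  "empty_gset = \<lparr>points = {}, act = (\<lambda>g. \<lambda>x\<in>{}. x)\<rparr>"

definition inl_pt :: "'g pt \<Rightarrow> 'g pt" where "inl_pt = (\<lambda>(C, i). (C, 2 * i))"
definition inr_pt :: "'g pt \<Rightarrow> 'g pt" where "inr_pt = (\<lambda>(C, i). (C, 2 * i + 1))"
definition fold_pt :: "'g pt \<Rightarrow> 'g pt" where "fold_pt = (\<lambda>(C, i). (C, i div 2))"

definition double_gset :: "('g, 'g pt) gset \<Rightarrow> ('g, 'g pt) gset" where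
  "double_gset X =
     (let P = inl_pt ` points X \<union> inr_pt ` points X
      in \<lparr>points = P,
          act = (\<lambda>g. \<lambda>z\<in>P. (if even (snd z) then inl_pt else inr_pt) (act X g (fold_pt z)))\<rparr>)"


section \<open>The category of bispans\<close>

text \<open>The bispan \<open>X \<leftarrow> A \<rightarrow> B \<rightarrow> Y\<close> with maps \<open>p\<close>, \<open>n\<close>, \<open>t\<close>.\<close>

record ('g, 'x, 'a, 'b) bispan =
  bX :: "('g, 'x) gset"
  bA :: "('g, 'a) gset"
  bB :: "('g, 'b) gset"
  bY :: "('g, 'x) gset"
  bp :: "'a \<Rightarrow> 'x"
  bn :: "'a \<Rightarrow> 'b"
  bt :: "'b \<Rightarrow> 'x"

type_synonym 'g pbispan = "('g, 'g pt, 'g pt, 'g pt) bispan"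

definition is_bispan :: "('g, 'm) monoid_scheme \<Rightarrow> ('g, 'x, 'a, 'b) bispan \<Rightarrow> bool" where
  "is_bispan G \<beta> \<longleftrightarrow>
     finite_gset G (bX \<beta>) \<and> finite_gset G (bA \<beta>) \<and> finite_gset G (bB \<beta>) \<and> finite_gset G (bY \<beta>) \<and>
     equivariant G (bA \<beta>) (bX \<beta>) (bp \<beta>) \<and>
     equivariant G (bA \<beta>) (bB \<beta>) (bn \<beta>) \<and>
     equivariant G (bB \<beta>) (bY \<beta>) (bt \<beta>)"

definition bispan_iso ::
    "('g, 'm) monoid_scheme \<Rightarrow> ('g, 'x, 'a, 'b) bispan \<Rightarrow> ('g, 'x, 'c, 'd) bispan \<Rightarrow> bool" where
  "bispan_iso G \<beta> \<gamma> \<longleftrightarrow>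
     bX \<beta> = bX \<gamma> \<and> bY \<beta> = bY \<gamma> \<and>
     (\<exists>i j. gset_iso G (bA \<beta>) (bA \<gamma>) i \<and> gset_iso G (bB \<beta>) (bB \<gamma>) j \<and>
        (\<forall>a\<in>points (bA \<beta>). bp \<gamma> (i a) = bp \<beta> a \<and> bn \<gamma> (i a) = j (bn \<beta> a)) \<and>
        (\<forall>b\<in>points (bB \<beta>). bt \<gamma> (j b) = bt \<beta> b))"

text \<open>The composite of \<open>X \<leftarrow> A \<rightarrow> B \<rightarrow> Y\<close> (called \<open>\<beta>\<close>) followed by \<open>Y \<leftarrow> C \<rightarrow> D \<rightarrow> Z\<close> (called
  \<open>\<gamma>\<close>). With \<open>Q = B \<times>\<^sub>Y C\<close>, \<open>R\<close> the dependent product of \<open>Q \<rightarrow> C\<close> along \<open>C \<rightarrow> D\<close>, and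
  \<open>E = C \<times>\<^sub>D R\<close>, there is the evaluation map \<open>E \<rightarrow> Q\<close>, and the composite is
  \<open>X \<leftarrow> A \<times>\<^sub>B E \<rightarrow> R \<rightarrow> Z\<close>. Here \<open>A \<times>\<^sub>B E\<close> is \<open>(A \<times>\<^sub>B Q) \<times>\<^sub>Q E\<close> by pasting of pullbacks.\<close>

definition bispan_comp ::
    "('g, 'm) monoid_scheme \<Rightarrow> ('g, 'x, 'c, 'd) bispan \<Rightarrow> ('g, 'x, 'a, 'b) bispan \<Rightarrow>
     ('g, 'x, 'a \<times> 'c \<times> 'd \<times> ('c \<Rightarrow> 'b \<times> 'c), 'd \<times> ('c \<Rightarrow> 'b \<times> 'c)) bispan" where
  "bispan_comp G \<gamma> \<beta> =
     (let Q = pullback_gset (bB \<beta>) (bt \<beta>) (bA \<gamma>) (bp \<gamma>);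
          R = dep_prod_gset G Q snd (bA \<gamma>) (bn \<gamma>) (bB \<gamma>);
          E = pullback_gset (bA \<gamma>) (bn \<gamma>) R fst;
          ev = (\<lambda>(c, d, s). s c)
      in \<lparr>bX = bX \<beta>,
          bA = pullback_gset (bA \<beta>) (bn \<beta>) E (fst \<circ> ev),
          bB = R,
          bY = bY \<gamma>,
          bp = bp \<beta> \<circ> fst,
          bn = snd \<circ> snd,
          bt = bt \<gamma> \<circ> fst\<rparr>)"

definition bispan_class :: "('g, 'm) monoid_scheme \<Rightarrow> 'g pbispan \<Rightarrow> 'g pbispan set" where
  "bispan_class G \<beta> = {\<gamma>. is_bispan G \<gamma> \<and> bispan_iso G \<beta> \<gamma>}"

definition admissible ::
    "('g, 'm) monoid_scheme \<Rightarrow> ('g set \<times> 'g set) set \<Rightarrow> ('g set \<times> 'g set) set \<Rightarrow>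
     ('g, 'x, 'a, 'b) bispan \<Rightarrow> bool" where
  "admissible G \<O>m \<O>a \<beta> \<longleftrightarrow>
     (\<forall>a\<in>points (bA \<beta>).
        (stabilizer G (act (bA \<beta>)) a, stabilizer G (act (bB \<beta>)) (bn \<beta> a)) \<in> \<O>m) \<and>
     (\<forall>b\<in>points (bB \<beta>).
        (stabilizer G (act (bB \<beta>)) b, stabilizer G (act (bY \<beta>)) (bt \<beta> b)) \<in> \<O>a)"

definition bispan_hom ::
    "('g, 'm) monoid_scheme \<Rightarrow> ('g set \<times> 'g set) set \<Rightarrow> ('g set \<times> 'g set) set \<Rightarrow>
     ('g, 'g pt) gset \<Rightarrow> ('g, 'g pt) gset \<Rightarrow> 'g pbispan set set" where
  "bispan_hom G \<O>m \<O>a X Y =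
     {bispan_class G \<beta> | \<beta>. is_bispan G \<beta> \<and> bX \<beta> = X \<and> bY \<beta> = Y \<and> admissible G \<O>m \<O>a \<beta>}"

definition class_comp ::
    "('g, 'm) monoid_scheme \<Rightarrow> 'g pbispan set \<Rightarrow> 'g pbispan set \<Rightarrow> 'g pbispan set" where
  "class_comp G v u =
     {\<delta>. is_bispan G \<delta> \<and>
        (\<exists>\<beta>\<in>u. \<exists>\<gamma>\<in>v. bY \<beta> = bX \<gamma> \<and> bispan_iso G \<delta> (bispan_comp G \<gamma> \<beta>))}"

definition res_map ::
    "('g, 'm) monoid_scheme \<Rightarrow> ('g, 'g pt) gset \<Rightarrow> ('g, 'g pt) gset \<Rightarrow> ('g pt \<Rightarrow> 'g pt) \<Rightarrow>
     'g pbispan set" where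
  "res_map G X Y f =
     bispan_class G \<lparr>bX = Y, bA = X, bB = X, bY = X, bp = f, bn = id, bt = id\<rparr>"

definition nm_map ::
    "('g, 'm) monoid_scheme \<Rightarrow> ('g, 'g pt) gset \<Rightarrow> ('g, 'g pt) gset \<Rightarrow> ('g pt \<Rightarrow> 'g pt) \<Rightarrow>
     'g pbispan set" where
  "nm_map G X Y f =
     bispan_class G \<lparr>bX = X, bA = X, bB = Y, bY = Y, bp = id, bn = f, bt = id\<rparr>"

definition tr_map ::
    "('g, 'm) monoid_scheme \<Rightarrow> ('g, 'g pt) gset \<Rightarrow> ('g, 'g pt) gset \<Rightarrow> ('g pt \<Rightarrow> 'g pt) \<Rightarrow>
     'g pbispan set" where
  "tr_map G X Y f =
     bispan_class G \<lparr>bX = X, bA = X, bB = X, bY = Y, bp = id, bn = id, bt = f\<rparr>"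

definition is_product ::
    "('g, 'm) monoid_scheme \<Rightarrow> ('g set \<times> 'g set) set \<Rightarrow> ('g set \<times> 'g set) set \<Rightarrow>
     ('g, 'g pt) gset \<Rightarrow> ('g, 'g pt) gset \<Rightarrow> ('g, 'g pt) gset \<Rightarrow>
     'g pbispan set \<Rightarrow> 'g pbispan set \<Rightarrow> bool" where
  "is_product G \<O>m \<O>a X Y Z u v \<longleftrightarrow>
     finite_gset G X \<and> finite_gset G Y \<and> finite_gset G Z \<and>
     u \<in> bispan_hom G \<O>m \<O>a Z X \<and> v \<in> bispan_hom G \<O>m \<O>a Z Y \<and>
     (\<forall>W. finite_gset G W \<longrightarrow>
        (\<forall>f\<in>bispan_hom G \<O>m \<O>a W X. \<forall>h\<in>bispan_hom G \<O>m \<O>a W Y.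
           \<exists>!k. k \<in> bispan_hom G \<O>m \<O>a W Z \<and> class_comp G u k = f \<and> class_comp G v k = h))"

definition is_terminal ::
    "('g, 'm) monoid_scheme \<Rightarrow> ('g set \<times> 'g set) set \<Rightarrow> ('g set \<times> 'g set) set \<Rightarrow>
     ('g, 'g pt) gset \<Rightarrow> bool" where
  "is_terminal G \<O>m \<O>a Z \<longleftrightarrow>
     finite_gset G Z \<and> (\<forall>W. finite_gset G W \<longrightarrow> (\<exists>!k. k \<in> bispan_hom G \<O>m \<O>a W Z))"


section \<open>Tambara functors\<close>

text \<open>The data of a functor to sets: the values on objects and on morphisms.\<close>

record ('g, 'b) tfunctor =
  tob :: "('g, 'g pt) gset \<Rightarrow> 'b set"
  tmor :: "'g pbispan set \<Rightarrow> 'b \<Rightarrow> 'b"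

definition set_functor ::
    "('g, 'm) monoid_scheme \<Rightarrow> ('g set \<times> 'g set) set \<Rightarrow> ('g set \<times> 'g set) set \<Rightarrow>
     ('g, 'b) tfunctor \<Rightarrow> bool" where
  "set_functor G \<O>m \<O>a T \<longleftrightarrow>
     (\<forall>X Y. finite_gset G X \<and> finite_gset G Y \<longrightarrow>
        (\<forall>u\<in>bispan_hom G \<O>m \<O>a X Y. tmor T u \<in> tob T X \<rightarrow>\<^sub>E tob T Y)) \<and>
     (\<forall>X. finite_gset G X \<longrightarrow> tmor T (res_map G X X id) = (\<lambda>x\<in>tob T X. x)) \<and>
     (\<forall>X Y Z. finite_gset G X \<and> finite_gset G Y \<and> finite_gset G Z \<longrightarrow>
        (\<forall>u\<in>bispan_hom G \<O>m \<O>a X Y. \<forall>v\<in>bispan_hom G \<O>m \<O>a Y Z.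
           tmor T (class_comp G v u) = compose (tob T X) (tmor T v) (tmor T u)))"

definition product_preserving ::
    "('g, 'm) monoid_scheme \<Rightarrow> ('g set \<times> 'g set) set \<Rightarrow> ('g set \<times> 'g set) set \<Rightarrow>
     ('g, 'b) tfunctor \<Rightarrow> bool" where
  "product_preserving G \<O>m \<O>a T \<longleftrightarrow>
     (\<forall>X Y Z u v. is_product G \<O>m \<O>a X Y Z u v \<longrightarrow>
        bij_betw (\<lambda>z. (tmor T u z, tmor T v z)) (tob T Z) (tob T X \<times> tob T Y)) \<and>
     (\<forall>Z. is_terminal G \<O>m \<O>a Z \<longrightarrow> (\<exists>!z. z \<in> tob T Z))"

text \<open>The semiring structure on \<open>T(X)\<close>: under \<open>T(X \<squnion> X) \<cong> T(X) \<times> T(X)\<close>, addition and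
  multiplication are the transfer and the norm along the fold map \<open>X \<squnion> X \<rightarrow> X\<close>; zero and one are the
  transfer and the norm along \<open>\<emptyset> \<rightarrow> X\<close>.\<close>

definition tpair ::
    "('g, 'm) monoid_scheme \<Rightarrow> ('g, 'b) tfunctor \<Rightarrow> ('g, 'g pt) gset \<Rightarrow> 'b \<Rightarrow> 'b \<Rightarrow> 'b" where
  "tpair G T X x y =
     (THE z. z \<in> tob T (double_gset X) \<and>
        tmor T (res_map G X (double_gset X) inl_pt) z = x \<and>
        tmor T (res_map G X (double_gset X) inr_pt) z = y)"

definition level_ring ::
    "('g, 'm) monoid_scheme \<Rightarrow> ('g, 'b) tfunctor \<Rightarrow> ('g, 'g pt) gset \<Rightarrow> 'b ring" where
  "level_ring G T X =
     \<lparr>carrier = tob T X,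
      mult = (\<lambda>x y. tmor T (nm_map G (double_gset X) X fold_pt) (tpair G T X x y)),
      one = tmor T (nm_map G empty_gset X id) (THE z. z \<in> tob T empty_gset),
      zero = tmor T (tr_map G empty_gset X id) (THE z. z \<in> tob T empty_gset),
      add = (\<lambda>x y. tmor T (tr_map G (double_gset X) X fold_pt) (tpair G T X x y))\<rparr>"

definition tambara_functor ::
    "('g, 'm) monoid_scheme \<Rightarrow> ('g set \<times> 'g set) set \<Rightarrow> ('g set \<times> 'g set) set \<Rightarrow>
     ('g, 'b) tfunctor \<Rightarrow> bool" where
  "tambara_functor G \<O>m \<O>a T \<longleftrightarrow>
     compatible G \<O>m \<O>a \<and> set_functor G \<O>m \<O>a T \<and> product_preserving G \<O>m \<O>a T \<and>
     (\<forall>X. finite_gset G X \<longrightarrow> cring (level_ring G T X))"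

text \<open>Restriction along the inclusion of the wide subcategory belonging to \<open>(\<O>m, \<O>a)\<close>.\<close>

definition forget ::
    "('g, 'm) monoid_scheme \<Rightarrow> ('g set \<times> 'g set) set \<Rightarrow> ('g set \<times> 'g set) set \<Rightarrow>
     ('g, 'b) tfunctor \<Rightarrow> ('g, 'b) tfunctor" where
  "forget G \<O>m \<O>a T =
     \<lparr>tob = tob T, tmor = restrict (tmor T) (\<Union>X Y. bispan_hom G \<O>m \<O>a X Y)\<rparr>"

abbreviation level ::
    "('g, 'm) monoid_scheme \<Rightarrow> ('g, 'b) tfunctor \<Rightarrow> 'g set \<Rightarrow> 'b ring" where
  "level G T H \<equiv> level_ring G T (coset_gset G H)"

definition res ::
    "('g, 'm) monoid_scheme \<Rightarrow> ('g, 'b) tfunctor \<Rightarrow> 'g set \<Rightarrow> 'g set \<Rightarrow> 'b \<Rightarrow> 'b" where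
  "res G T H K = tmor T (res_map G (coset_gset G K) (coset_gset G H) (coset_proj G H))"

definition tr ::
    "('g, 'm) monoid_scheme \<Rightarrow> ('g, 'b) tfunctor \<Rightarrow> 'g set \<Rightarrow> 'g set \<Rightarrow> 'b \<Rightarrow> 'b" where
  "tr G T K H = tmor T (tr_map G (coset_gset G K) (coset_gset G H) (coset_proj G H))"

definition nm ::
    "('g, 'm) monoid_scheme \<Rightarrow> ('g, 'b) tfunctor \<Rightarrow> 'g set \<Rightarrow> 'g set \<Rightarrow> 'b \<Rightarrow> 'b" where
  "nm G T K H = tmor T (nm_map G (coset_gset G K) (coset_gset G H) (coset_proj G H))"

definition cj ::
    "('g, 'm) monoid_scheme \<Rightarrow> ('g, 'b) tfunctor \<Rightarrow> 'g set \<Rightarrow> 'g \<Rightarrow> 'b \<Rightarrow> 'b" where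
  "cj G T H g =
     tmor T (tr_map G (coset_gset G H) (coset_gset G (conjugate G g H)) (coset_conj G g))"

definition mult_cohomological ::
    "('g, 'm) monoid_scheme \<Rightarrow> ('g, 'b) tfunctor \<Rightarrow> bool" where
  "mult_cohomological G T \<longleftrightarrow>
     (\<forall>H K. subgroup H G \<and> subgroup K G \<and> K \<subset> H \<longrightarrow>
        (\<forall>x\<in>carrier (level G T H).
           nm G T K H (res G T H K x) =
             x [^]\<^bsub>level G T H\<^esub> card (rcosets\<^bsub>G\<lparr>carrier := H\<rparr>\<^esub> K)))"


section \<open>Prime ideals and the spectrum\<close>

text \<open>An ideal is indexed by the subgroups of \<open>G\<close>; it is taken to be \<open>undefined\<close> elsewhere, so that
  equality of ideals is equality of the families.\<close>

definition tideal ::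
    "('g, 'm) monoid_scheme \<Rightarrow> ('g set \<times> 'g set) set \<Rightarrow> ('g set \<times> 'g set) set \<Rightarrow>
     ('g, 'b) tfunctor \<Rightarrow> ('g set \<Rightarrow> 'b set) \<Rightarrow> bool" where
  "tideal G \<O>m \<O>a T I \<longleftrightarrow>
     I \<in> extensional {H. subgroup H G} \<and>
     (\<forall>H. subgroup H G \<longrightarrow> ideal (I H) (level G T H)) \<and>
     (\<forall>H K. subgroup H G \<and> subgroup K G \<and> K \<subseteq> H \<longrightarrow> res G T H K ` I H \<subseteq> I K) \<and>
     (\<forall>H. \<forall>g\<in>carrier G. subgroup H G \<longrightarrow> cj G T H g ` I H \<subseteq> I (conjugate G g H)) \<and>
     (\<forall>(K, H)\<in>\<O>a. tr G T K H ` I K \<subseteq> I H) \<and>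
     (\<forall>(K, H)\<in>\<O>m. nm G T K H ` I K \<subseteq> I H)"

definition Qcond ::
    "('g, 'm) monoid_scheme \<Rightarrow> ('g set \<times> 'g set) set \<Rightarrow> ('g, 'b) tfunctor \<Rightarrow>
     ('g set \<Rightarrow> 'b set) \<Rightarrow> 'g set \<Rightarrow> 'g set \<Rightarrow> 'b \<Rightarrow> 'b \<Rightarrow> bool" where
  "Qcond G \<O>m T I H1 H2 x y \<longleftrightarrow>
     (\<forall>K1 K2 L. \<forall>g1\<in>carrier G. \<forall>g2\<in>carrier G.
        subgroup K1 G \<and> K1 \<subseteq> H1 \<and> subgroup K2 G \<and> K2 \<subseteq> H2 \<and> subgroup L G \<and>
        (conjugate G g1 K1, L) \<in> \<O>m \<and> (conjugate G g2 K2, L) \<in> \<O>m \<longrightarrow>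
        nm G T (conjugate G g1 K1) L (cj G T K1 g1 (res G T H1 K1 x)) \<otimes>\<^bsub>level G T L\<^esub>
        nm G T (conjugate G g2 K2) L (cj G T K2 g2 (res G T H2 K2 y)) \<in> I L)"

definition prime_tideal ::
    "('g, 'm) monoid_scheme \<Rightarrow> ('g set \<times> 'g set) set \<Rightarrow> ('g set \<times> 'g set) set \<Rightarrow>
     ('g, 'b) tfunctor \<Rightarrow> ('g set \<Rightarrow> 'b set) \<Rightarrow> bool" where
  "prime_tideal G \<O>m \<O>a T P \<longleftrightarrow>
     tideal G \<O>m \<O>a T P \<and>
     (\<exists>H. subgroup H G \<and> P H \<noteq> carrier (level G T H)) \<and>
     (\<forall>H1 H2. \<forall>x\<in>carrier (level G T H1). \<forall>y\<in>carrier (level G T H2).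
        subgroup H1 G \<and> subgroup H2 G \<and> Qcond G \<O>m T P H1 H2 x y \<longrightarrow> x \<in> P H1 \<or> y \<in> P H2)"

definition Vset ::
    "('g, 'm) monoid_scheme \<Rightarrow> ('g set \<times> 'g set) set \<Rightarrow> ('g set \<times> 'g set) set \<Rightarrow>
     ('g, 'b) tfunctor \<Rightarrow> ('g set \<Rightarrow> 'b set) \<Rightarrow> ('g set \<Rightarrow> 'b set) set" where
  "Vset G \<O>m \<O>a T I = {P. prime_tideal G \<O>m \<O>a T P \<and> (\<forall>H. subgroup H G \<longrightarrow> I H \<subseteq> P H)}"

text \<open>The complements of the \<open>V(I)\<close> form a subbasis. They cover the set of prime ideals, because
  \<open>V(T)\<close> is empty.\<close>

definition Spec ::
    "('g, 'm) monoid_scheme \<Rightarrow> ('g set \<times> 'g set) set \<Rightarrow> ('g set \<times> 'g set) set \<Rightarrow>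
     ('g, 'b) tfunctor \<Rightarrow> ('g set \<Rightarrow> 'b set) topology" where
  "Spec G \<O>m \<O>a T =
     topology_generated_by
       {Collect (prime_tideal G \<O>m \<O>a T) - Vset G \<O>m \<O>a T I | I. tideal G \<O>m \<O>a T I}"

end

theory Submission
  imports Defs
begin

text \<open>The hull of \<open>\<O>m\<close> consists of the pairs \<open>(B, C)\<close> with \<open>(A, C) \<in> \<O>m\<close> for some \<open>A \<le> B\<close>. For such
  pairs \<open>nm\<^sub>A\<^sup>C res\<^sub>A\<^sup>B x\<close> is a positive power of \<open>nm\<^sub>B\<^sup>C x\<close>, because \<open>T\<close> is multiplicatively cohomological.
  Prime ideals are radical at every level. Hence an \<open>\<O>m\<close>-prime ideal is closed under the norms of the
  hull, the conditions \<open>Q\<close> for \<open>\<O>m\<close> and for the hull agree on primes, and the two spectra have the same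
  points. They have the same closed sets, since replacing an \<open>\<O>m\<close>-ideal by the intersection of the
  hull-ideals containing it does not change the primes above it.

  Radicality rests on the double coset formula for restrictions of norms. This is read off from the
  composition of bispans: \<open>T\<close> has base change along pullbacks, and it sends disjoint unions to products.\<close>

subsection \<open>Finite G-sets\<close>

text \<open>The hard point is radicality. For the pair \<open>y\<close>, \<open>y\<close> the
  condition Q asks for products of two norms of possibly different conjugated restrictions of
  \<open>y\<close>, and a power of \<open>y\<close> in the ideal does not put these mixed products
  there. So all such norms are treated together: there are finitely many at each level, each has a
  power in the ideal, hence every long enough product of them lies in the ideal, and primality
  shortens the length required. This needs a norm of a restriction of a norm of \<open>y\<close> to
  be a product of norms of \<open>y\<close>. That is the double coset formula, obtained without
  coset representatives by cutting a pullback of G-sets into orbits.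

  Bispans bring an obstacle of their own: morphisms are isomorphism classes, composites live in
  another type than their factors, and \<open>class_comp\<close> ranges over all representatives. So
  a candidate is compared with the composites through an isomorphism given in coordinates. Transfers
  are never composed as such: conjugations, though defined as transfers, are restrictions along the
  inverse isomorphism.\<close>

context group
begin

text \<open>The inverse of \<open>act X g\<close> is \<open>act X (inv g)\<close>, so closure and
  the two action laws give bijectivity. Extensionality is asked for because the elements of
  \<open>BijGroup\<close> are undefined outside the set.\<close>

lemma finite_gsetI:
  assumes fin: "finite (points X)"
    and ext: "\<And>g. g \<in> carrier G \<Longrightarrow> act X g \<in> extensional (points X)"
    and cl: "\<And>g x. g \<in> carrier G \<Longrightarrow> x \<in> points X \<Longrightarrow> act X g x \<in> points X"
    and one: "\<And>x. x \<in> points X \<Longrightarrow> act X \<one> x = x"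
    and mult: "\<And>g h x. g \<in> carrier G \<Longrightarrow> h \<in> carrier G \<Longrightarrow> x \<in> points X \<Longrightarrow>
      act X (g \<otimes> h) x = act X g (act X h x)"
  shows "finite_gset G X"
proof -
  have b: "act X g \<in> Bij (points X)" if g: "g \<in> carrier G" for g
  proof -
    have "bij_betw (act X g) (points X) (points X)"
    proof (rule bij_betw_byWitness[where f' = "act X (inv g)"])
      show "\<forall>a\<in>points X. act X (inv g) (act X g a) = a"
        using mult[symmetric, of "inv g" g] g one by auto
      show "\<forall>a\<in>points X. act X g (act X (inv g) a) = a"
        using mult[symmetric, of g "inv g"] g one by auto
    qed (use cl g in auto)
    then show ?thesis using ext[OF g] by (simp add: Bij_def)
  qed
  have "group_action G (points X) (act X)"
    unfolding group_action_def group_hom_def group_hom_axioms_def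
  proof (intro conjI group_BijGroup homI)
    show "group G" by (rule is_group)
  next
    fix g assume "g \<in> carrier G"
    then show "act X g \<in> carrier (BijGroup (points X))" using b by (simp add: BijGroup_def)
  next
    fix g h assume gh: "g \<in> carrier G" "h \<in> carrier G"
    show "act X (g \<otimes> h) = act X g \<otimes>\<^bsub>BijGroup (points X)\<^esub> act X h"
    proof
      fix x
      show "act X (g \<otimes> h) x = (act X g \<otimes>\<^bsub>BijGroup (points X)\<^esub> act X h) x"
        using gh ext[of "g \<otimes> h"] b
        by (cases "x \<in> points X") (auto simp: BijGroup_def compose_def mult extensional_def)
    qed
  qed
  then show ?thesis using fin by (simp add: finite_gset_def)
qed

lemma gset_finite: "finite_gset G X \<Longrightarrow> finite (points X)"
  by (simp add: finite_gset_def)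

lemma gset_closed: "finite_gset G X \<Longrightarrow> g \<in> carrier G \<Longrightarrow> x \<in> points X \<Longrightarrow> act X g x \<in> points X"
  unfolding finite_gset_def by (meson group_action.element_image)

lemma gset_one: "finite_gset G X \<Longrightarrow> x \<in> points X \<Longrightarrow> act X \<one> x = x"
  unfolding finite_gset_def by (metis group_action.id_eq_one restrict_apply')

lemma gset_mult: "finite_gset G X \<Longrightarrow> g \<in> carrier G \<Longrightarrow> h \<in> carrier G \<Longrightarrow> x \<in> points X \<Longrightarrow>
    act X (g \<otimes> h) x = act X g (act X h x)"
  unfolding finite_gset_def by (metis group_action.composition_rule)

lemma gset_inv_act: "finite_gset G X \<Longrightarrow> g \<in> carrier G \<Longrightarrow> x \<in> points X \<Longrightarrow>
    act X (inv g) (act X g x) = x"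
  by (metis gset_mult gset_one inv_closed l_inv)

lemma gset_act_inv: "finite_gset G X \<Longrightarrow> g \<in> carrier G \<Longrightarrow> x \<in> points X \<Longrightarrow>
    act X g (act X (inv g) x) = x"
  by (metis gset_mult gset_one inv_closed r_inv)

lemma stabilizer_sub: "finite_gset G X \<Longrightarrow> x \<in> points X \<Longrightarrow> subgroup (stabilizer G (act X) x) G"
  unfolding finite_gset_def by (metis group_action.stabilizer_subgroup)

lemma equivariantI:
  assumes "\<And>x. x \<in> points X \<Longrightarrow> f x \<in> points Y"
    and "\<And>g x. g \<in> carrier G \<Longrightarrow> x \<in> points X \<Longrightarrow> f (act X g x) = act Y g (f x)"
  shows "equivariant G X Y f"
  using assms by (auto simp: equivariant_def)

lemma equivariant_closed: "equivariant G X Y f \<Longrightarrow> x \<in> points X \<Longrightarrow> f x \<in> points Y"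
  by (auto simp: equivariant_def)

lemma equivariant_act: "equivariant G X Y f \<Longrightarrow> g \<in> carrier G \<Longrightarrow> x \<in> points X \<Longrightarrow>
    f (act X g x) = act Y g (f x)"
  by (auto simp: equivariant_def)

lemma equivariant_comp: "equivariant G X Y f \<Longrightarrow> equivariant G Y Z h \<Longrightarrow> equivariant G X Z (h \<circ> f)"
  by (auto simp: equivariant_def Pi_def)

lemma equivariant_id: "equivariant G X X id"
  by (auto simp: equivariant_def)

lemma equivariant_inv:
  assumes X: "finite_gset G X" and f: "equivariant G X Y f" and b: "bij_betw f (points X) (points Y)"
  shows "equivariant G Y X (inv_into (points X) f)"
proof (rule equivariantI)
  fix y assume "y \<in> points Y"
  then show "inv_into (points X) f y \<in> points X"
    using b by (simp add: bij_betw_def inv_into_into)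
next
  fix g y assume g: "g \<in> carrier G" and "y \<in> points Y"
  then obtain x where x: "x \<in> points X" "y = f x" using b by (auto simp: bij_betw_def)
  have "inv_into (points X) f (act Y g y) = inv_into (points X) f (f (act X g x))"
    using x g f by (simp add: equivariant_act)
  also have "\<dots> = act X g x"
    using b x g X by (simp add: bij_betw_inv_into_left gset_closed)
  also have "\<dots> = act X g (inv_into (points X) f y)" using b x by (simp add: bij_betw_inv_into_left)
  finally show "inv_into (points X) f (act Y g y) = act X g (inv_into (points X) f y)" .
qed

lemma gset_iso_sym: "finite_gset G X \<Longrightarrow> gset_iso G X Y f \<Longrightarrow> gset_iso G Y X (inv_into (points X) f)"
  unfolding gset_iso_def by (simp add: equivariant_inv bij_betw_inv_into)

lemma gset_iso_trans: "gset_iso G X Y f \<Longrightarrow> gset_iso G Y Z h \<Longrightarrow> gset_iso G X Z (h \<circ> f)"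
  unfolding gset_iso_def using bij_betw_trans equivariant_comp by blast

lemma stabilizer_mono:
  assumes "equivariant G X Y f" "x \<in> points X"
  shows "stabilizer G (act X) x \<subseteq> stabilizer G (act Y) (f x)"
  using assms unfolding stabilizer_def by (auto simp flip: equivariant_act)

lemma stabilizer_inj:
  assumes X: "finite_gset G X" and "equivariant G X Y f" "inj_on f (points X)" "x \<in> points X"
  shows "stabilizer G (act Y) (f x) = stabilizer G (act X) x"
proof
  show "stabilizer G (act Y) (f x) \<subseteq> stabilizer G (act X) x"
  proof
    fix g assume "g \<in> stabilizer G (act Y) (f x)"
    then have g: "g \<in> carrier G" and "f (act X g x) = f x"
      using assms by (auto simp: stabilizer_def equivariant_act)
    then have "act X g x = x" using assms gset_closed[OF X g] by (meson inj_onD)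
    then show "g \<in> stabilizer G (act X) x" using g by (simp add: stabilizer_def)
  qed
qed (rule stabilizer_mono[OF assms(2,4)])

subsection \<open>Isomorphisms of bispans\<close>

lemma bispanD:
  assumes "is_bispan G \<beta>"
  shows "finite_gset G (bX \<beta>)" "finite_gset G (bA \<beta>)" "finite_gset G (bB \<beta>)" "finite_gset G (bY \<beta>)"
    "equivariant G (bA \<beta>) (bX \<beta>) (bp \<beta>)" "equivariant G (bA \<beta>) (bB \<beta>) (bn \<beta>)"
    "equivariant G (bB \<beta>) (bY \<beta>) (bt \<beta>)"
  using assms by (auto simp: is_bispan_def)

lemma bispan_iso_refl: "bispan_iso G \<beta> \<beta>"
  unfolding bispan_iso_def by (auto intro!: exI[of _ id] simp: gset_iso_def equivariant_id)

lemma bispan_iso_sym: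
  assumes \<beta>: "is_bispan G \<beta>" and iso: "bispan_iso G \<beta> \<gamma>"
  shows "bispan_iso G \<gamma> \<beta>"
proof -
  obtain i j where i: "gset_iso G (bA \<beta>) (bA \<gamma>) i" and j: "gset_iso G (bB \<beta>) (bB \<gamma>) j"
    and a: "\<And>a. a \<in> points (bA \<beta>) \<Longrightarrow> bp \<gamma> (i a) = bp \<beta> a \<and> bn \<gamma> (i a) = j (bn \<beta> a)"
    and b: "\<And>b. b \<in> points (bB \<beta>) \<Longrightarrow> bt \<gamma> (j b) = bt \<beta> b"
    and e: "bX \<beta> = bX \<gamma>" "bY \<beta> = bY \<gamma>"
    using iso unfolding bispan_iso_def by blast
  let ?i = "inv_into (points (bA \<beta>)) i" and ?j = "inv_into (points (bB \<beta>)) j"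
  have ib: "bij_betw i (points (bA \<beta>)) (points (bA \<gamma>))"
    and jb: "bij_betw j (points (bB \<beta>)) (points (bB \<gamma>))"
    using i j by (auto simp: gset_iso_def)
  have 1: "bp \<beta> (?i a) = bp \<gamma> a \<and> bn \<beta> (?i a) = ?j (bn \<gamma> a)" if m: "a \<in> points (bA \<gamma>)" for a
  proof -
    obtain a' where a': "a' \<in> points (bA \<beta>)" "a = i a'"
      using ib m by (metis bij_betw_imp_surj_on imageE)
    then have "?i a = a'" using ib by (simp add: bij_betw_inv_into_left)
    then show ?thesis
      using a[OF a'(1)] a' jb equivariant_closed[OF bispanD(6)[OF \<beta>] a'(1)]
      by (simp add: bij_betw_inv_into_left)
  qed
  have 2: "bt \<beta> (?j b') = bt \<gamma> b'" if m: "b' \<in> points (bB \<gamma>)" for b'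
  proof -
    obtain b'' where b': "b'' \<in> points (bB \<beta>)" "b' = j b''"
      using jb m by (metis bij_betw_imp_surj_on imageE)
    then show ?thesis using b[OF b'(1)] jb by (simp add: bij_betw_inv_into_left)
  qed
  show ?thesis unfolding bispan_iso_def
    using gset_iso_sym[OF bispanD(2)[OF \<beta>] i] gset_iso_sym[OF bispanD(3)[OF \<beta>] j] 1 2 e by auto
qed

text \<open>Only \<open>\<beta>\<close> is constrained, because \<open>\<delta>\<close> is often a
  composite, which is never shown to be a bispan.\<close>

lemma bispan_iso_trans:
  assumes "bispan_iso G \<beta> \<gamma>" "bispan_iso G \<gamma> \<delta>" and \<beta>: "equivariant G (bA \<beta>) (bB \<beta>) (bn \<beta>)"
  shows "bispan_iso G \<beta> \<delta>"
proof -
  obtain i j where i: "gset_iso G (bA \<beta>) (bA \<gamma>) i" and j: "gset_iso G (bB \<beta>) (bB \<gamma>) j"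
    and a: "\<And>a. a \<in> points (bA \<beta>) \<Longrightarrow> bp \<gamma> (i a) = bp \<beta> a \<and> bn \<gamma> (i a) = j (bn \<beta> a)"
    and b: "\<And>b. b \<in> points (bB \<beta>) \<Longrightarrow> bt \<gamma> (j b) = bt \<beta> b"
    and e: "bX \<beta> = bX \<gamma>" "bY \<beta> = bY \<gamma>"
    using assms unfolding bispan_iso_def by blast
  obtain i' j' where i': "gset_iso G (bA \<gamma>) (bA \<delta>) i'" and j': "gset_iso G (bB \<gamma>) (bB \<delta>) j'"
    and a': "\<And>a. a \<in> points (bA \<gamma>) \<Longrightarrow> bp \<delta> (i' a) = bp \<gamma> a \<and> bn \<delta> (i' a) = j' (bn \<gamma> a)"
    and b': "\<And>b. b \<in> points (bB \<gamma>) \<Longrightarrow> bt \<delta> (j' b) = bt \<gamma> b"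
    and e': "bX \<gamma> = bX \<delta>" "bY \<gamma> = bY \<delta>"
    using assms unfolding bispan_iso_def by blast
  have "i x \<in> points (bA \<gamma>)" if "x \<in> points (bA \<beta>)" for x
    using i that unfolding gset_iso_def by (meson equivariant_closed)
  moreover have "j x \<in> points (bB \<gamma>)" if "x \<in> points (bB \<beta>)" for x
    using j that unfolding gset_iso_def by (meson equivariant_closed)
  ultimately show ?thesis
    unfolding bispan_iso_def using gset_iso_trans[OF i i'] gset_iso_trans[OF j j'] a b a' b' e e'
    by (intro conjI exI[of _ "i' \<circ> i"] exI[of _ "j' \<circ> j"]) auto
qed

lemma bispan_class_eqI:
  assumes \<beta>: "is_bispan G \<beta>" and \<gamma>: "is_bispan G \<gamma>" and iso: "bispan_iso G \<beta> \<gamma>"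
  shows "bispan_class G \<beta> = bispan_class G \<gamma>"
  using bispan_iso_trans[OF iso] bispan_iso_trans[OF bispan_iso_sym[OF \<beta> iso]]
    bispanD[OF \<beta>] bispanD[OF \<gamma>]
  by (auto simp: bispan_class_def)

lemma bispan_class_self: "is_bispan G \<beta> \<Longrightarrow> \<beta> \<in> bispan_class G \<beta>"
  by (simp add: bispan_class_def bispan_iso_refl)

lemma bispan_class_eqD: "is_bispan G \<gamma> \<Longrightarrow> bispan_class G \<beta> = bispan_class G \<gamma> \<Longrightarrow> bispan_iso G \<beta> \<gamma>"
  using bispan_class_self by (auto simp: bispan_class_def)

lemma bispan_isoI:
  assumes "bX \<beta> = bX \<gamma>" "bY \<beta> = bY \<gamma>"
    and "equivariant G (bA \<beta>) (bA \<gamma>) i" "bij_betw i (points (bA \<beta>)) (points (bA \<gamma>))"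
    and "equivariant G (bB \<beta>) (bB \<gamma>) j" "bij_betw j (points (bB \<beta>)) (points (bB \<gamma>))"
    and "\<And>a. a \<in> points (bA \<beta>) \<Longrightarrow> bp \<gamma> (i a) = bp \<beta> a"
    and "\<And>a. a \<in> points (bA \<beta>) \<Longrightarrow> bn \<gamma> (i a) = j (bn \<beta> a)"
    and "\<And>b. b \<in> points (bB \<beta>) \<Longrightarrow> bt \<gamma> (j b) = bt \<beta> b"
  shows "bispan_iso G \<beta> \<gamma>"
  unfolding bispan_iso_def gset_iso_def using assms by blast

text \<open>\<open>class_comp\<close> collects the composites of all pairs of representatives.
  Asking for the isomorphism with every such composite replaces a separate proof that composition
  respects isomorphism.\<close>

lemma class_comp_eqI:
  fixes \<beta> \<gamma> \<delta> :: "'a pbispan"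
  assumes \<beta>: "is_bispan G \<beta>" and \<gamma>: "is_bispan G \<gamma>" and \<delta>: "is_bispan G \<delta>" and eq: "bY \<beta> = bX \<gamma>"
    and iso: "\<And>(\<beta>' :: 'a pbispan) (\<gamma>' :: 'a pbispan). is_bispan G \<beta>' \<Longrightarrow> is_bispan G \<gamma>' \<Longrightarrow> bispan_iso G \<beta> \<beta>' \<Longrightarrow>
      bispan_iso G \<gamma> \<gamma>' \<Longrightarrow> bispan_iso G \<delta> (bispan_comp G \<gamma>' \<beta>')"
  shows "class_comp G (bispan_class G \<gamma>) (bispan_class G \<beta>) = bispan_class G \<delta>"
proof (intro equalityI subsetI)
  fix \<epsilon> assume "\<epsilon> \<in> class_comp G (bispan_class G \<gamma>) (bispan_class G \<beta>)"
  then obtain \<beta>' \<gamma>' :: "'a pbispan" where \<epsilon>: "is_bispan G \<epsilon>" "bispan_iso G \<epsilon> (bispan_comp G \<gamma>' \<beta>')"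
    and "is_bispan G \<beta>'" "is_bispan G \<gamma>'" "bispan_iso G \<beta> \<beta>'" "bispan_iso G \<gamma> \<gamma>'"
    unfolding class_comp_def bispan_class_def by auto
  then have "bispan_iso G \<delta> (bispan_comp G \<gamma>' \<beta>')" by (blast intro: iso)
  then have "bispan_iso G \<delta> \<epsilon>"
    using bispan_iso_trans[OF _ bispan_iso_sym[OF \<epsilon>]] bispanD[OF \<delta>] by blast
  then show "\<epsilon> \<in> bispan_class G \<delta>" using \<epsilon> by (simp add: bispan_class_def)
next
  fix \<epsilon> assume "\<epsilon> \<in> bispan_class G \<delta>"
  then have \<epsilon>: "is_bispan G \<epsilon>" "bispan_iso G \<delta> \<epsilon>" by (auto simp: bispan_class_def)
  have "bispan_iso G \<epsilon> (bispan_comp G \<gamma> \<beta>)"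
    using bispan_iso_trans[OF bispan_iso_sym[OF \<delta> \<epsilon>(2)] iso[OF \<beta> \<gamma> bispan_iso_refl bispan_iso_refl]]
      bispanD[OF \<epsilon>(1)] by blast
  then show "\<epsilon> \<in> class_comp G (bispan_class G \<gamma>) (bispan_class G \<beta>)"
    unfolding class_comp_def using \<epsilon> bispan_class_self[OF \<beta>] bispan_class_self[OF \<gamma>] eq by blast
qed

end

subsection \<open>Composition of bispans\<close>

context group
begin

text \<open>Describes an isomorphism onto a composite by the coordinates of the points: \<open>dd\<close> and
  \<open>\<sigma>\<close> give the base point and the section of the dependent product, \<open>ka\<close> and \<open>cc\<close> the first
  two components of a point of \<open>A \<times>\<^sub>B (C \<times>\<^sub>D R)\<close>.\<close>

lemma bispan_comp_isoI:
  fixes \<beta> :: "('a, 'x, 'p, 'q) bispan" and \<gamma> :: "('a, 'x, 'c, 'd) bispan" and \<delta> :: "('a, 'x, 'e, 'f) bispan"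
  assumes \<beta>: "is_bispan G \<beta>" and \<gamma>: "is_bispan G \<gamma>" and \<delta>: "is_bispan G \<delta>"
    and eq: "bX \<delta> = bX \<beta>" "bY \<delta> = bY \<gamma>"
    and dd: "equivariant G (bB \<delta>) (bB \<gamma>) dd"
    and ddt: "\<And>b. b \<in> points (bB \<delta>) \<Longrightarrow> bt \<gamma> (dd b) = bt \<delta> b"
    and \<sigma>: "\<And>b c. b \<in> points (bB \<delta>) \<Longrightarrow> c \<in> points (bA \<gamma>) \<Longrightarrow> bn \<gamma> c = dd b \<Longrightarrow>
      \<sigma> b c \<in> points (bB \<beta>) \<and> bt \<beta> (\<sigma> b c) = bp \<gamma> c"
    and \<sigma>g: "\<And>g b c. g \<in> carrier G \<Longrightarrow> b \<in> points (bB \<delta>) \<Longrightarrow> c \<in> points (bA \<gamma>) \<Longrightarrow>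
      bn \<gamma> c = dd b \<Longrightarrow> \<sigma> (act (bB \<delta>) g b) (act (bA \<gamma>) g c) = act (bB \<beta>) g (\<sigma> b c)"
    and ka: "equivariant G (bA \<delta>) (bA \<beta>) ka" "\<And>a. a \<in> points (bA \<delta>) \<Longrightarrow> bp \<beta> (ka a) = bp \<delta> a"
    and cc: "equivariant G (bA \<delta>) (bA \<gamma>) cc"
      "\<And>a. a \<in> points (bA \<delta>) \<Longrightarrow> bn \<gamma> (cc a) = dd (bn \<delta> a)"
    and kc: "\<And>a. a \<in> points (bA \<delta>) \<Longrightarrow> bn \<beta> (ka a) = \<sigma> (bn \<delta> a) (cc a)"
    and Bex: "\<And>d s. d \<in> points (bB \<gamma>) \<Longrightarrow>
      (\<And>c. c \<in> points (bA \<gamma>) \<Longrightarrow> bn \<gamma> c = d \<Longrightarrow> s c \<in> points (bB \<beta>) \<and> bt \<beta> (s c) = bp \<gamma> c) \<Longrightarrow>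
      \<exists>b\<in>points (bB \<delta>). dd b = d \<and> (\<forall>c\<in>points (bA \<gamma>). bn \<gamma> c = d \<longrightarrow> \<sigma> b c = s c)"
    and Binj: "\<And>b b'. b \<in> points (bB \<delta>) \<Longrightarrow> b' \<in> points (bB \<delta>) \<Longrightarrow> dd b = dd b' \<Longrightarrow>
      (\<And>c. c \<in> points (bA \<gamma>) \<Longrightarrow> bn \<gamma> c = dd b \<Longrightarrow> \<sigma> b c = \<sigma> b' c) \<Longrightarrow> b = b'"
    and Aex: "\<And>a b c. a \<in> points (bA \<beta>) \<Longrightarrow> b \<in> points (bB \<delta>) \<Longrightarrow> c \<in> points (bA \<gamma>) \<Longrightarrow>
      bn \<gamma> c = dd b \<Longrightarrow> bn \<beta> a = \<sigma> b c \<Longrightarrow>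
      \<exists>a'\<in>points (bA \<delta>). ka a' = a \<and> cc a' = c \<and> bn \<delta> a' = b"
    and Ainj: "\<And>a a'. a \<in> points (bA \<delta>) \<Longrightarrow> a' \<in> points (bA \<delta>) \<Longrightarrow> ka a = ka a' \<Longrightarrow> cc a = cc a' \<Longrightarrow>
      bn \<delta> a = bn \<delta> a' \<Longrightarrow> a = a'"
  shows "bispan_iso G \<delta> (bispan_comp G \<gamma> \<beta>)"
proof -
  define fib where "fib = (\<lambda>d. {c \<in> points (bA \<gamma>). bn \<gamma> c = d})"
  \<comment> \<open>The second coordinate of a section of \<open>Q\<close> over the fibre at
    \<open>d\<close> is forced to be the point itself, so a section amounts to a choice of first
    coordinates; these are what \<open>\<sigma>\<close> provides.\<close>
  define S where "S = (\<lambda>d. {s. s \<in> extensional (fib d) \<and> (\<forall>c\<in>fib d.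
    \<exists>b\<in>points (bB \<beta>). bt \<beta> b = bp \<gamma> c \<and> s c = (b, c))})"
  define Q where "Q = pullback_gset (bB \<beta>) (bt \<beta>) (bA \<gamma>) (bp \<gamma>)"
  let ?c = "bispan_comp G \<gamma> \<beta>"
  define D where "D = {(d, s). d \<in> points (bB \<gamma>) \<and> s \<in> S d}"
  define E where "E = {(a, c, d, s). a \<in> points (bA \<beta>) \<and> c \<in> points (bA \<gamma>) \<and> (d, s) \<in> D \<and>
    bn \<gamma> c = d \<and> bn \<beta> a = fst (s c)}"
  have S_eq: "(\<Pi>\<^sub>E a\<in>{c \<in> points (bA \<gamma>). bn \<gamma> c = d}. {c \<in> points Q. snd c = a}) = S d" for d
  proof -
    have *: "q \<in> points Q \<and> snd q = c \<longleftrightarrow> (\<exists>b\<in>points (bB \<beta>). bt \<beta> b = bp \<gamma> c \<and> q = (b, c))"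
      if "c \<in> points (bA \<gamma>)" for c q
      using that by (auto simp: Q_def pullback_gset_def Let_def)
    show ?thesis
      by (rule Set.set_eqI, simp add: PiE_iff S_def fib_def * cong: conj_cong, blast)
  qed
  have B_pts: "points (bB ?c) = D"
    unfolding bispan_comp_def Let_def dep_prod_gset_def Q_def[symmetric] S_eq D_def by simp
  have B_act: "act (bB ?c) g (d, s) = (act (bB \<gamma>) g d, \<lambda>a\<in>fib (act (bB \<gamma>) g d). act Q g (s (act (bA \<gamma>) (inv g) a)))"
    if "(d, s) \<in> D" for g d s
    using that unfolding bispan_comp_def Let_def dep_prod_gset_def Q_def[symmetric] S_eq fib_def D_def by simp
  have A_pts: "points (bA ?c) = E"
    using B_pts unfolding bispan_comp_def Let_def E_def by (auto simp: pullback_gset_def Let_def)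
  have E_pts: "points (pullback_gset (bA \<gamma>) (bn \<gamma>) (bB ?c) fst) = {(c, r). c \<in> points (bA \<gamma>) \<and> r \<in> D \<and> bn \<gamma> c = fst r}"
    unfolding pullback_gset_def Let_def B_pts by simp
  have A_act: "act (bA ?c) g (a, c, d, s) = (act (bA \<beta>) g a, act (bA \<gamma>) g c, act (bB ?c) g (d, s))"
    if "(a, c, d, s) \<in> E" for g a c d s
  proof -
    have 1: "bA ?c = pullback_gset (bA \<beta>) (bn \<beta>) (pullback_gset (bA \<gamma>) (bn \<gamma>) (bB ?c) fst) (fst \<circ> (\<lambda>(c, d, s). s c))"
      unfolding bispan_comp_def Let_def by simp
    have 2: "points (bA ?c) = {(a, y). a \<in> points (bA \<beta>) \<and>
        y \<in> points (pullback_gset (bA \<gamma>) (bn \<gamma>) (bB ?c) fst) \<and> bn \<beta> a = (fst \<circ> (\<lambda>(c, d, s). s c)) y}"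
      unfolding 1 pullback_gset_def[of "bA \<beta>"] Let_def by simp
    have "act (bA ?c) g (a, c, d, s) = (act (bA \<beta>) g a, act (pullback_gset (bA \<gamma>) (bn \<gamma>) (bB ?c) fst) g (c, d, s))"
      using that unfolding A_pts[symmetric] 2 unfolding 1 pullback_gset_def[of "bA \<beta>"] Let_def by simp
    also have "act (pullback_gset (bA \<gamma>) (bn \<gamma>) (bB ?c) fst) g (c, d, s) = (act (bA \<gamma>) g c, act (bB ?c) g (d, s))"
      using that unfolding pullback_gset_def[of "bA \<gamma>"] Let_def by (simp add: B_pts E_def)
    finally show ?thesis .
  qed
  have maps: "bp ?c = bp \<beta> \<circ> fst" "bn ?c = snd \<circ> snd" "bt ?c = bt \<gamma> \<circ> fst" "bX ?c = bX \<beta>" "bY ?c = bY \<gamma>"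
    unfolding bispan_comp_def Let_def by simp_all
  define j where "j = (\<lambda>b. (dd b, \<lambda>c\<in>fib (dd b). (\<sigma> b c, c)))"
  define i where "i = (\<lambda>a. (ka a, cc a, j (bn \<delta> a)))"
  note fin = bispanD[OF \<beta>] bispanD[OF \<gamma>] bispanD[OF \<delta>]
  have jD: "j b \<in> D" if b: "b \<in> points (bB \<delta>)" for b
    unfolding j_def D_def S_def using \<sigma>[OF b] equivariant_closed[OF dd b] by (auto simp: fib_def)
  have iE: "i a \<in> E" if a: "a \<in> points (bA \<delta>)" for a
  proof -
    have b: "bn \<delta> a \<in> points (bB \<delta>)" using fin a by (meson equivariant_closed)
    show ?thesis
      unfolding E_def i_def using jD[OF b] kc[OF a] cc(2)[OF a] equivariant_closed[OF cc(1) a] equivariant_closed[OF ka(1) a]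
      by (auto simp: j_def fib_def)
  qed
  \<comment> \<open>The action on sections is by conjugation: \<open>c\<close> is first moved back
    by \<open>inv g\<close> into the fibre over \<open>dd b\<close>, and \<open>\<sigma>g\<close>
    moves the value forward again.\<close>
  have jg: "j (act (bB \<delta>) g b) = act (bB ?c) g (j b)" if g: "g \<in> carrier G" and b: "b \<in> points (bB \<delta>)" for g b
  proof -
    have "(dd b, \<lambda>c\<in>fib (dd b). (\<sigma> b c, c)) \<in> D" using jD[OF b] by (simp add: j_def)
    note this [THEN B_act, of g]
    moreover have "dd (act (bB \<delta>) g b) = act (bB \<gamma>) g (dd b)" using equivariant_act[OF dd g b] .
    moreover have "(\<sigma> (act (bB \<delta>) g b) c, c) = act Q g ((\<lambda>c\<in>fib (dd b). (\<sigma> b c, c)) (act (bA \<gamma>) (inv g) c))"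
      if c: "c \<in> fib (act (bB \<gamma>) g (dd b))" for c
    proof -
      let ?c' = "act (bA \<gamma>) (inv g) c"
      have c1: "c \<in> points (bA \<gamma>)" "bn \<gamma> c = act (bB \<gamma>) g (dd b)" using c by (auto simp: fib_def)
      have ig: "inv g \<in> carrier G" using g by simp
      have c': "?c' \<in> points (bA \<gamma>)" using c1 ig fin by (meson gset_closed)
      have n': "bn \<gamma> ?c' = dd b"
        using equivariant_act[OF fin(13) ig c1(1)] c1(2) gset_inv_act[OF fin(10) g equivariant_closed[OF dd b]] by simp
      have cg: "act (bA \<gamma>) g ?c' = c" using gset_act_inv[OF fin(9) g c1(1)] .
      have "act Q g (\<sigma> b ?c', ?c') = (act (bB \<beta>) g (\<sigma> b ?c'), act (bA \<gamma>) g ?c')"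
        unfolding Q_def pullback_gset_def Let_def using \<sigma>[OF b c' n'] c' by simp
      then show ?thesis using \<sigma>g[OF g b c' n'] c' n' cg by (simp add: fib_def)
    qed
    ultimately show ?thesis unfolding j_def by (auto intro!: restrict_ext)
  qed
  show ?thesis
  proof (rule bispan_isoI[where i = i and j = j], unfold A_pts B_pts maps)
    show "equivariant G (bB \<delta>) (bB ?c) j" using jD jg by (auto intro!: equivariantI simp: B_pts)
    show "equivariant G (bA \<delta>) (bA ?c) i"
    proof (rule equivariantI)
      fix a assume "a \<in> points (bA \<delta>)" then show "i a \<in> points (bA ?c)" using iE A_pts by simp
    next
      fix g a assume g: "g \<in> carrier G" and a: "a \<in> points (bA \<delta>)"
      have b: "bn \<delta> a \<in> points (bB \<delta>)" using fin a by (meson equivariant_closed)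
      have "(ka a, cc a, fst (j (bn \<delta> a)), snd (j (bn \<delta> a))) \<in> E" using iE[OF a] by (simp add: i_def)
      from A_act[OF this, of g] show "i (act (bA \<delta>) g a) = act (bA ?c) g (i a)"
        unfolding i_def using jg[OF g b] equivariant_act[OF ka(1) g a] equivariant_act[OF cc(1) g a]
          equivariant_act[OF fin(20) g a] by simp
    qed
    show "bij_betw j (points (bB \<delta>)) D"
    proof (rule bij_betw_imageI)
      show "inj_on j (points (bB \<delta>))"
      proof (rule inj_onI)
        fix b b' assume b: "b \<in> points (bB \<delta>)" "b' \<in> points (bB \<delta>)" and e: "j b = j b'"
        show "b = b'"
        proof (rule Binj[OF b])
          show "dd b = dd b'" using e by (simp add: j_def)
          fix c assume "c \<in> points (bA \<gamma>)" "bn \<gamma> c = dd b"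
          moreover have "snd (j b) c = snd (j b') c" "fst (j b) = fst (j b')" using e by simp_all
          ultimately show "\<sigma> b c = \<sigma> b' c" by (simp add: j_def fib_def)
        qed
      qed
      show "j ` points (bB \<delta>) = D"
      proof (intro equalityI subsetI)
        fix r assume "r \<in> D"
        then obtain d s where r: "r = (d, s)" "d \<in> points (bB \<gamma>)" "s \<in> S d" by (auto simp: D_def)
        have sc: "fst (s c) \<in> points (bB \<beta>) \<and> bt \<beta> (fst (s c)) = bp \<gamma> c \<and> s c = (fst (s c), c)"
          if "c \<in> points (bA \<gamma>)" "bn \<gamma> c = d" for c
          using r(3) that unfolding S_def fib_def by fastforce
        obtain b where b: "b \<in> points (bB \<delta>)" "dd b = d" "\<forall>c\<in>points (bA \<gamma>). bn \<gamma> c = d \<longrightarrow> \<sigma> b c = fst (s c)"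
          using Bex[OF r(2), of "\<lambda>c. fst (s c)"] sc by blast
        have "j b = r" unfolding j_def r(1) b(2)
        proof (simp, rule extensionalityI[where A = "fib d"])
          show "s \<in> extensional (fib d)" using r(3) by (simp add: S_def)
          fix c assume "c \<in> fib d"
          then show "(\<lambda>c\<in>fib d. (\<sigma> b c, c)) c = s c" using b(3) sc by (auto simp: fib_def)
        qed simp
        then show "r \<in> j ` points (bB \<delta>)" using b(1) by blast
      qed (use jD in blast)
    qed
    show "bij_betw i (points (bA \<delta>)) E"
    proof (rule bij_betw_imageI)
      have Bi: "bn \<delta> a = bn \<delta> a'" if "a \<in> points (bA \<delta>)" "a' \<in> points (bA \<delta>)" "i a = i a'" for a a'
      proof (rule Binj)
        show "bn \<delta> a \<in> points (bB \<delta>)" "bn \<delta> a' \<in> points (bB \<delta>)" using that fin by (meson equivariant_closed)+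
        show "dd (bn \<delta> a) = dd (bn \<delta> a')" using that(3) by (simp add: i_def j_def)
        fix c assume "c \<in> points (bA \<gamma>)" "bn \<gamma> c = dd (bn \<delta> a)"
        moreover have "j (bn \<delta> a) = j (bn \<delta> a')" using that(3) by (simp add: i_def)
        then have "snd (j (bn \<delta> a)) c = snd (j (bn \<delta> a')) c" "fst (j (bn \<delta> a)) = fst (j (bn \<delta> a'))"
          by simp_all
        ultimately show "\<sigma> (bn \<delta> a) c = \<sigma> (bn \<delta> a') c" by (simp add: j_def fib_def)
      qed
      show "inj_on i (points (bA \<delta>))"
      proof (rule inj_onI)
        fix a a' assume a: "a \<in> points (bA \<delta>)" "a' \<in> points (bA \<delta>)" "i a = i a'"
        show "a = a'" by (rule Ainj[OF a(1,2) _ _ Bi[OF a]]) (use a(3) in \<open>simp_all add: i_def\<close>)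
      qed
      show "i ` points (bA \<delta>) = E"
      proof (intro equalityI subsetI)
        fix e assume "e \<in> E"
        then obtain a c d s where e: "e = (a, c, d, s)" "a \<in> points (bA \<beta>)" "c \<in> points (bA \<gamma>)"
          "d \<in> points (bB \<gamma>)" "s \<in> S d" "bn \<gamma> c = d" "bn \<beta> a = fst (s c)" by (auto simp: E_def D_def)
        have sc: "fst (s c) \<in> points (bB \<beta>) \<and> bt \<beta> (fst (s c)) = bp \<gamma> c \<and> s c = (fst (s c), c)"
          if "c \<in> points (bA \<gamma>)" "bn \<gamma> c = d" for c
          using e(5) that unfolding S_def fib_def by fastforce
        obtain b where b: "b \<in> points (bB \<delta>)" "dd b = d" "\<forall>c\<in>points (bA \<gamma>). bn \<gamma> c = d \<longrightarrow> \<sigma> b c = fst (s c)"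
          using Bex[OF e(4), of "\<lambda>c. fst (s c)"] sc by blast
        have jb: "j b = (d, s)" unfolding j_def b(2)
        proof (simp, rule extensionalityI[where A = "fib d"])
          show "s \<in> extensional (fib d)" using e(5) by (simp add: S_def)
          fix c assume "c \<in> fib d"
          then show "(\<lambda>c\<in>fib d. (\<sigma> b c, c)) c = s c" using b(3) sc by (auto simp: fib_def)
        qed simp
        obtain a' where "a' \<in> points (bA \<delta>)" "ka a' = a" "cc a' = c" "bn \<delta> a' = b"
          using Aex[OF e(2) b(1) e(3)] e b by auto
        then have "i a' = e" using jb by (simp add: i_def e(1))
        then show "e \<in> i ` points (bA \<delta>)" using \<open>a' \<in> points (bA \<delta>)\<close> by blast
      qed (use iE in blast)
    qed
  qed (use eq ka(2) ddt in \<open>simp_all add: i_def j_def\<close>)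
qed

text \<open>Up to isomorphism \<open>\<gamma>\<close> is the restriction along \<open>h\<close>. As
  \<open>bn \<gamma>\<close> is bijective, every fibre is a single point and a section over it is
  just a value. So the dependent product collapses and the composite is the pullback of
  \<open>\<beta>\<close> along \<open>h\<close>; \<open>Bpb\<close> and \<open>Apb\<close> say that
  \<open>\<delta>\<close> is this pullback.\<close>

lemma res_comp_iso:
  fixes \<beta> :: "('a, 'x, 'p, 'q) bispan" and \<gamma> :: "('a, 'x, 'c, 'd) bispan" and \<delta> :: "('a, 'x, 'e, 'f) bispan"
  assumes \<beta>: "is_bispan G \<beta>" and \<gamma>: "is_bispan G \<gamma>" and \<delta>: "is_bispan G \<delta>"
    and eq: "bX \<delta> = bX \<beta>" "bY \<delta> = bY \<gamma>"
    and n: "bij_betw (bn \<gamma>) (points (bA \<gamma>)) (points (bB \<gamma>))"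
    and t: "bij_betw (bt \<gamma>) (points (bB \<gamma>)) (points (bY \<gamma>))"
    and p: "\<And>c. c \<in> points (bA \<gamma>) \<Longrightarrow> bp \<gamma> c = h (bt \<gamma> (bn \<gamma> c))"
    and k: "equivariant G (bB \<delta>) (bB \<beta>) k" "\<And>b. b \<in> points (bB \<delta>) \<Longrightarrow> bt \<beta> (k b) = h (bt \<delta> b)"
    and Bpb: "\<And>b x. b \<in> points (bB \<beta>) \<Longrightarrow> x \<in> points (bY \<gamma>) \<Longrightarrow> bt \<beta> b = h x \<Longrightarrow>
      \<exists>!b'. b' \<in> points (bB \<delta>) \<and> k b' = b \<and> bt \<delta> b' = x"
    and ka: "equivariant G (bA \<delta>) (bA \<beta>) ka" "\<And>a. a \<in> points (bA \<delta>) \<Longrightarrow> bp \<beta> (ka a) = bp \<delta> a"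
      "\<And>a. a \<in> points (bA \<delta>) \<Longrightarrow> bn \<beta> (ka a) = k (bn \<delta> a)"
    and Apb: "\<And>a b. a \<in> points (bA \<beta>) \<Longrightarrow> b \<in> points (bB \<delta>) \<Longrightarrow> bn \<beta> a = k b \<Longrightarrow>
      \<exists>!a'. a' \<in> points (bA \<delta>) \<and> ka a' = a \<and> bn \<delta> a' = b"
  shows "bispan_iso G \<delta> (bispan_comp G \<gamma> \<beta>)"
proof -
  note fin = bispanD[OF \<beta>] bispanD[OF \<gamma>] bispanD[OF \<delta>]
  define dd where "dd = inv_into (points (bB \<gamma>)) (bt \<gamma>) \<circ> bt \<delta>"
  define cc where "cc = inv_into (points (bA \<gamma>)) (bn \<gamma>) \<circ> (dd \<circ> bn \<delta>)"
  have dde: "equivariant G (bB \<delta>) (bB \<gamma>) dd"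
    unfolding dd_def using equivariant_comp[OF fin(21)] equivariant_inv[OF fin(10,14) t] eq by simp
  have cce: "equivariant G (bA \<delta>) (bA \<gamma>) cc"
    unfolding cc_def by (rule equivariant_comp[OF equivariant_comp[OF fin(20) dde] equivariant_inv[OF fin(9,13) n]])
  have tY: "bt \<delta> b \<in> points (bY \<gamma>)" if "b \<in> points (bB \<delta>)" for b using fin(21) that eq by (metis equivariant_closed)
  have ddt: "bt \<gamma> (dd b) = bt \<delta> b" if "b \<in> points (bB \<delta>)" for b
    using tY[OF that] t by (simp add: dd_def bij_betw_inv_into_right)
  have nB: "bn \<delta> a \<in> points (bB \<delta>)" if "a \<in> points (bA \<delta>)" for a using fin(20) that by (meson equivariant_closed)
  have ccn: "bn \<gamma> (cc a) = dd (bn \<delta> a)" if "a \<in> points (bA \<delta>)" for a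
    using equivariant_closed[OF dde nB[OF that]] n by (simp add: cc_def bij_betw_inv_into_right)
  show ?thesis
  proof (rule bispan_comp_isoI[OF \<beta> \<gamma> \<delta> eq dde ddt _ _ ka(1,2) cce ccn, where \<sigma> = "\<lambda>b c. k b"])
    fix b c assume "b \<in> points (bB \<delta>)" "c \<in> points (bA \<gamma>)" "bn \<gamma> c = dd b"
    then show "k b \<in> points (bB \<beta>) \<and> bt \<beta> (k b) = bp \<gamma> c" using k p ddt equivariant_closed by metis
  next
    fix d s assume d: "d \<in> points (bB \<gamma>)"
      and s: "\<And>c. c \<in> points (bA \<gamma>) \<Longrightarrow> bn \<gamma> c = d \<Longrightarrow> s c \<in> points (bB \<beta>) \<and> bt \<beta> (s c) = bp \<gamma> c"
    obtain c where c: "c \<in> points (bA \<gamma>)" "bn \<gamma> c = d" using d n by (metis bij_betw_imp_surj_on imageE)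
    have u: "c' = c" if "c' \<in> points (bA \<gamma>)" "bn \<gamma> c' = d" for c'
      using that c n by (metis bij_betw_imp_inj_on inj_onD)
    have "bt \<gamma> d \<in> points (bY \<gamma>)" using d fin(14) by (meson equivariant_closed)
    then obtain b where "b \<in> points (bB \<delta>)" "k b = s c" "bt \<delta> b = bt \<gamma> d"
      using Bpb[of "s c" "bt \<gamma> d"] s[OF c] p[OF c(1)] c(2) by auto
    then show "\<exists>b\<in>points (bB \<delta>). dd b = d \<and> (\<forall>c\<in>points (bA \<gamma>). bn \<gamma> c = d \<longrightarrow> k b = s c)"
      using u d t by (intro bexI[of _ b]) (auto simp: dd_def bij_betw_inv_into_left)
  next
    fix b b' assume b: "b \<in> points (bB \<delta>)" "b' \<in> points (bB \<delta>)" "dd b = dd b'"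
      and e: "\<And>c. c \<in> points (bA \<gamma>) \<Longrightarrow> bn \<gamma> c = dd b \<Longrightarrow> k b = k b'"
    have "dd b \<in> points (bB \<gamma>)" using dde b by (meson equivariant_closed)
    then have "k b = k b'" using e n by (metis bij_betw_imp_surj_on imageE)
    moreover have "bt \<delta> b = bt \<delta> b'" using ddt b by metis
    ultimately show "b = b'"
      using Bpb[OF equivariant_closed[OF k(1) b(1)] tY[OF b(1)] k(2)[OF b(1)]] b by metis
  next
    fix a b c assume a: "a \<in> points (bA \<beta>)" "b \<in> points (bB \<delta>)" "c \<in> points (bA \<gamma>)" "bn \<gamma> c = dd b" "bn \<beta> a = k b"
    then obtain a' where a': "a' \<in> points (bA \<delta>)" "ka a' = a" "bn \<delta> a' = b" using Apb by blast
    moreover have "cc a' = c" using a a' n by (simp add: cc_def bij_betw_inv_into_left flip: a(4))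
    ultimately show "\<exists>a'\<in>points (bA \<delta>). ka a' = a \<and> cc a' = c \<and> bn \<delta> a' = b" by blast
  next
    fix a a' assume a: "a \<in> points (bA \<delta>)" "a' \<in> points (bA \<delta>)" "ka a = ka a'" "bn \<delta> a = bn \<delta> a'"
    then show "a = a'" using Apb[OF equivariant_closed[OF ka(1) a(1)] nB[OF a(1)] ka(3)[OF a(1)]] by metis
  qed (use k ka equivariant_act in auto)
qed

text \<open>Up to isomorphism \<open>\<gamma>\<close> is the norm along \<open>f\<close>, and
  bijectivity of \<open>bt \<beta>\<close> says that \<open>\<beta>\<close> has no genuine transfer.
  Hence each point of \<open>bA \<gamma>\<close> has exactly one lift to \<open>bB \<beta>\<close>,
  each fibre has exactly one section, and the dependent product is \<open>bB \<gamma>\<close>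
  itself.\<close>

lemma nm_comp_iso:
  fixes \<beta> :: "('a, 'x, 'p, 'q) bispan" and \<gamma> :: "('a, 'x, 'c, 'd) bispan" and \<delta> :: "('a, 'x, 'e, 'f) bispan"
  assumes \<beta>: "is_bispan G \<beta>" and \<gamma>: "is_bispan G \<gamma>" and \<delta>: "is_bispan G \<delta>"
    and eq: "bX \<delta> = bX \<beta>" "bY \<delta> = bY \<gamma>" "bY \<beta> = bX \<gamma>"
    and p: "bij_betw (bp \<gamma>) (points (bA \<gamma>)) (points (bX \<gamma>))"
    and t: "bij_betw (bt \<gamma>) (points (bB \<gamma>)) (points (bY \<gamma>))"
    and n: "\<And>c. c \<in> points (bA \<gamma>) \<Longrightarrow> bt \<gamma> (bn \<gamma> c) = f (bp \<gamma> c)"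
    and bt: "bij_betw (bt \<beta>) (points (bB \<beta>)) (points (bY \<beta>))"
    and dt: "bij_betw (bt \<delta>) (points (bB \<delta>)) (points (bY \<delta>))"
    and ka: "equivariant G (bA \<delta>) (bA \<beta>) ka" "\<And>a. a \<in> points (bA \<delta>) \<Longrightarrow> bp \<beta> (ka a) = bp \<delta> a"
      "bij_betw ka (points (bA \<delta>)) (points (bA \<beta>))"
    and dn: "\<And>a. a \<in> points (bA \<delta>) \<Longrightarrow> bt \<delta> (bn \<delta> a) = f (bt \<beta> (bn \<beta> (ka a)))"
  shows "bispan_iso G \<delta> (bispan_comp G \<gamma> \<beta>)"
proof -
  note fin = bispanD[OF \<beta>] bispanD[OF \<gamma>] bispanD[OF \<delta>]
  define dd where "dd = inv_into (points (bB \<gamma>)) (bt \<gamma>) \<circ> bt \<delta>"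
  define \<sigma> where "\<sigma> = inv_into (points (bB \<beta>)) (bt \<beta>) \<circ> bp \<gamma>"
  define cc where "cc = inv_into (points (bA \<gamma>)) (bp \<gamma>) \<circ> (bt \<beta> \<circ> (bn \<beta> \<circ> ka))"
  have dde: "equivariant G (bB \<delta>) (bB \<gamma>) dd"
    unfolding dd_def using equivariant_comp[OF fin(21)] equivariant_inv[OF fin(10,14) t] eq by simp
  have \<sigma>e: "equivariant G (bA \<gamma>) (bB \<beta>) \<sigma>"
    unfolding \<sigma>_def using equivariant_comp[OF fin(12)] equivariant_inv[OF fin(3,7) bt] eq by simp
  have q: "equivariant G (bA \<delta>) (bX \<gamma>) (bt \<beta> \<circ> (bn \<beta> \<circ> ka))"
    using equivariant_comp[OF equivariant_comp[OF ka(1) fin(6)] fin(7)] eq by simp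
  have cce: "equivariant G (bA \<delta>) (bA \<gamma>) cc"
    unfolding cc_def by (rule equivariant_comp[OF q equivariant_inv[OF fin(9,12) p]])
  have tY: "bt \<delta> b \<in> points (bY \<gamma>)" if "b \<in> points (bB \<delta>)" for b using fin(21) that eq by (metis equivariant_closed)
  have ddt: "bt \<gamma> (dd b) = bt \<delta> b" if "b \<in> points (bB \<delta>)" for b
    using tY[OF that] t by (simp add: dd_def bij_betw_inv_into_right)
  have nB: "bn \<delta> a \<in> points (bB \<delta>)" if "a \<in> points (bA \<delta>)" for a using fin(20) that by (meson equivariant_closed)
  have \<sigma>t: "bt \<beta> (\<sigma> c) = bp \<gamma> c" if "c \<in> points (bA \<gamma>)" for c
    using bt eq equivariant_closed[OF fin(12) that] by (simp add: \<sigma>_def bij_betw_inv_into_right)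
  have ccp: "bp \<gamma> (cc a) = bt \<beta> (bn \<beta> (ka a))" if "a \<in> points (bA \<delta>)" for a
    using p equivariant_closed[OF q that] by (simp add: cc_def bij_betw_inv_into_right)
  have t_inj: "d = d'" if "d \<in> points (bB \<gamma>)" "d' \<in> points (bB \<gamma>)" "bt \<gamma> d = bt \<gamma> d'" for d d'
    using that t by (metis bij_betw_imp_inj_on inj_onD)
  have ccn: "bn \<gamma> (cc a) = dd (bn \<delta> a)" if a: "a \<in> points (bA \<delta>)" for a
  proof (rule t_inj)
    have c: "cc a \<in> points (bA \<gamma>)" using cce a by (meson equivariant_closed)
    show "bn \<gamma> (cc a) \<in> points (bB \<gamma>)" using fin(13) c by (meson equivariant_closed)
    show "dd (bn \<delta> a) \<in> points (bB \<gamma>)" using dde nB[OF a] by (meson equivariant_closed)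
    show "bt \<gamma> (bn \<gamma> (cc a)) = bt \<gamma> (dd (bn \<delta> a))" using n[OF c] ccp[OF a] ddt[OF nB[OF a]] dn[OF a] by simp
  qed
  have dt_inj: "d = d'" if "d \<in> points (bB \<delta>)" "d' \<in> points (bB \<delta>)" "bt \<delta> d = bt \<delta> d'" for d d'
    using that dt by (metis bij_betw_imp_inj_on inj_onD)
  have bt_inj: "d = d'" if "d \<in> points (bB \<beta>)" "d' \<in> points (bB \<beta>)" "bt \<beta> d = bt \<beta> d'" for d d'
    using that bt by (metis bij_betw_imp_inj_on inj_onD)
  show ?thesis
  proof (rule bispan_comp_isoI[OF \<beta> \<gamma> \<delta> eq(1,2) dde ddt _ _ ka(1,2) cce ccn, where \<sigma> = "\<lambda>b. \<sigma>"])
    fix b c assume "b \<in> points (bB \<delta>)" "c \<in> points (bA \<gamma>)" "bn \<gamma> c = dd b"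
    then show "\<sigma> c \<in> points (bB \<beta>) \<and> bt \<beta> (\<sigma> c) = bp \<gamma> c" using \<sigma>t \<sigma>e equivariant_closed by metis
  next
    fix a assume a: "a \<in> points (bA \<delta>)"
    have "cc a \<in> points (bA \<gamma>)" using cce a by (meson equivariant_closed)
    then show "bn \<beta> (ka a) = \<sigma> (cc a)"
      using \<sigma>t ccp[OF a] equivariant_closed[OF \<sigma>e] equivariant_closed[OF fin(6) equivariant_closed[OF ka(1) a]]
      by (intro bt_inj) auto
  next
    fix d s assume d: "d \<in> points (bB \<gamma>)"
      and s: "\<And>c. c \<in> points (bA \<gamma>) \<Longrightarrow> bn \<gamma> c = d \<Longrightarrow> s c \<in> points (bB \<beta>) \<and> bt \<beta> (s c) = bp \<gamma> c"
    have "bt \<gamma> d \<in> points (bY \<delta>)" using d fin(14) eq by (metis equivariant_closed)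
    then obtain b where b: "b \<in> points (bB \<delta>)" "bt \<delta> b = bt \<gamma> d" using dt by (metis bij_betw_imp_surj_on imageE)
    have "dd b = d" using t d b by (simp add: dd_def bij_betw_inv_into_left)
    moreover have "\<sigma> c = s c" if "c \<in> points (bA \<gamma>)" "bn \<gamma> c = d" for c
      using s[OF that] \<sigma>t[OF that(1)] equivariant_closed[OF \<sigma>e that(1)] by (intro bt_inj) auto
    ultimately show "\<exists>b\<in>points (bB \<delta>). dd b = d \<and> (\<forall>c\<in>points (bA \<gamma>). bn \<gamma> c = d \<longrightarrow> \<sigma> c = s c)"
      using b(1) by blast
  next
    fix b b' assume b: "b \<in> points (bB \<delta>)" "b' \<in> points (bB \<delta>)" "dd b = dd b'"
    then show "b = b'" using ddt by (metis dt_inj)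
  next
    fix a b c assume a: "a \<in> points (bA \<beta>)" "b \<in> points (bB \<delta>)" "c \<in> points (bA \<gamma>)" "bn \<gamma> c = dd b" "bn \<beta> a = \<sigma> c"
    obtain a' where a': "a' \<in> points (bA \<delta>)" "ka a' = a" using a(1) ka(3) by (metis bij_betw_imp_surj_on imageE)
    have "cc a' = c" using a a' \<sigma>t[OF a(3)] p by (simp add: cc_def bij_betw_inv_into_left)
    moreover have "bn \<delta> a' = b"
      using dn[OF a'(1)] a a' \<sigma>t[OF a(3)] n[OF a(3)] ddt[OF a(2)] nB[OF a'(1)] by (intro dt_inj) auto
    ultimately show "\<exists>a'\<in>points (bA \<delta>). ka a' = a \<and> cc a' = c \<and> bn \<delta> a' = b" using a' by blast
  next
    fix a a' assume a: "a \<in> points (bA \<delta>)" "a' \<in> points (bA \<delta>)" "ka a = ka a'"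
    then show "a = a'" using ka(3) by (metis bij_betw_imp_inj_on inj_onD)
  qed (use \<sigma>e equivariant_act in auto)
qed

lemma bij_betw_square:
  assumes "bij_betw i X A" "bij_betw j X B" "\<And>x. x \<in> X \<Longrightarrow> g (i x) = j x"
  shows "bij_betw g A B"
proof -
  have "bij_betw (g \<circ> i) X B" using assms(2,3) bij_betw_cong[of X "g \<circ> i" j B] by simp
  then show ?thesis using bij_betw_comp_iff[OF assms(1)] by blast
qed

lemma bispan_isoE:
  assumes iso: "bispan_iso G \<beta> \<gamma>"
  obtains i j where "bX \<beta> = bX \<gamma>" "bY \<beta> = bY \<gamma>"
    "equivariant G (bA \<beta>) (bA \<gamma>) i" "bij_betw i (points (bA \<beta>)) (points (bA \<gamma>))"
    "equivariant G (bB \<beta>) (bB \<gamma>) j" "bij_betw j (points (bB \<beta>)) (points (bB \<gamma>))"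
    "\<And>a. a \<in> points (bA \<beta>) \<Longrightarrow> bp \<gamma> (i a) = bp \<beta> a"
    "\<And>a. a \<in> points (bA \<beta>) \<Longrightarrow> bn \<gamma> (i a) = j (bn \<beta> a)"
    "\<And>b. b \<in> points (bB \<beta>) \<Longrightarrow> bt \<gamma> (j b) = bt \<beta> b"
  using iso unfolding bispan_iso_def gset_iso_def by blast

section \<open>Composition with the classes of restrictions and norms\<close>

definition res_bispan where
  "res_bispan X Y f = \<lparr>bX = Y, bA = X, bB = X, bY = X, bp = f, bn = id, bt = id\<rparr>"

definition nm_bispan where
  "nm_bispan X Y f = \<lparr>bX = X, bA = X, bB = Y, bY = Y, bp = id, bn = f, bt = id\<rparr>"

lemma res_bispan_simps [simp]:
  "bX (res_bispan X Y f) = Y" "bA (res_bispan X Y f) = X" "bB (res_bispan X Y f) = X"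
  "bY (res_bispan X Y f) = X" "bp (res_bispan X Y f) = f" "bn (res_bispan X Y f) = id"
  "bt (res_bispan X Y f) = id"
  by (simp_all add: res_bispan_def)

lemma nm_bispan_simps [simp]:
  "bX (nm_bispan X Y f) = X" "bA (nm_bispan X Y f) = X" "bB (nm_bispan X Y f) = Y"
  "bY (nm_bispan X Y f) = Y" "bp (nm_bispan X Y f) = id" "bn (nm_bispan X Y f) = f"
  "bt (nm_bispan X Y f) = id"
  by (simp_all add: nm_bispan_def)

lemma res_map_eq: "res_map G X Y f = bispan_class G (res_bispan X Y f)"
  by (simp add: res_map_def res_bispan_def)

lemma nm_map_eq: "nm_map G X Y f = bispan_class G (nm_bispan X Y f)"
  by (simp add: nm_map_def nm_bispan_def)

lemma is_bispan_res: "finite_gset G X \<Longrightarrow> finite_gset G Y \<Longrightarrow> equivariant G X Y f \<Longrightarrow>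
    is_bispan G (res_bispan X Y f)"
  by (simp add: is_bispan_def equivariant_id)

lemma is_bispan_nm: "finite_gset G X \<Longrightarrow> finite_gset G Y \<Longrightarrow> equivariant G X Y f \<Longrightarrow>
    is_bispan G (nm_bispan X Y f)"
  by (simp add: is_bispan_def equivariant_id)

text \<open>The data \<open>k\<close> and \<open>ka\<close> exhibit \<open>\<delta>\<close> as the
  pullback of \<open>\<beta>\<close> along \<open>f\<close>. They are transported along isomorphisms
  to arbitrary representatives; this is why \<open>res_comp_iso\<close> has bijections in place of
  identities.\<close>

lemma res_class_comp:
  fixes \<beta> \<delta> :: "'a pbispan"
  assumes X: "finite_gset G X" and f: "equivariant G X (bY \<beta>) f"
    and \<beta>: "is_bispan G \<beta>" and \<delta>: "is_bispan G \<delta>" and eq: "bX \<delta> = bX \<beta>" "bY \<delta> = X"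
    and k: "equivariant G (bB \<delta>) (bB \<beta>) k" "\<And>b. b \<in> points (bB \<delta>) \<Longrightarrow> bt \<beta> (k b) = f (bt \<delta> b)"
    and Bpb: "\<And>b x. b \<in> points (bB \<beta>) \<Longrightarrow> x \<in> points X \<Longrightarrow> bt \<beta> b = f x \<Longrightarrow>
      \<exists>!b'. b' \<in> points (bB \<delta>) \<and> k b' = b \<and> bt \<delta> b' = x"
    and ka: "equivariant G (bA \<delta>) (bA \<beta>) ka" "\<And>a. a \<in> points (bA \<delta>) \<Longrightarrow> bp \<beta> (ka a) = bp \<delta> a"
      "\<And>a. a \<in> points (bA \<delta>) \<Longrightarrow> bn \<beta> (ka a) = k (bn \<delta> a)"
    and Apb: "\<And>a b. a \<in> points (bA \<beta>) \<Longrightarrow> b \<in> points (bB \<delta>) \<Longrightarrow> bn \<beta> a = k b \<Longrightarrow>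
      \<exists>!a'. a' \<in> points (bA \<delta>) \<and> ka a' = a \<and> bn \<delta> a' = b"
  shows "class_comp G (res_map G X (bY \<beta>) f) (bispan_class G \<beta>) = bispan_class G \<delta>"
  unfolding res_map_eq
proof (rule class_comp_eqI[OF \<beta> is_bispan_res[OF X bispanD(4)[OF \<beta>] f] \<delta>])
  fix \<beta>' \<gamma>' :: "'a pbispan"
  assume \<beta>': "is_bispan G \<beta>'" and \<gamma>': "is_bispan G \<gamma>'" and "bispan_iso G \<beta> \<beta>'"
    and "bispan_iso G (res_bispan X (bY \<beta>) f) \<gamma>'"
  then obtain i j u v where
    e: "bX \<beta> = bX \<beta>'" "bY \<beta> = bY \<beta>'" and i: "equivariant G (bA \<beta>) (bA \<beta>') i" and
    ib: "bij_betw i (points (bA \<beta>)) (points (bA \<beta>'))" and j: "equivariant G (bB \<beta>) (bB \<beta>') j" and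
    jb: "bij_betw j (points (bB \<beta>)) (points (bB \<beta>'))" and
    ip: "\<And>a. a \<in> points (bA \<beta>) \<Longrightarrow> bp \<beta>' (i a) = bp \<beta> a" and
    inn: "\<And>a. a \<in> points (bA \<beta>) \<Longrightarrow> bn \<beta>' (i a) = j (bn \<beta> a)" and
    jt: "\<And>b. b \<in> points (bB \<beta>) \<Longrightarrow> bt \<beta>' (j b) = bt \<beta> b" and
    e': "bX \<gamma>' = bY \<beta>" "bY \<gamma>' = X" and u: "equivariant G X (bA \<gamma>') u" "bij_betw u (points X) (points (bA \<gamma>'))"
    and v: "equivariant G X (bB \<gamma>') v" "bij_betw v (points X) (points (bB \<gamma>'))"
    and u1: "\<And>x. x \<in> points X \<Longrightarrow> bp \<gamma>' (u x) = f x" "\<And>x. x \<in> points X \<Longrightarrow> bn \<gamma>' (u x) = v x"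
    and v1: "\<And>x. x \<in> points X \<Longrightarrow> bt \<gamma>' (v x) = x"
    by (elim bispan_isoE) (auto simp: id_def)
  show "bispan_iso G \<delta> (bispan_comp G \<gamma>' \<beta>')"
  proof (rule res_comp_iso[OF \<beta>' \<gamma>' \<delta>, where h = f and k = "j \<circ> k" and ka = "i \<circ> ka"])
    show "bij_betw (bn \<gamma>') (points (bA \<gamma>')) (points (bB \<gamma>'))" by (rule bij_betw_square[OF u(2) v(2) u1(2)])
    show "bij_betw (bt \<gamma>') (points (bB \<gamma>')) (points (bY \<gamma>'))"
      using bij_betw_square[OF v(2) bij_betw_id] v1 e' by simp
    fix c assume "c \<in> points (bA \<gamma>')"
    then obtain x where "x \<in> points X" "c = u x" using u(2) by (metis bij_betw_imp_surj_on imageE)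
    then show "bp \<gamma>' c = f (bt \<gamma>' (bn \<gamma>' c))" using u1 v1 by simp
  next
    show "equivariant G (bB \<delta>) (bB \<beta>') (j \<circ> k)" by (rule equivariant_comp[OF k(1) j])
    show "equivariant G (bA \<delta>) (bA \<beta>') (i \<circ> ka)" by (rule equivariant_comp[OF ka(1) i])
  next
    fix b assume "b \<in> points (bB \<delta>)"
    then show "bt \<beta>' ((j \<circ> k) b) = f (bt \<delta> b)" using jt k equivariant_closed[OF k(1)] by simp
  next
    fix b x assume b: "b \<in> points (bB \<beta>')" and x: "x \<in> points (bY \<gamma>')" and e: "bt \<beta>' b = f x"
    obtain b0 where b0: "b0 \<in> points (bB \<beta>)" "b = j b0" using b jb by (metis bij_betw_imp_surj_on imageE)
    have "(j (k b') = j b0) = (k b' = b0)" if "b' \<in> points (bB \<delta>)" for b'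
      using jb b0(1) equivariant_closed[OF k(1) that] by (auto simp: bij_betw_def inj_on_eq_iff)
    then show "\<exists>!b'. b' \<in> points (bB \<delta>) \<and> (j \<circ> k) b' = b \<and> bt \<delta> b' = x"
      using Bpb[OF b0(1), of x] x e e' b0 jt by (simp cong: conj_cong)
  next
    fix a assume "a \<in> points (bA \<delta>)"
    then show "bp \<beta>' ((i \<circ> ka) a) = bp \<delta> a" "bn \<beta>' ((i \<circ> ka) a) = (j \<circ> k) (bn \<delta> a)"
      using ip inn ka equivariant_closed[OF ka(1)] by simp_all
  next
    fix a b assume a: "a \<in> points (bA \<beta>')" and b: "b \<in> points (bB \<delta>)" and e: "bn \<beta>' a = (j \<circ> k) b"
    obtain a0 where a0: "a0 \<in> points (bA \<beta>)" "a = i a0" using a ib by (metis bij_betw_imp_surj_on imageE)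
    have "bn \<beta> a0 = k b"
      using e inn[OF a0(1)] a0 jb equivariant_closed[OF k(1) b] equivariant_closed[OF bispanD(6)[OF \<beta>] a0(1)]
      by (auto simp: bij_betw_def inj_on_eq_iff)
    moreover have "(i (ka a') = i a0) = (ka a' = a0)" if "a' \<in> points (bA \<delta>)" for a'
      using ib a0(1) equivariant_closed[OF ka(1) that] by (auto simp: bij_betw_def inj_on_eq_iff)
    ultimately show "\<exists>!a'. a' \<in> points (bA \<delta>) \<and> (i \<circ> ka) a' = a \<and> bn \<delta> a' = b"
      using Apb[OF a0(1) b] a0 by (simp cong: conj_cong)
  qed (use eq e e' in auto)
qed simp

text \<open>As \<open>\<beta>\<close> has no genuine transfer, composing with the norm only prolongs
  its middle map by \<open>f\<close>; \<open>dn\<close> expresses this through the bijections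
  \<open>bt\<close>.\<close>

lemma nm_class_comp:
  fixes \<beta> \<delta> :: "'a pbispan"
  assumes Z: "finite_gset G Z" and f: "equivariant G (bY \<beta>) Z f"
    and \<beta>: "is_bispan G \<beta>" and \<delta>: "is_bispan G \<delta>" and eq: "bX \<delta> = bX \<beta>" "bY \<delta> = Z"
    and bt: "bij_betw (bt \<beta>) (points (bB \<beta>)) (points (bY \<beta>))"
    and dt: "bij_betw (bt \<delta>) (points (bB \<delta>)) (points Z)"
    and ka: "equivariant G (bA \<delta>) (bA \<beta>) ka" "\<And>a. a \<in> points (bA \<delta>) \<Longrightarrow> bp \<beta> (ka a) = bp \<delta> a"
      "bij_betw ka (points (bA \<delta>)) (points (bA \<beta>))"
    and dn: "\<And>a. a \<in> points (bA \<delta>) \<Longrightarrow> bt \<delta> (bn \<delta> a) = f (bt \<beta> (bn \<beta> (ka a)))"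
  shows "class_comp G (nm_map G (bY \<beta>) Z f) (bispan_class G \<beta>) = bispan_class G \<delta>"
  unfolding nm_map_eq
proof (rule class_comp_eqI[OF \<beta> is_bispan_nm[OF bispanD(4)[OF \<beta>] Z f] \<delta>])
  fix \<beta>' \<gamma>' :: "'a pbispan"
  assume \<beta>': "is_bispan G \<beta>'" and \<gamma>': "is_bispan G \<gamma>'" and "bispan_iso G \<beta> \<beta>'"
    and "bispan_iso G (nm_bispan (bY \<beta>) Z f) \<gamma>'"
  then obtain i j u v where
    e: "bX \<beta> = bX \<beta>'" "bY \<beta> = bY \<beta>'" and i: "equivariant G (bA \<beta>) (bA \<beta>') i" and
    ib: "bij_betw i (points (bA \<beta>)) (points (bA \<beta>'))" and j: "equivariant G (bB \<beta>) (bB \<beta>') j" and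
    jb: "bij_betw j (points (bB \<beta>)) (points (bB \<beta>'))" and
    ip: "\<And>a. a \<in> points (bA \<beta>) \<Longrightarrow> bp \<beta>' (i a) = bp \<beta> a" and
    inn: "\<And>a. a \<in> points (bA \<beta>) \<Longrightarrow> bn \<beta>' (i a) = j (bn \<beta> a)" and
    jt: "\<And>b. b \<in> points (bB \<beta>) \<Longrightarrow> bt \<beta>' (j b) = bt \<beta> b" and
    e': "bX \<gamma>' = bY \<beta>" "bY \<gamma>' = Z" and u: "bij_betw u (points (bY \<beta>)) (points (bA \<gamma>'))"
    and v: "equivariant G Z (bB \<gamma>') v" "bij_betw v (points Z) (points (bB \<gamma>'))"
    and u1: "\<And>x. x \<in> points (bY \<beta>) \<Longrightarrow> bp \<gamma>' (u x) = x" "\<And>x. x \<in> points (bY \<beta>) \<Longrightarrow> bn \<gamma>' (u x) = v (f x)"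
    and v1: "\<And>x. x \<in> points Z \<Longrightarrow> bt \<gamma>' (v x) = x"
    by (elim bispan_isoE) (auto simp: id_def)
  show "bispan_iso G \<delta> (bispan_comp G \<gamma>' \<beta>')"
  proof (rule nm_comp_iso[OF \<beta>' \<gamma>' \<delta>, where f = f and ka = "i \<circ> ka"])
    show "bij_betw (bp \<gamma>') (points (bA \<gamma>')) (points (bX \<gamma>'))"
      using bij_betw_square[OF u bij_betw_id] u1 e' by simp
    show "bij_betw (bt \<gamma>') (points (bB \<gamma>')) (points (bY \<gamma>'))"
      using bij_betw_square[OF v(2) bij_betw_id] v1 e' by simp
    show "bij_betw (bt \<beta>') (points (bB \<beta>')) (points (bY \<beta>'))"
      using bij_betw_square[OF jb bt] jt e by simp
    fix c assume "c \<in> points (bA \<gamma>')"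
    then obtain y where "y \<in> points (bY \<beta>)" "c = u y" using u by (metis bij_betw_imp_surj_on imageE)
    then show "bt \<gamma>' (bn \<gamma>' c) = f (bp \<gamma>' c)" using u1 v1 equivariant_closed[OF f] by simp
  next
    show "equivariant G (bA \<delta>) (bA \<beta>') (i \<circ> ka)" by (rule equivariant_comp[OF ka(1) i])
    show "bij_betw (i \<circ> ka) (points (bA \<delta>)) (points (bA \<beta>'))" by (rule bij_betw_trans[OF ka(3) ib])
  next
    fix a assume a: "a \<in> points (bA \<delta>)"
    then have "ka a \<in> points (bA \<beta>)" by (rule equivariant_closed[OF ka(1)])
    moreover from this have "bn \<beta> (ka a) \<in> points (bB \<beta>)" by (rule equivariant_closed[OF bispanD(6)[OF \<beta>]])
    ultimately show "bp \<beta>' ((i \<circ> ka) a) = bp \<delta> a" "bt \<delta> (bn \<delta> a) = f (bt \<beta>' (bn \<beta>' ((i \<circ> ka) a)))"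
      using ip inn jt a ka(2) dn by simp_all
  qed (use eq e e' dt in auto)
qed simp

section \<open>Functoriality and base change for restrictions and norms\<close>

lemma res_res_class:
  fixes X Y Z :: "('a, 'a pt) gset"
  assumes "finite_gset G X" "finite_gset G Y" "finite_gset G Z" "equivariant G X Y f" "equivariant G Y Z h"
  shows "class_comp G (res_map G X Y f) (res_map G Y Z h) = res_map G X Z (h \<circ> f)"
proof -
  have "class_comp G (res_map G X (bY (res_bispan Y Z h)) f) (bispan_class G (res_bispan Y Z h)) =
      bispan_class G (res_bispan X Z (h \<circ> f))"
    using assms equivariant_closed[OF assms(4)]
    by (intro res_class_comp[where k = f and ka = f] is_bispan_res equivariant_comp) auto
  then show ?thesis by (simp add: res_map_eq)
qed

lemma nm_nm_class:
  fixes X Y Z :: "('a, 'a pt) gset"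
  assumes "finite_gset G X" "finite_gset G Y" "finite_gset G Z" "equivariant G X Y f" "equivariant G Y Z h"
  shows "class_comp G (nm_map G Y Z h) (nm_map G X Y f) = nm_map G X Z (h \<circ> f)"
proof -
  have "class_comp G (nm_map G (bY (nm_bispan X Y f)) Z h) (bispan_class G (nm_bispan X Y f)) =
      bispan_class G (nm_bispan X Z (h \<circ> f))"
    using assms
    by (intro nm_class_comp[where ka = id] is_bispan_nm equivariant_comp) (auto simp: equivariant_id)
  then show ?thesis by (simp add: nm_map_eq)
qed

text \<open>Base change: both composites are the class of
  \<open>X \<leftarrow> P \<rightarrow> X' = X'\<close>, reached on the left as the pullback of a
  norm and on the right as a restriction prolonged by a norm.\<close>

lemma res_nm_class:
  fixes X Y X' P :: "('a, 'a pt) gset"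
  assumes g: "finite_gset G X" "finite_gset G Y" "finite_gset G X'" "finite_gset G P"
    and f: "equivariant G X Y f" and h: "equivariant G X' Y h"
    and f': "equivariant G P X' f'" and h': "equivariant G P X h'"
    and sq: "\<And>p. p \<in> points P \<Longrightarrow> f (h' p) = h (f' p)"
    and pb: "\<And>x x'. x \<in> points X \<Longrightarrow> x' \<in> points X' \<Longrightarrow> f x = h x' \<Longrightarrow>
      \<exists>!p. p \<in> points P \<and> h' p = x \<and> f' p = x'"
  shows "class_comp G (res_map G X' Y h) (nm_map G X Y f) = class_comp G (nm_map G P X' f') (res_map G P X h')"
proof -
  define \<delta> :: "'a pbispan" where "\<delta> = \<lparr>bX = X, bA = P, bB = X', bY = X', bp = h', bn = f', bt = id\<rparr>"
  have \<delta>s: "bX \<delta> = X" "bA \<delta> = P" "bB \<delta> = X'" "bY \<delta> = X'" "bp \<delta> = h'" "bn \<delta> = f'" "bt \<delta> = id"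
    by (simp_all add: \<delta>_def)
  have \<delta>: "is_bispan G \<delta>" using assms by (simp add: is_bispan_def \<delta>s equivariant_id)
  have "class_comp G (res_map G X' (bY (nm_bispan X Y f)) h) (bispan_class G (nm_bispan X Y f)) = bispan_class G \<delta>"
    using assms \<delta> equivariant_closed[OF h]
    by (intro res_class_comp[where k = h and ka = h'] is_bispan_nm) (auto simp: \<delta>s)
  moreover have "class_comp G (nm_map G (bY (res_bispan P X h')) X' f') (bispan_class G (res_bispan P X h')) = bispan_class G \<delta>"
    using assms \<delta>
    by (intro nm_class_comp[where ka = id] is_bispan_res) (auto simp: \<delta>s equivariant_id)
  ultimately show ?thesis by (simp add: nm_map_eq res_map_eq)
qed

lemma res_map_cong:
  fixes X Y :: "('a, 'a pt) gset"
  assumes "finite_gset G X" "finite_gset G Y" "equivariant G X Y f" "\<And>x. x \<in> points X \<Longrightarrow> f x = f' x"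
  shows "res_map G X Y f = res_map G X Y f'"
proof -
  have "equivariant G X Y f'"
    using assms(3,4) gset_closed[OF assms(1)] by (auto simp: equivariant_def Pi_def)
  then show ?thesis unfolding res_map_eq using assms
    by (intro bispan_class_eqI is_bispan_res bispan_isoI[where i = id and j = id]) (auto simp: equivariant_id)
qed

lemma nm_map_cong:
  fixes X Y :: "('a, 'a pt) gset"
  assumes "finite_gset G X" "finite_gset G Y" "equivariant G X Y f" "\<And>x. x \<in> points X \<Longrightarrow> f x = f' x"
  shows "nm_map G X Y f = nm_map G X Y f'"
proof -
  have "equivariant G X Y f'"
    using assms(3,4) gset_closed[OF assms(1)] by (auto simp: equivariant_def Pi_def)
  then show ?thesis unfolding nm_map_eq using assms
    by (intro bispan_class_eqI is_bispan_nm bispan_isoI[where i = id and j = id]) (auto simp: equivariant_id)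
qed

text \<open>The two bispans are isomorphic through \<open>f\<close>. This brings the conjugations,
  defined as transfers, into the calculus of restrictions.\<close>

lemma tr_iso_class:
  fixes X Y :: "('a, 'a pt) gset"
  assumes X: "finite_gset G X" and Y: "finite_gset G Y" and f: "equivariant G X Y f"
    and h: "equivariant G Y X h" and hf: "\<And>x. x \<in> points X \<Longrightarrow> h (f x) = x"
    and fh: "\<And>y. y \<in> points Y \<Longrightarrow> f (h y) = y"
  shows "tr_map G X Y f = res_map G Y X h"
  unfolding tr_map_def res_map_eq
proof (rule bispan_class_eqI)
  have "bij_betw f (points X) (points Y)"
    using hf fh equivariant_closed[OF f] equivariant_closed[OF h]
    by (intro bij_betw_byWitness[where f' = h]) auto
  then show "bispan_iso G \<lparr>bX = X, bA = X, bB = X, bY = Y, bp = id, bn = id, bt = f\<rparr> (res_bispan Y X h)"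
    using f hf by (intro bispan_isoI[where i = f and j = f]) auto
qed (use assms in \<open>auto simp: is_bispan_def equivariant_id\<close>)

lemma nm_iso_class:
  fixes X Y :: "('a, 'a pt) gset"
  assumes X: "finite_gset G X" and Y: "finite_gset G Y" and f: "equivariant G X Y f"
    and h: "equivariant G Y X h" and hf: "\<And>x. x \<in> points X \<Longrightarrow> h (f x) = x"
    and fh: "\<And>y. y \<in> points Y \<Longrightarrow> f (h y) = y"
  shows "nm_map G X Y f = res_map G Y X h"
  unfolding nm_map_eq res_map_eq
proof (rule bispan_class_eqI)
  have "bij_betw f (points X) (points Y)"
    using hf fh equivariant_closed[OF f] equivariant_closed[OF h]
    by (intro bij_betw_byWitness[where f' = h]) auto
  then show "bispan_iso G (nm_bispan X Y f) (res_bispan Y X h)"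
    using f hf by (intro bispan_isoI[where i = f and j = id]) (auto simp: equivariant_id)
qed (use assms in \<open>auto simp: is_bispan_def equivariant_id\<close>)

end

subsection \<open>Disjoint unions\<close>

definition sub_gset :: "('g, 'x) gset \<Rightarrow> 'x set \<Rightarrow> ('g, 'x) gset" where
  "sub_gset X U = \<lparr>points = U, act = (\<lambda>g. restrict (act X g) U)\<rparr>"

lemma sub_gset_simps [simp]:
  "points (sub_gset X U) = U" "x \<in> U \<Longrightarrow> act (sub_gset X U) g x = act X g x"
  by (simp_all add: sub_gset_def)

text \<open>Generalizes \<open>double_gset\<close> to two summands with the same tagging by parity,
  so that \<open>double_gset_eq\<close> is an equality and not merely an isomorphism. The copies
  stay inside \<open>'g pt\<close>, where the objects of the category live.\<close>

definition sum_gset :: "('g, 'g pt) gset \<Rightarrow> ('g, 'g pt) gset \<Rightarrow> ('g, 'g pt) gset" where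
  "sum_gset X Y = (let P = inl_pt ` points X \<union> inr_pt ` points Y in
     \<lparr>points = P, act = (\<lambda>g. \<lambda>z\<in>P. if even (snd z) then inl_pt (act X g (fold_pt z))
        else inr_pt (act Y g (fold_pt z)))\<rparr>)"

definition copair :: "('g pt \<Rightarrow> 'z) \<Rightarrow> ('g pt \<Rightarrow> 'z) \<Rightarrow> 'g pt \<Rightarrow> 'z" where
  "copair f h z = (if even (snd z) then f (fold_pt z) else h (fold_pt z))"

lemma fold_pt_simps [simp]: "fold_pt (inl_pt z) = z" "fold_pt (inr_pt z) = z"
  by (auto simp: fold_pt_def inl_pt_def inr_pt_def split: prod.splits)

lemma even_pt_simps [simp]: "even (snd (inl_pt z))" "odd (snd (inr_pt z))"
  by (auto simp: inl_pt_def inr_pt_def split: prod.splits)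

lemma inl_inr_neq [simp]: "inl_pt x \<noteq> inr_pt y" "inr_pt y \<noteq> inl_pt x"
  by (metis even_pt_simps)+

lemma inl_pt_eq [simp]: "inl_pt x = inl_pt y \<longleftrightarrow> x = y"
  by (metis fold_pt_simps(1))

lemma inr_pt_eq [simp]: "inr_pt x = inr_pt y \<longleftrightarrow> x = y"
  by (metis fold_pt_simps(2))

lemma inl_image [simp]: "inl_pt x \<in> inl_pt ` A \<longleftrightarrow> x \<in> A" "inr_pt x \<notin> inl_pt ` A"
  by auto

lemma inr_image [simp]: "inr_pt x \<in> inr_pt ` A \<longleftrightarrow> x \<in> A" "inl_pt x \<notin> inr_pt ` A"
  by auto

lemma copair_simps [simp]: "copair f h (inl_pt x) = f x" "copair f h (inr_pt x) = h x"
  by (simp_all add: copair_def)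

lemma sum_gset_points: "points (sum_gset X Y) = inl_pt ` points X \<union> inr_pt ` points Y"
  by (simp add: sum_gset_def Let_def)

lemma sum_gset_act [simp]:
  "x \<in> points X \<Longrightarrow> act (sum_gset X Y) g (inl_pt x) = inl_pt (act X g x)"
  "y \<in> points Y \<Longrightarrow> act (sum_gset X Y) g (inr_pt y) = inr_pt (act Y g y)"
  by (simp_all add: sum_gset_def Let_def)

lemma double_gset_eq: "double_gset X = sum_gset X X"
  unfolding double_gset_def sum_gset_def Let_def by (auto intro!: ext simp: restrict_def)

lemma bij_betw_sum:
  assumes "bij_betw i A X" "bij_betw j B Y" "A \<inter> B = {}"
  shows "bij_betw (\<lambda>a. if a \<in> A then inl_pt (i a) else inr_pt (j a)) (A \<union> B) (inl_pt ` X \<union> inr_pt ` Y)"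
proof (rule bij_betw_imageI)
  show "inj_on (\<lambda>a. if a \<in> A then inl_pt (i a) else inr_pt (j a)) (A \<union> B)"
    using assms by (auto simp: inj_on_def bij_betw_def)
  have "(\<lambda>a. if a \<in> A then inl_pt (i a) else inr_pt (j a)) ` A = inl_pt ` i ` A"
    by (auto simp: image_image)
  moreover have "(\<lambda>a. if a \<in> A then inl_pt (i a) else inr_pt (j a)) ` B = inr_pt ` j ` B"
    using assms(3) by (force simp: image_image)
  ultimately show "(\<lambda>a. if a \<in> A then inl_pt (i a) else inr_pt (j a)) ` (A \<union> B) = inl_pt ` X \<union> inr_pt ` Y"
    using assms by (simp only: image_Un bij_betw_imp_surj_on)
qed

context group
begin

lemma sub_gset_finite:
  assumes X: "finite_gset G X" and U: "U \<subseteq> points X"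
    and cl: "\<And>g x. g \<in> carrier G \<Longrightarrow> x \<in> U \<Longrightarrow> act X g x \<in> U"
  shows "finite_gset G (sub_gset X U)"
proof (rule finite_gsetI)
  show "finite (points (sub_gset X U))" using gset_finite[OF X] U by (simp add: finite_subset)
  show "act (sub_gset X U) g \<in> extensional (points (sub_gset X U))" for g
    by (simp add: sub_gset_def)
qed (use U gset_one[OF X] gset_mult[OF X] cl in auto)

lemma sum_gset_finite:
  assumes X: "finite_gset G X" and Y: "finite_gset G Y"
  shows "finite_gset G (sum_gset X Y)"
proof (rule finite_gsetI)
  show "finite (points (sum_gset X Y))" using gset_finite[OF X] gset_finite[OF Y] by (simp add: sum_gset_points)
  show "act (sum_gset X Y) g \<in> extensional (points (sum_gset X Y))" for g
    by (simp add: sum_gset_def Let_def)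
qed (use gset_closed[OF X] gset_one[OF X] gset_mult[OF X] gset_closed[OF Y] gset_one[OF Y] gset_mult[OF Y]
    in \<open>auto simp: sum_gset_points\<close>)

lemma inl_equivariant: "equivariant G X (sum_gset X Y) inl_pt"
  by (rule equivariantI) (auto simp: sum_gset_points)

lemma inr_equivariant: "equivariant G Y (sum_gset X Y) inr_pt"
  by (rule equivariantI) (auto simp: sum_gset_points)

lemma copair_equivariant: "finite_gset G X \<Longrightarrow> finite_gset G Y \<Longrightarrow> equivariant G X Z f \<Longrightarrow>
    equivariant G Y Z h \<Longrightarrow> equivariant G (sum_gset X Y) Z (copair f h)"
  by (rule equivariantI) (auto simp: sum_gset_points equivariant_closed equivariant_act gset_closed)

lemma sub_gset_incl: "U \<subseteq> points X \<Longrightarrow> equivariant G (sub_gset X U) X id"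
  by (rule equivariantI) auto

text \<open>Pullback along an injection is the part of the bispan lying over its image; the left
  inverse \<open>e'\<close> reads \<open>bt \<kappa>\<close> back in \<open>X\<close>. This computes
  the components of an arbitrary bispan into a disjoint union.\<close>

lemma res_sub_class:
  fixes \<kappa> \<delta> :: "'a pbispan"
  assumes \<kappa>: "is_bispan G \<kappa>" and X: "finite_gset G X" and e: "equivariant G X (bY \<kappa>) e"
    and e': "\<And>x. x \<in> points X \<Longrightarrow> e' (e x) = x"
    and \<delta>_def: "\<delta> = \<lparr>bX = bX \<kappa>, bA = sub_gset (bA \<kappa>) {a \<in> points (bA \<kappa>). bt \<kappa> (bn \<kappa> a) \<in> e ` points X},
      bB = sub_gset (bB \<kappa>) {b \<in> points (bB \<kappa>). bt \<kappa> b \<in> e ` points X}, bY = X,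
      bp = bp \<kappa>, bn = bn \<kappa>, bt = e' \<circ> bt \<kappa>\<rparr>"
  shows "is_bispan G \<delta>" "class_comp G (res_map G X (bY \<kappa>) e) (bispan_class G \<kappa>) = bispan_class G \<delta>"
proof -
  note fin = bispanD[OF \<kappa>]
  have im: "act (bY \<kappa>) g y \<in> e ` points X" if "g \<in> carrier G" "y \<in> e ` points X" for g y
    using that e X by (auto simp flip: equivariant_act intro!: gset_closed)
  have ee: "e (e' y) = y" "e' y \<in> points X" if "y \<in> e ` points X" for y
    using that e' by auto
  have eg: "e' (act (bY \<kappa>) g y) = act X g (e' y)" if "g \<in> carrier G" "y \<in> e ` points X" for g y
  proof -
    obtain x where x: "x \<in> points X" "y = e x" using \<open>y \<in> e ` points X\<close> by blast
    have "act (bY \<kappa>) g y = e (act X g x)" using x that(1) by (simp add: equivariant_act[OF e])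
    then show ?thesis using e'[OF gset_closed[OF X that(1) x(1)]] e'[OF x(1)] x(2) by simp
  qed
  have ds: "bX \<delta> = bX \<kappa>" "bA \<delta> = sub_gset (bA \<kappa>) {a \<in> points (bA \<kappa>). bt \<kappa> (bn \<kappa> a) \<in> e ` points X}"
    "bB \<delta> = sub_gset (bB \<kappa>) {b \<in> points (bB \<kappa>). bt \<kappa> b \<in> e ` points X}" "bY \<delta> = X"
    "bp \<delta> = bp \<kappa>" "bn \<delta> = bn \<kappa>" "bt \<delta> = e' \<circ> bt \<kappa>"
    by (simp_all add: \<delta>_def)
  have A: "finite_gset G (bA \<delta>)"
    unfolding ds using fin im by (intro sub_gset_finite) (auto simp: gset_closed equivariant_act equivariant_closed)
  have B: "finite_gset G (bB \<delta>)"
    unfolding ds using fin im by (intro sub_gset_finite) (auto simp: gset_closed equivariant_act equivariant_closed)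
  have pA: "equivariant G (bA \<delta>) (bX \<delta>) (bp \<delta>)"
    unfolding ds using fin(5) by (auto simp: equivariant_def)
  have nA: "equivariant G (bA \<delta>) (bB \<delta>) (bn \<delta>)"
    unfolding ds by (rule equivariantI) (simp_all add: equivariant_closed[OF fin(6)] equivariant_act[OF fin(6)])
  have tB: "equivariant G (bB \<delta>) (bY \<delta>) (bt \<delta>)"
    by (rule equivariantI) (use ee(2) eg equivariant_act[OF fin(7)] in \<open>auto simp: ds\<close>)
  show \<delta>: "is_bispan G \<delta>"
    unfolding is_bispan_def using A B pA nA tB fin(1) X by (simp add: ds)
  show "class_comp G (res_map G X (bY \<kappa>) e) (bispan_class G \<kappa>) = bispan_class G \<delta>"
  proof (rule res_class_comp[OF X e \<kappa> \<delta>, where k = id and ka = id])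
    show "equivariant G (bB \<delta>) (bB \<kappa>) id" "equivariant G (bA \<delta>) (bA \<kappa>) id"
      unfolding ds by (auto intro!: sub_gset_incl)
  qed (auto simp: ds ee e' dest: equivariant_closed[OF fin(6)])
qed

lemma stabilizer_complete:
  assumes "finite_gset G X" "finite_gset G Y" "equivariant G X Y f" "x \<in> points X"
  shows "(stabilizer G (act X) x, stabilizer G (act Y) (f x)) \<in> complete_ts G"
  using stabilizer_sub[OF assms(1,4)] stabilizer_sub[OF assms(2) equivariant_closed[OF assms(3,4)]]
    stabilizer_mono[OF assms(3,4)] by (simp add: complete_ts_def)

lemma admissible_complete:
  assumes "is_bispan G \<beta>"
  shows "admissible G (complete_ts G) (complete_ts G) \<beta>"
  unfolding admissible_def
  by (intro conjI ballI stabilizer_complete bispanD[OF assms])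

text \<open>A bispan into a disjoint union is a pair of bispans into the summands: split
  \<open>B\<close> according to where \<open>t\<close> lands, and \<open>A\<close> accordingly along
  \<open>n\<close>. So a coproduct of G-sets is a product in the category of bispans, and product
  preservation applies to \<open>double_gset\<close>.\<close>

lemma sum_is_product:
  fixes X Y :: "('a, 'a pt) gset"
  assumes X: "finite_gset G X" and Y: "finite_gset G Y"
  defines "\<C> \<equiv> complete_ts G"
  shows "is_product G \<C> \<C> X Y (sum_gset X Y) (res_map G X (sum_gset X Y) inl_pt) (res_map G Y (sum_gset X Y) inr_pt)"
proof -
  let ?S = "sum_gset X Y"
  have adm: "admissible G \<C> \<C> \<beta>" if "is_bispan G \<beta>" for \<beta> :: "'a pbispan"
    unfolding \<C>_def by (rule admissible_complete[OF that])
  note S = sum_gset_finite[OF X Y]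
  have "res_map G X ?S inl_pt \<in> bispan_hom G \<C> \<C> ?S X"
    unfolding bispan_hom_def res_map_eq using is_bispan_res[OF X S inl_equivariant]
    by (auto intro!: exI[of _ "res_bispan X ?S inl_pt"] adm)
  moreover have "res_map G Y ?S inr_pt \<in> bispan_hom G \<C> \<C> ?S Y"
    unfolding bispan_hom_def res_map_eq using is_bispan_res[OF Y S inr_equivariant]
    by (auto intro!: exI[of _ "res_bispan Y ?S inr_pt"] adm)
  moreover have "\<exists>!k. k \<in> bispan_hom G \<C> \<C> W ?S \<and> class_comp G (res_map G X ?S inl_pt) k = f \<and>
      class_comp G (res_map G Y ?S inr_pt) k = h"
    if W: "finite_gset G W" and f: "f \<in> bispan_hom G \<C> \<C> W X" and h: "h \<in> bispan_hom G \<C> \<C> W Y" for W f h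
  proof -
    obtain \<beta> where \<beta>: "is_bispan G \<beta>" "f = bispan_class G \<beta>" "bX \<beta> = W" "bY \<beta> = X"
      using f by (auto simp: bispan_hom_def)
    obtain \<gamma> where \<gamma>: "is_bispan G \<gamma>" "h = bispan_class G \<gamma>" "bX \<gamma> = W" "bY \<gamma> = Y"
      using h by (auto simp: bispan_hom_def)
    note fb = bispanD[OF \<beta>(1), unfolded \<beta>] and fc = bispanD[OF \<gamma>(1), unfolded \<gamma>]
    define \<kappa> :: "'a pbispan" where "\<kappa> = \<lparr>bX = W, bA = sum_gset (bA \<beta>) (bA \<gamma>), bB = sum_gset (bB \<beta>) (bB \<gamma>),
      bY = ?S, bp = copair (bp \<beta>) (bp \<gamma>), bn = copair (inl_pt \<circ> bn \<beta>) (inr_pt \<circ> bn \<gamma>),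
      bt = copair (inl_pt \<circ> bt \<beta>) (inr_pt \<circ> bt \<gamma>)\<rparr>"
    have ks: "bX \<kappa> = W" "bA \<kappa> = sum_gset (bA \<beta>) (bA \<gamma>)" "bB \<kappa> = sum_gset (bB \<beta>) (bB \<gamma>)"
      "bY \<kappa> = ?S" "bp \<kappa> = copair (bp \<beta>) (bp \<gamma>)" "bn \<kappa> = copair (inl_pt \<circ> bn \<beta>) (inr_pt \<circ> bn \<gamma>)"
      "bt \<kappa> = copair (inl_pt \<circ> bt \<beta>) (inr_pt \<circ> bt \<gamma>)" by (simp_all add: \<kappa>_def)
    have \<kappa>: "is_bispan G \<kappa>"
      unfolding is_bispan_def ks using W S fb fc
      by (intro conjI sum_gset_finite copair_equivariant equivariant_comp[OF _ inl_equivariant]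
          equivariant_comp[OF _ inr_equivariant]) auto
    show ?thesis
    proof (rule ex1I[where a = "bispan_class G \<kappa>"], intro conjI)
      show "bispan_class G \<kappa> \<in> bispan_hom G \<C> \<C> W ?S"
        unfolding bispan_hom_def using \<kappa> adm[OF \<kappa>] ks by blast
      have "class_comp G (res_map G X (bY \<kappa>) inl_pt) (bispan_class G \<kappa>) = bispan_class G \<beta>"
        by (rule res_class_comp[OF X _ \<kappa> \<beta>(1), where k = inl_pt and ka = inl_pt])
          (auto simp: ks \<beta> inl_equivariant sum_gset_points)
      then show "class_comp G (res_map G X ?S inl_pt) (bispan_class G \<kappa>) = f" by (simp add: \<beta> ks)
      have "class_comp G (res_map G Y (bY \<kappa>) inr_pt) (bispan_class G \<kappa>) = bispan_class G \<gamma>"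
        by (rule res_class_comp[OF Y _ \<kappa> \<gamma>(1), where k = inr_pt and ka = inr_pt])
          (auto simp: ks \<gamma> inr_equivariant sum_gset_points)
      then show "class_comp G (res_map G Y ?S inr_pt) (bispan_class G \<kappa>) = h" by (simp add: \<gamma> ks)
    next
      fix k assume k: "k \<in> bispan_hom G \<C> \<C> W ?S \<and> class_comp G (res_map G X ?S inl_pt) k = f \<and>
        class_comp G (res_map G Y ?S inr_pt) k = h"
      then obtain \<epsilon> where \<epsilon>: "is_bispan G \<epsilon>" "k = bispan_class G \<epsilon>" "bX \<epsilon> = W" "bY \<epsilon> = ?S"
        by (auto simp: bispan_hom_def)
      note fe = bispanD[OF \<epsilon>(1), unfolded \<epsilon>]
      \<comment> \<open>Uniqueness: the two halves of \<open>\<epsilon>\<close> represent its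
        restrictions along the inclusions, hence are isomorphic to \<open>\<beta>\<close> and
        \<open>\<gamma>\<close>. The isomorphisms of the halves are glued into one from
        \<open>\<epsilon>\<close> to \<open>\<kappa>\<close>.\<close>
      define \<epsilon>1 :: "'a pbispan" where "\<epsilon>1 = \<lparr>bX = bX \<epsilon>, bA = sub_gset (bA \<epsilon>) {a \<in> points (bA \<epsilon>). bt \<epsilon> (bn \<epsilon> a) \<in> inl_pt ` points X},
        bB = sub_gset (bB \<epsilon>) {b \<in> points (bB \<epsilon>). bt \<epsilon> b \<in> inl_pt ` points X}, bY = X,
        bp = bp \<epsilon>, bn = bn \<epsilon>, bt = fold_pt \<circ> bt \<epsilon>\<rparr>"
      define \<epsilon>2 :: "'a pbispan" where "\<epsilon>2 = \<lparr>bX = bX \<epsilon>, bA = sub_gset (bA \<epsilon>) {a \<in> points (bA \<epsilon>). bt \<epsilon> (bn \<epsilon> a) \<in> inr_pt ` points Y},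
        bB = sub_gset (bB \<epsilon>) {b \<in> points (bB \<epsilon>). bt \<epsilon> b \<in> inr_pt ` points Y}, bY = Y,
        bp = bp \<epsilon>, bn = bn \<epsilon>, bt = fold_pt \<circ> bt \<epsilon>\<rparr>"
      let ?A1 = "{a \<in> points (bA \<epsilon>). bt \<epsilon> (bn \<epsilon> a) \<in> inl_pt ` points X}" and ?A2 = "{a \<in> points (bA \<epsilon>). bt \<epsilon> (bn \<epsilon> a) \<in> inr_pt ` points Y}"
      let ?B1 = "{b \<in> points (bB \<epsilon>). bt \<epsilon> b \<in> inl_pt ` points X}" and ?B2 = "{b \<in> points (bB \<epsilon>). bt \<epsilon> b \<in> inr_pt ` points Y}"
      have "bispan_class G \<epsilon>1 = bispan_class G \<beta>"
        using res_sub_class(2)[OF \<epsilon>(1) X _ _ \<epsilon>1_def] k \<beta>(2) by (simp add: \<epsilon> inl_equivariant)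
      then have "bispan_iso G \<epsilon>1 \<beta>" by (rule bispan_class_eqD[OF \<beta>(1)])
      then obtain i1 j1 where 1: "equivariant G (sub_gset (bA \<epsilon>) ?A1) (bA \<beta>) i1" "bij_betw i1 ?A1 (points (bA \<beta>))"
        "equivariant G (sub_gset (bB \<epsilon>) ?B1) (bB \<beta>) j1" "bij_betw j1 ?B1 (points (bB \<beta>))"
        "\<And>a. a \<in> ?A1 \<Longrightarrow> bp \<beta> (i1 a) = bp \<epsilon> a" "\<And>a. a \<in> ?A1 \<Longrightarrow> bn \<beta> (i1 a) = j1 (bn \<epsilon> a)"
        "\<And>b. b \<in> ?B1 \<Longrightarrow> bt \<beta> (j1 b) = fold_pt (bt \<epsilon> b)"
        by (elim bispan_isoE) (simp add: \<epsilon>1_def)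
      have "bispan_class G \<epsilon>2 = bispan_class G \<gamma>"
        using res_sub_class(2)[OF \<epsilon>(1) Y _ _ \<epsilon>2_def] k \<gamma>(2) by (simp add: \<epsilon> inr_equivariant)
      then have "bispan_iso G \<epsilon>2 \<gamma>" by (rule bispan_class_eqD[OF \<gamma>(1)])
      then obtain i2 j2 where 2: "equivariant G (sub_gset (bA \<epsilon>) ?A2) (bA \<gamma>) i2" "bij_betw i2 ?A2 (points (bA \<gamma>))"
        "equivariant G (sub_gset (bB \<epsilon>) ?B2) (bB \<gamma>) j2" "bij_betw j2 ?B2 (points (bB \<gamma>))"
        "\<And>a. a \<in> ?A2 \<Longrightarrow> bp \<gamma> (i2 a) = bp \<epsilon> a" "\<And>a. a \<in> ?A2 \<Longrightarrow> bn \<gamma> (i2 a) = j2 (bn \<epsilon> a)"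
        "\<And>b. b \<in> ?B2 \<Longrightarrow> bt \<gamma> (j2 b) = fold_pt (bt \<epsilon> b)"
        by (elim bispan_isoE) (simp add: \<epsilon>2_def)
      define i where "i = (\<lambda>a. if a \<in> ?A1 then inl_pt (i1 a) else inr_pt (i2 a))"
      define j where "j = (\<lambda>a. if a \<in> ?B1 then inl_pt (j1 a) else inr_pt (j2 a))"
      have tS: "bt \<epsilon> b \<in> inl_pt ` points X \<union> inr_pt ` points Y" if "b \<in> points (bB \<epsilon>)" for b
        using equivariant_closed[OF fe(7) that] by (simp add: sum_gset_points)
      have nB: "bn \<epsilon> a \<in> points (bB \<epsilon>)" if "a \<in> points (bA \<epsilon>)" for a using equivariant_closed[OF fe(6) that] .
      have Aun: "points (bA \<epsilon>) = ?A1 \<union> ?A2" and Adis: "?A1 \<inter> ?A2 = {}" using tS nB by (blast, auto)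
      have Bun: "points (bB \<epsilon>) = ?B1 \<union> ?B2" and Bdis: "?B1 \<inter> ?B2 = {}" using tS by (blast, auto)
      have ib: "bij_betw i (points (bA \<epsilon>)) (points (bA \<kappa>))"
        using bij_betw_sum[OF 1(2) 2(2) Adis, folded i_def Aun] by (simp only: ks sum_gset_points)
      have jb: "bij_betw j (points (bB \<epsilon>)) (points (bB \<kappa>))"
        using bij_betw_sum[OF 1(4) 2(4) Bdis, folded j_def Bun] by (simp only: ks sum_gset_points)
      have ia: "i a = inl_pt (i1 a)" "i1 a \<in> points (bA \<beta>)" if "a \<in> ?A1" for a
        using that equivariant_closed[OF 1(1), of a] by (simp_all add: i_def)
      have ia': "i a = inr_pt (i2 a)" "i2 a \<in> points (bA \<gamma>)" if "a \<in> ?A2" for a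
        using that equivariant_closed[OF 2(1), of a] Adis by (auto simp add: i_def)
      have ja: "j a = inl_pt (j1 a)" "j1 a \<in> points (bB \<beta>)" if "a \<in> ?B1" for a
        using that equivariant_closed[OF 1(3), of a] by (simp_all add: j_def)
      have ja': "j a = inr_pt (j2 a)" "j2 a \<in> points (bB \<gamma>)" if "a \<in> ?B2" for a
        using that equivariant_closed[OF 2(3), of a] Bdis by (auto simp add: j_def)
      have gB1: "act (bB \<epsilon>) g b \<in> ?B1" if "g \<in> carrier G" "b \<in> ?B1" for g b
        using that gset_closed[OF fe(3)] gset_closed[OF X] by (auto simp: equivariant_act[OF fe(7)])
      have gB2: "act (bB \<epsilon>) g b \<in> ?B2" if "g \<in> carrier G" "b \<in> ?B2" for g b
        using that gset_closed[OF fe(3)] gset_closed[OF Y] by (auto simp: equivariant_act[OF fe(7)])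
      have gA1: "act (bA \<epsilon>) g a \<in> ?A1" if "g \<in> carrier G" "a \<in> ?A1" for g a
        using gB1[OF that(1), of "bn \<epsilon> a"] that gset_closed[OF fe(2)] nB by (auto simp: equivariant_act[OF fe(6)])
      have gA2: "act (bA \<epsilon>) g a \<in> ?A2" if "g \<in> carrier G" "a \<in> ?A2" for g a
        using gB2[OF that(1), of "bn \<epsilon> a"] that gset_closed[OF fe(2)] nB by (auto simp: equivariant_act[OF fe(6)])
      have ie: "equivariant G (bA \<epsilon>) (bA \<kappa>) i"
      proof (rule equivariantI)
        fix a assume "a \<in> points (bA \<epsilon>)" then show "i a \<in> points (bA \<kappa>)" using ib by (meson bij_betwE)
      next
        fix g a assume g: "g \<in> carrier G" and "a \<in> points (bA \<epsilon>)"
        then consider "a \<in> ?A1" | "a \<in> ?A2" using Aun by blast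
        then show "i (act (bA \<epsilon>) g a) = act (bA \<kappa>) g (i a)"
        proof cases
          case c: 1
          show ?thesis using ia[OF gA1[OF g c]] ia[OF c] equivariant_act[OF 1(1) g, of a] c by (simp add: ks)
        next
          case c: 2
          show ?thesis using ia'[OF gA2[OF g c]] ia'[OF c] equivariant_act[OF 2(1) g, of a] c by (simp add: ks)
        qed
      qed
      have je: "equivariant G (bB \<epsilon>) (bB \<kappa>) j"
      proof (rule equivariantI)
        fix a assume "a \<in> points (bB \<epsilon>)" then show "j a \<in> points (bB \<kappa>)" using jb by (meson bij_betwE)
      next
        fix g a assume g: "g \<in> carrier G" and "a \<in> points (bB \<epsilon>)"
        then consider "a \<in> ?B1" | "a \<in> ?B2" using Bun by blast
        then show "j (act (bB \<epsilon>) g a) = act (bB \<kappa>) g (j a)"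
        proof cases
          case c: 1
          show ?thesis using ja[OF gB1[OF g c]] ja[OF c] equivariant_act[OF 1(3) g, of a] c by (simp add: ks)
        next
          case c: 2
          show ?thesis using ja'[OF gB2[OF g c]] ja'[OF c] equivariant_act[OF 2(3) g, of a] c by (simp add: ks)
        qed
      qed
      have "bispan_iso G \<epsilon> \<kappa>"
      proof (rule bispan_isoI[OF _ _ ie ib je jb])
        fix a assume "a \<in> points (bA \<epsilon>)"
        then consider "a \<in> ?A1" | "a \<in> ?A2" using Aun by blast
        then show "bp \<kappa> (i a) = bp \<epsilon> a"
          by cases (simp_all only: ks ia ia' 1 2 copair_simps)
      next
        fix a assume a: "a \<in> points (bA \<epsilon>)"
        then consider "a \<in> ?A1" | "a \<in> ?A2" using Aun by blast
        then show "bn \<kappa> (i a) = j (bn \<epsilon> a)"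
        proof cases
          case c: 1
          then have "bn \<epsilon> a \<in> ?B1" using nB by blast
          then show ?thesis using ia[OF c] ja 1(6)[OF c] by (simp only: ks copair_simps comp_apply)
        next
          case c: 2
          then have "bn \<epsilon> a \<in> ?B2" using nB by blast
          then show ?thesis using ia'[OF c] ja' 2(6)[OF c] by (simp only: ks copair_simps comp_apply)
        qed
      next
        fix b assume "b \<in> points (bB \<epsilon>)"
        then consider "b \<in> ?B1" | "b \<in> ?B2" using Bun by blast
        then show "bt \<kappa> (j b) = bt \<epsilon> b"
        proof cases
          case c: 1
          then show ?thesis using ja[OF c] 1(7)[OF c] by (auto simp: ks)
        next
          case c: 2
          then show ?thesis using ja'[OF c] 2(7)[OF c] by (auto simp: ks)
        qed
      qed (simp_all add: ks \<epsilon>)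
      then show "k = bispan_class G \<kappa>" using bispan_class_eqI[OF \<epsilon>(1) \<kappa>] \<epsilon>(2) by simp
    qed
  qed
  ultimately show ?thesis unfolding is_product_def using X Y S by blast
qed

end

subsection \<open>Coset spaces\<close>

context group
begin

lemma l_coset_iff: "y \<in> x <# H \<longleftrightarrow> (\<exists>h\<in>H. y = x \<otimes> h)"
  by (auto simp: l_coset_def)

lemma l_coset_self: "subgroup H G \<Longrightarrow> x \<in> carrier G \<Longrightarrow> x \<in> x <# H"
  by (simp add: lcos_self)

lemma l_coset_eq:
  assumes H: "subgroup H G" and x: "x \<in> carrier G" and y: "y \<in> carrier G"
  shows "x <# H = y <# H \<longleftrightarrow> inv x \<otimes> y \<in> H"
proof
  assume "x <# H = y <# H"
  then obtain h where h: "h \<in> H" "y = x \<otimes> h" using l_coset_self[OF H y] l_coset_iff by blast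
  then have "inv x \<otimes> y = h" using x subgroup.mem_carrier[OF H] by (simp add: m_assoc[symmetric])
  then show "inv x \<otimes> y \<in> H" using h by simp
next
  assume xy: "inv x \<otimes> y \<in> H"
  have Hc: "h \<in> carrier G" if "h \<in> H" for h using H that by (rule subgroup.mem_carrier)
  show "x <# H = y <# H"
  proof (intro equalityI subsetI)
    fix z assume "z \<in> x <# H"
    then obtain h where h: "h \<in> H" "z = x \<otimes> h" by (auto simp: l_coset_iff)
    have "inv (inv x \<otimes> y) \<otimes> h \<in> H" using xy h H by (simp add: subgroup.m_closed subgroup.m_inv_closed)
    moreover have "y \<otimes> (inv (inv x \<otimes> y) \<otimes> h) = z"
      using x y h Hc by (simp add: inv_mult_group m_assoc[symmetric])
    ultimately show "z \<in> y <# H" unfolding l_coset_iff by blast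
  next
    fix z assume "z \<in> y <# H"
    then obtain h where h: "h \<in> H" "z = y \<otimes> h" by (auto simp: l_coset_iff)
    have "(inv x \<otimes> y) \<otimes> h \<in> H" using xy h H by (simp add: subgroup.m_closed)
    moreover have "x \<otimes> ((inv x \<otimes> y) \<otimes> h) = z"
      using x y h Hc by (simp add: m_assoc[symmetric])
    ultimately show "z \<in> x <# H" unfolding l_coset_iff by blast
  qed
qed

section \<open>Conjugate subgroups and stabilizers of cosets\<close>

lemma conjugate_iff: "y \<in> conjugate G g H \<longleftrightarrow> (\<exists>h\<in>H. y = g \<otimes> h \<otimes> inv g)"
  by (auto simp: conjugate_def l_coset_def r_coset_def)

lemma conjugate_iff':
  assumes H: "subgroup H G" and g: "g \<in> carrier G" and y: "y \<in> carrier G"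
  shows "y \<in> conjugate G g H \<longleftrightarrow> inv g \<otimes> y \<otimes> g \<in> H"
proof
  assume "y \<in> conjugate G g H"
  then obtain h where h: "h \<in> H" "y = g \<otimes> h \<otimes> inv g" by (auto simp: conjugate_iff)
  have "h \<in> carrier G" by (rule subgroup.mem_carrier[OF H h(1)])
  moreover from this have "inv g \<otimes> y \<otimes> g = inv g \<otimes> g \<otimes> h \<otimes> (inv g \<otimes> g)"
    using g h(2) by (simp only: m_assoc m_closed inv_closed)
  ultimately have "inv g \<otimes> y \<otimes> g = h" using g by simp
  then show "inv g \<otimes> y \<otimes> g \<in> H" using h by simp
next
  assume "inv g \<otimes> y \<otimes> g \<in> H"
  moreover have "g \<otimes> (inv g \<otimes> y \<otimes> g) \<otimes> inv g = (g \<otimes> inv g) \<otimes> y \<otimes> (g \<otimes> inv g)"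
    using g y by (simp only: m_assoc m_closed inv_closed)
  then have "y = g \<otimes> (inv g \<otimes> y \<otimes> g) \<otimes> inv g" using g y by simp
  ultimately show "y \<in> conjugate G g H" unfolding conjugate_iff by blast
qed

lemma coset_gset_points: "points (coset_gset G H) = {(x <# H, 0) | x. x \<in> carrier G}"
  by (auto simp: coset_gset_def Let_def LCOSETS_def)

lemma coset_gset_point: "x \<in> carrier G \<Longrightarrow> (x <# H, 0) \<in> points (coset_gset G H)"
  by (auto simp: coset_gset_points)

lemma coset_gset_act:
  assumes "subgroup H G" "x \<in> carrier G" "g \<in> carrier G"
  shows "act (coset_gset G H) g (x <# H, 0) = ((g \<otimes> x) <# H, 0)"
  using assms by (auto simp: coset_gset_def Let_def LCOSETS_def lcos_m_assoc subgroup.subset)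

lemma coset_gset_finite:
  assumes fin: "finite (carrier G)" and H: "subgroup H G"
  shows "finite_gset G (coset_gset G H)"
proof (rule finite_gsetI)
  have "points (coset_gset G H) = (\<lambda>x. (x <# H, 0)) ` carrier G" by (auto simp: coset_gset_points)
  then show "finite (points (coset_gset G H))" using fin by simp
  show "act (coset_gset G H) g \<in> extensional (points (coset_gset G H))" for g
    by (simp add: coset_gset_def Let_def)
qed (use coset_gset_act[OF H] in \<open>auto simp: coset_gset_points m_assoc\<close>)

lemma coset_gset_stabilizer:
  assumes H: "subgroup H G" and x: "x \<in> carrier G"
  shows "stabilizer G (act (coset_gset G H)) (x <# H, 0) = conjugate G x H"
proof -
  have "g \<in> stabilizer G (act (coset_gset G H)) (x <# H, 0) \<longleftrightarrow> g \<in> conjugate G x H" for g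
  proof (cases "g \<in> carrier G")
    case True
    have "act (coset_gset G H) g (x <# H, 0) = (x <# H, 0) \<longleftrightarrow> x <# H = (g \<otimes> x) <# H"
      using coset_gset_act[OF H x True] by auto
    also have "\<dots> \<longleftrightarrow> g \<in> conjugate G x H"
      using True x H by (simp add: l_coset_eq conjugate_iff' m_assoc)
    finally show ?thesis using True by (simp add: stabilizer_def)
  next
    case False
    moreover have "g \<notin> conjugate G x H"
      using False x H by (auto simp: conjugate_iff dest: subgroup.mem_carrier)
    ultimately show ?thesis by (simp add: stabilizer_def)
  qed
  then show ?thesis by blast
qed

lemma conjugate_subgroup: "finite (carrier G) \<Longrightarrow> subgroup H G \<Longrightarrow> x \<in> carrier G \<Longrightarrow> subgroup (conjugate G x H) G"
  using stabilizer_sub[OF coset_gset_finite coset_gset_point] coset_gset_stabilizer by metis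

lemma conjugate_one:
  assumes "subgroup H G"
  shows "conjugate G \<one> H = H"
proof -
  have "\<one> \<otimes> h \<otimes> inv \<one> = h" if "h \<in> H" for h using subgroup.mem_carrier[OF assms that] by simp
  then show ?thesis by (auto simp: conjugate_iff)
qed

lemma conjugate_mono: "K \<subseteq> H \<Longrightarrow> conjugate G g K \<subseteq> conjugate G g H"
  unfolding subset_iff conjugate_iff by blast

lemma conjugate_conjugate:
  assumes "subgroup H G" "g \<in> carrier G" "h \<in> carrier G"
  shows "conjugate G g (conjugate G h H) = conjugate G (g \<otimes> h) H"
proof -
  have "g \<otimes> (h \<otimes> k \<otimes> inv h) \<otimes> inv g = g \<otimes> h \<otimes> k \<otimes> inv (g \<otimes> h)" if "k \<in> H" for k
    using assms subgroup.mem_carrier[OF assms(1) that] by (simp add: inv_mult_group m_assoc)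
  then show ?thesis by (force simp: conjugate_iff)
qed

lemma conjugate_inv:
  assumes "subgroup H G" "g \<in> carrier G"
  shows "conjugate G g (conjugate G (inv g) H) = H" "conjugate G (inv g) (conjugate G g H) = H"
  using assms by (simp_all add: conjugate_conjugate conjugate_one)

text \<open>The map \<open>gK \<mapsto> g x\<close>. A representative is chosen with
  \<open>SOME\<close>, which is harmless when \<open>K\<close> fixes \<open>x\<close>; the ignored
  \<open>i\<close> is the tag of a point of \<open>'a pt\<close>.\<close>

definition orbit_map :: "('a, 'x) gset \<Rightarrow> 'x \<Rightarrow> 'a pt \<Rightarrow> 'x" where
  "orbit_map X x = (\<lambda>(C, i). act X (SOME g. g \<in> C) x)"

lemma orbit_map_eq:
  assumes X: "finite_gset G X" and x: "x \<in> points X" and K: "subgroup K G"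
    and st: "K \<subseteq> stabilizer G (act X) x" and g: "g \<in> carrier G"
  shows "orbit_map X x (g <# K, 0) = act X g x"
proof -
  have "(SOME h. h \<in> g <# K) \<in> g <# K" using l_coset_self[OF K g] by (rule someI)
  then obtain k where k: "k \<in> K" "(SOME h. h \<in> g <# K) = g \<otimes> k" by (auto simp: l_coset_iff)
  then have "k \<in> carrier G" "act X k x = x" using st by (auto simp: stabilizer_def)
  then show ?thesis using k g gset_mult[OF X g _ x] by (simp add: orbit_map_def)
qed

lemma orbit_map_equivariant:
  assumes X: "finite_gset G X" and x: "x \<in> points X" and K: "subgroup K G"
    and st: "K \<subseteq> stabilizer G (act X) x"
  shows "equivariant G (coset_gset G K) X (orbit_map X x)"
  by (rule equivariantI)
    (use orbit_map_eq[OF assms] gset_closed[OF X _ x] gset_mult[OF X _ _ x] coset_gset_act[OF K]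
      in \<open>auto simp: coset_gset_points\<close>)

lemma coset_proj_eq:
  assumes K: "subgroup K G" and H: "subgroup H G" and KH: "K \<subseteq> H" and x: "x \<in> carrier G"
  shows "coset_proj G H (x <# K, i) = (x <# H, i)"
proof -
  have "(x <# K) <#> H = x <# H"
  proof (intro equalityI subsetI)
    fix z assume "z \<in> (x <# K) <#> H"
    then obtain k h where kh: "k \<in> K" "h \<in> H" "z = x \<otimes> k \<otimes> h" by (auto simp: set_mult_def l_coset_iff)
    then have "z = x \<otimes> (k \<otimes> h)" "k \<otimes> h \<in> H"
      using x subgroup.mem_carrier[OF H] KH by (auto simp: m_assoc subgroup.m_closed[OF H] subsetD)
    then show "z \<in> x <# H" unfolding l_coset_iff by blast
  next
    fix z assume "z \<in> x <# H"
    then obtain h where h: "h \<in> H" "z = x \<otimes> h" by (auto simp: l_coset_iff)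
    then show "z \<in> (x <# K) <#> H" using l_coset_self[OF K x] by (auto simp: set_mult_def)
  qed
  then show ?thesis by (simp add: coset_proj_def)
qed

lemma coset_proj_equivariant:
  assumes K: "subgroup K G" and H: "subgroup H G" and KH: "K \<subseteq> H"
  shows "equivariant G (coset_gset G K) (coset_gset G H) (coset_proj G H)"
  by (rule equivariantI)
    (use coset_proj_eq[OF assms] coset_gset_act[OF K] coset_gset_act[OF H] in \<open>auto simp: coset_gset_points\<close>)

lemma coset_conj_eq:
  assumes H: "subgroup H G" and g: "g \<in> carrier G" and x: "x \<in> carrier G"
  shows "coset_conj G g (x <# H, i) = ((x \<otimes> inv g) <# conjugate G g H, i)"
proof -
  have "x \<otimes> h \<otimes> inv g = x \<otimes> inv g \<otimes> (g \<otimes> h \<otimes> inv g)" if "h \<in> H" for h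
  proof -
    have h: "h \<in> carrier G" using subgroup.mem_carrier[OF H that] .
    have "x \<otimes> inv g \<otimes> (g \<otimes> h \<otimes> inv g) = x \<otimes> (inv g \<otimes> g) \<otimes> h \<otimes> inv g"
      using x g h by (simp only: m_assoc m_closed inv_closed)
    then show ?thesis using x g h by simp
  qed
  then have "(x <# H) #> inv g = (x \<otimes> inv g) <# conjugate G g H"
    by (force simp: l_coset_iff conjugate_iff r_coset_def)
  then show ?thesis by (simp add: coset_conj_def)
qed

lemma coset_conj_equivariant:
  assumes fin: "finite (carrier G)" and H: "subgroup H G" and g: "g \<in> carrier G"
  shows "equivariant G (coset_gset G H) (coset_gset G (conjugate G g H)) (coset_conj G g)"
  by (rule equivariantI)
    (use coset_conj_eq[OF H g] coset_gset_act[OF H] coset_gset_act[OF conjugate_subgroup[OF fin H g]] g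
      in \<open>auto simp: coset_gset_points m_assoc\<close>)

text \<open>A conjugation is a transfer along an isomorphism, whose inverse is right translation by
  \<open>g\<close>. Seen as a restriction, it composes with other restrictions.\<close>

lemma cj_class:
  assumes fin: "finite (carrier G)" and H: "subgroup H G" and g: "g \<in> carrier G"
  shows "tr_map G (coset_gset G H) (coset_gset G (conjugate G g H)) (coset_conj G g) =
    res_map G (coset_gset G (conjugate G g H)) (coset_gset G H) (coset_conj G (inv g))"
proof (rule tr_iso_class)
  let ?C = "conjugate G g H"
  have C: "subgroup ?C G" by (rule conjugate_subgroup[OF fin H g])
  show "finite_gset G (coset_gset G H)" "finite_gset G (coset_gset G ?C)"
    using coset_gset_finite[OF fin] H C by auto
  show "equivariant G (coset_gset G H) (coset_gset G ?C) (coset_conj G g)"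
    by (rule coset_conj_equivariant[OF fin H g])
  show "equivariant G (coset_gset G ?C) (coset_gset G H) (coset_conj G (inv g))"
    using coset_conj_equivariant[OF fin C, of "inv g"] g H by (simp add: conjugate_inv)
  have e: "coset_conj G (inv g) (x <# ?C, 0) = ((x \<otimes> g) <# H, 0)" if "x \<in> carrier G" for x
    using coset_conj_eq[OF C _ that, of "inv g"] g H by (simp add: conjugate_inv)
  have e': "coset_conj G g (x <# H, 0) = ((x \<otimes> inv g) <# ?C, 0)" if "x \<in> carrier G" for x
    using coset_conj_eq[OF H g that] .
  show "coset_conj G (inv g) (coset_conj G g x) = x" if "x \<in> points (coset_gset G H)" for x
    using that g by (auto simp: coset_gset_points e e' m_assoc)
  show "coset_conj G g (coset_conj G (inv g) x) = x" if "x \<in> points (coset_gset G ?C)" for x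
    using that g by (auto simp: coset_gset_points e e' m_assoc)
qed

end

subsection \<open>Restrictions, norms and products in a complete Tambara functor\<close>

locale complete_tambara = group G for G (structure) +
  fixes T :: "('a, 'c) tfunctor"
  assumes fin: "finite (carrier G)"
    and tambara: "tambara_functor G (complete_ts G) (complete_ts G) T"
begin

abbreviation RS where "RS X Y f \<equiv> tmor T (res_map G X Y f)"
abbreviation NM where "NM X Y f \<equiv> tmor T (nm_map G X Y f)"

lemma class_in_hom: "is_bispan G \<beta> \<Longrightarrow>
    bispan_class G \<beta> \<in> bispan_hom G (complete_ts G) (complete_ts G) (bX \<beta>) (bY \<beta>)"
  unfolding bispan_hom_def using admissible_complete by blast

lemma tmor_closed:
  assumes "is_bispan G \<beta>" "z \<in> tob T (bX \<beta>)"
  shows "tmor T (bispan_class G \<beta>) z \<in> tob T (bY \<beta>)"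
proof -
  have "tmor T (bispan_class G \<beta>) \<in> tob T (bX \<beta>) \<rightarrow>\<^sub>E tob T (bY \<beta>)"
    using tambara class_in_hom[OF assms(1)] bispanD(1,4)[OF assms(1)]
    unfolding tambara_functor_def set_functor_def by blast
  then show ?thesis using assms(2) by auto
qed

lemma tmor_comp:
  assumes "is_bispan G \<beta>" "is_bispan G \<gamma>" "bY \<beta> = bX \<gamma>" "z \<in> tob T (bX \<beta>)"
  shows "tmor T (bispan_class G \<gamma>) (tmor T (bispan_class G \<beta>) z) =
    tmor T (class_comp G (bispan_class G \<gamma>) (bispan_class G \<beta>)) z"
proof -
  have "tmor T (class_comp G (bispan_class G \<gamma>) (bispan_class G \<beta>)) =
      compose (tob T (bX \<beta>)) (tmor T (bispan_class G \<gamma>)) (tmor T (bispan_class G \<beta>))"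
    using tambara class_in_hom[OF assms(1)] class_in_hom[OF assms(2)] assms(3) bispanD(1,4)[OF assms(1)]
      bispanD(4)[OF assms(2)]
    unfolding tambara_functor_def set_functor_def by (simp del: split_paired_All)
  then show ?thesis using assms(4) by (simp add: compose_def)
qed

section \<open>Restrictions and norms along arbitrary equivariant maps\<close>

lemma RS_closed: "finite_gset G X \<Longrightarrow> finite_gset G Y \<Longrightarrow> equivariant G X Y f \<Longrightarrow> z \<in> tob T Y \<Longrightarrow>
    RS X Y f z \<in> tob T X"
  using tmor_closed[OF is_bispan_res] by (simp add: res_map_eq)

lemma NM_closed: "finite_gset G X \<Longrightarrow> finite_gset G Y \<Longrightarrow> equivariant G X Y f \<Longrightarrow> z \<in> tob T X \<Longrightarrow>
    NM X Y f z \<in> tob T Y"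
  using tmor_closed[OF is_bispan_nm] by (simp add: nm_map_eq)

lemma RS_id: "finite_gset G X \<Longrightarrow> z \<in> tob T X \<Longrightarrow> RS X X id z = z"
  using tambara unfolding tambara_functor_def set_functor_def by simp

lemma NM_id: "finite_gset G X \<Longrightarrow> z \<in> tob T X \<Longrightarrow> NM X X id z = z"
  using RS_id nm_iso_class[OF _ _ equivariant_id equivariant_id] by simp

lemma RS_RS:
  assumes "finite_gset G X" "finite_gset G Y" "finite_gset G Z" "equivariant G X Y f" "equivariant G Y Z h"
    and "z \<in> tob T Z"
  shows "RS X Y f (RS Y Z h z) = RS X Z (h \<circ> f) z"
  using tmor_comp[OF is_bispan_res[OF assms(2,3,5)] is_bispan_res[OF assms(1,2,4)], of z] assms(6)
    res_res_class[OF assms(1-5)] by (simp add: res_map_eq)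

lemma NM_NM:
  assumes "finite_gset G X" "finite_gset G Y" "finite_gset G Z" "equivariant G X Y f" "equivariant G Y Z h"
    and "z \<in> tob T X"
  shows "NM Y Z h (NM X Y f z) = NM X Z (h \<circ> f) z"
  using tmor_comp[OF is_bispan_nm[OF assms(1,2,4)] is_bispan_nm[OF assms(2,3,5)], of z] assms(6)
    nm_nm_class[OF assms(1-5)] by (simp add: nm_map_eq)

text \<open>The source of every formula below for restricting a product or a norm. Only the pullback
  property of \<open>P\<close> is asked for, so any convenient model of the pullback may be
  used.\<close>

lemma RS_NM:
  assumes g: "finite_gset G X" "finite_gset G Y" "finite_gset G X'" "finite_gset G P"
    and f: "equivariant G X Y f" and h: "equivariant G X' Y h"
    and f': "equivariant G P X' f'" and h': "equivariant G P X h'"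
    and sq: "\<And>p. p \<in> points P \<Longrightarrow> f (h' p) = h (f' p)"
    and pb: "\<And>x x'. x \<in> points X \<Longrightarrow> x' \<in> points X' \<Longrightarrow> f x = h x' \<Longrightarrow>
      \<exists>!p. p \<in> points P \<and> h' p = x \<and> f' p = x'"
    and z: "z \<in> tob T X"
  shows "RS X' Y h (NM X Y f z) = NM P X' f' (RS P X h' z)"
proof -
  have "RS X' Y h (NM X Y f z) = tmor T (class_comp G (res_map G X' Y h) (nm_map G X Y f)) z"
    unfolding res_map_eq nm_map_eq
    by (rule tmor_comp[OF is_bispan_nm[OF g(1,2) f] is_bispan_res[OF g(3,2) h]]) (simp_all add: z)
  also have "class_comp G (res_map G X' Y h) (nm_map G X Y f) =
      class_comp G (nm_map G P X' f') (res_map G P X h')"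
    by (rule res_nm_class[OF g f h f' h' sq pb])
  also have "tmor T \<dots> z = NM P X' f' (RS P X h' z)"
    unfolding res_map_eq nm_map_eq
    by (rule tmor_comp[OF is_bispan_res[OF g(4,1) h'] is_bispan_nm[OF g(4,3) f'], symmetric]) (simp_all add: z)
  finally show ?thesis .
qed

lemma RS_cong:
  fixes X Y :: "('a, 'a pt) gset"
  assumes "finite_gset G X" "finite_gset G Y" "equivariant G X Y f" "\<And>x. x \<in> points X \<Longrightarrow> f x = f' x"
  shows "RS X Y f = RS X Y f'"
  using res_map_cong[OF assms] by simp

lemma NM_cong:
  fixes X Y :: "('a, 'a pt) gset"
  assumes "finite_gset G X" "finite_gset G Y" "equivariant G X Y f" "\<And>x. x \<in> points X \<Longrightarrow> f x = f' x"
  shows "NM X Y f = NM X Y f'"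
  using nm_map_cong[OF assms] by simp

section \<open>Multiplication as a norm along the fold map\<close>

lemma double_gset_finite: "finite_gset G X \<Longrightarrow> finite_gset G (double_gset X)"
  by (simp add: double_gset_eq sum_gset_finite)

lemma inl_double: "equivariant G X (double_gset X) inl_pt"
  by (simp add: double_gset_eq inl_equivariant)

lemma inr_double: "equivariant G X (double_gset X) inr_pt"
  by (simp add: double_gset_eq inr_equivariant)

lemma fold_double: "finite_gset G X \<Longrightarrow> equivariant G (double_gset X) X fold_pt"
  by (rule equivariantI) (auto simp: double_gset_eq sum_gset_points gset_closed)

lemma double_bij:
  assumes X: "finite_gset G X"
  shows "bij_betw (\<lambda>z. (RS X (double_gset X) inl_pt z, RS X (double_gset X) inr_pt z))
    (tob T (double_gset X)) (tob T X \<times> tob T X)"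
  using sum_is_product[OF X X] tambara
  unfolding tambara_functor_def product_preserving_def double_gset_eq by blast

lemma tpair_RS:
  assumes X: "finite_gset G X" and z: "z \<in> tob T (double_gset X)"
  shows "tpair G T X (RS X (double_gset X) inl_pt z) (RS X (double_gset X) inr_pt z) = z"
  unfolding tpair_def using z bij_betw_imp_inj_on[OF double_bij[OF X]]
  by (intro the_equality) (auto simp: inj_on_def)

lemma pair_ex:
  assumes X: "finite_gset G X" and "x \<in> tob T X" "y \<in> tob T X"
  obtains z where "z \<in> tob T (double_gset X)" "x = RS X (double_gset X) inl_pt z" "y = RS X (double_gset X) inr_pt z"
proof -
  have "(x, y) \<in> (\<lambda>z. (RS X (double_gset X) inl_pt z, RS X (double_gset X) inr_pt z)) ` tob T (double_gset X)"
    using bij_betw_imp_surj_on[OF double_bij[OF X]] assms(2,3) by simp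
  then show ?thesis using that by blast
qed

lemma carrier_level [simp]: "carrier (level_ring G T X) = tob T X"
  by (simp add: level_ring_def)

lemma cring_level: "finite_gset G X \<Longrightarrow> cring (level_ring G T X)"
  using tambara by (simp add: tambara_functor_def)

text \<open>With a pair encoded as one element over \<open>double_gset X\<close>, ring
  multiplication becomes a norm, and multiplicativity statements turn into identities between
  composites.\<close>

lemma mult_RS:
  assumes X: "finite_gset G X" and z: "z \<in> tob T (double_gset X)"
  shows "RS X (double_gset X) inl_pt z \<otimes>\<^bsub>level_ring G T X\<^esub> RS X (double_gset X) inr_pt z =
    NM (double_gset X) X fold_pt z"
  using tpair_RS[OF assms] by (simp add: level_ring_def)

text \<open>Factor \<open>f\<close> as the fold map after a map \<open>g\<close> that sends the two
  parts of \<open>A\<close> to different copies of \<open>X\<close>. The norm along the fold map is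
  a product, and base change along each inclusion recovers the norm on the corresponding
  part.\<close>

lemma NM_split:
  assumes A: "finite_gset G A" and X: "finite_gset G X" and f: "equivariant G A X f"
    and A1: "finite_gset G A1" "equivariant G A1 A i1" "inj_on i1 (points A1)"
    and A2: "finite_gset G A2" "equivariant G A2 A i2" "inj_on i2 (points A2)"
    and un: "points A = i1 ` points A1 \<union> i2 ` points A2" "i1 ` points A1 \<inter> i2 ` points A2 = {}"
    and z: "z \<in> tob T A"
  shows "NM A X f z = NM A1 X (f \<circ> i1) (RS A1 A i1 z) \<otimes>\<^bsub>level_ring G T X\<^esub> NM A2 X (f \<circ> i2) (RS A2 A i2 z)"
proof -
  define g where "g = (\<lambda>a. if a \<in> i1 ` points A1 then inl_pt (f a) else inr_pt (f a))"
  have D: "finite_gset G (double_gset X)" by (rule double_gset_finite[OF X])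
  have fX: "f a \<in> points X" if "a \<in> points A" for a using equivariant_closed[OF f that] .
  have im: "act A h a \<in> i1 ` points A1 \<longleftrightarrow> a \<in> i1 ` points A1" if "h \<in> carrier G" "a \<in> points A" for h a
  proof
    assume "a \<in> i1 ` points A1"
    then show "act A h a \<in> i1 ` points A1"
      using that A1(1,2) by (auto simp flip: equivariant_act intro!: gset_closed)
  next
    assume *: "act A h a \<in> i1 ` points A1"
    have "act A (inv h) (act A h a) \<in> i1 ` points A1"
      using * that A1(1,2) by (auto simp flip: equivariant_act[OF A1(2)] intro!: gset_closed)
    then show "a \<in> i1 ` points A1" using gset_inv_act[OF A that] by simp
  qed
  have g: "equivariant G A (double_gset X) g"
  proof (rule equivariantI)
    fix a assume "a \<in> points A" then show "g a \<in> points (double_gset X)"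
      using fX by (simp add: g_def double_gset_eq sum_gset_points)
  next
    fix h a assume h: "h \<in> carrier G" and a: "a \<in> points A"
    show "g (act A h a) = act (double_gset X) h (g a)"
      using fX[OF a] equivariant_act[OF f h a] im[OF h a] unfolding g_def by (simp add: double_gset_eq)
  qed
  let ?w = "NM A (double_gset X) g z"
  have w: "?w \<in> tob T (double_gset X)" by (rule NM_closed[OF A D g z])
  have "NM A X f z = NM A X (fold_pt \<circ> g) z"
    by (subst NM_cong[OF A X f, of "fold_pt \<circ> g"]) (auto simp: g_def)
  also have "\<dots> = NM (double_gset X) X fold_pt ?w"
    by (rule NM_NM[OF A D X g fold_double[OF X] z, symmetric])
  also have "\<dots> = RS X (double_gset X) inl_pt ?w \<otimes>\<^bsub>level_ring G T X\<^esub> RS X (double_gset X) inr_pt ?w"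
    by (rule mult_RS[OF X w, symmetric])
  also have "RS X (double_gset X) inl_pt ?w = NM A1 X (f \<circ> i1) (RS A1 A i1 z)"
  proof (rule RS_NM[OF A D X A1(1) g inl_double equivariant_comp[OF A1(2) f] A1(2) _ _ z])
    fix p assume "p \<in> points A1" then show "g (i1 p) = inl_pt ((f \<circ> i1) p)" by (simp add: g_def)
  next
    fix a x assume a: "a \<in> points A" and "x \<in> points X" and e: "g a = inl_pt x"
    have "a \<in> i1 ` points A1" "f a = x" using e by (auto simp: g_def split: if_splits)
    then obtain p where "p \<in> points A1" "i1 p = a" by auto
    then show "\<exists>!p. p \<in> points A1 \<and> i1 p = a \<and> (f \<circ> i1) p = x"
      using \<open>f a = x\<close> A1(3) by (intro ex1I[of _ p]) (auto dest: inj_onD)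
  qed
  also have "RS X (double_gset X) inr_pt ?w = NM A2 X (f \<circ> i2) (RS A2 A i2 z)"
  proof (rule RS_NM[OF A D X A2(1) g inr_double equivariant_comp[OF A2(2) f] A2(2) _ _ z])
    fix p assume "p \<in> points A2"
    then have "i2 p \<notin> i1 ` points A1" using un by blast
    then show "g (i2 p) = inr_pt ((f \<circ> i2) p)" by (simp add: g_def)
  next
    fix a x assume a: "a \<in> points A" and "x \<in> points X" and e: "g a = inr_pt x"
    have "a \<notin> i1 ` points A1" "f a = x" using e by (auto simp: g_def split: if_splits)
    then obtain p where "p \<in> points A2" "i2 p = a" using a un by auto
    then show "\<exists>!p. p \<in> points A2 \<and> i2 p = a \<and> (f \<circ> i2) p = x"
      using \<open>f a = x\<close> A2(3) by (intro ex1I[of _ p]) (auto dest: inj_onD)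
  qed
  finally show ?thesis .
qed

text \<open>Base change along the pullback square formed by the fold maps of \<open>X\<close> and
  \<open>Y\<close>, whose other side \<open>d\<close> is \<open>h\<close> on both copies.\<close>

lemma RS_mult:
  assumes X: "finite_gset G X" and Y: "finite_gset G Y" and h: "equivariant G X Y h"
    and x: "x \<in> tob T Y" and y: "y \<in> tob T Y"
  shows "RS X Y h (x \<otimes>\<^bsub>level_ring G T Y\<^esub> y) = RS X Y h x \<otimes>\<^bsub>level_ring G T X\<^esub> RS X Y h y"
proof -
  obtain w where w: "w \<in> tob T (double_gset Y)" "x = RS Y (double_gset Y) inl_pt w" "y = RS Y (double_gset Y) inr_pt w"
    by (rule pair_ex[OF Y x y])
  define d where "d = copair (inl_pt \<circ> h) (inr_pt \<circ> h)"
  note DX = double_gset_finite[OF X] and DY = double_gset_finite[OF Y]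
  have d: "equivariant G (double_gset X) (double_gset Y) d"
    unfolding d_def double_gset_eq
    by (intro copair_equivariant X equivariant_comp[OF h] inl_equivariant inr_equivariant)
  let ?v = "RS (double_gset X) (double_gset Y) d w"
  have v: "?v \<in> tob T (double_gset X)" by (rule RS_closed[OF DX DY d w(1)])
  have "RS X Y h (x \<otimes>\<^bsub>level_ring G T Y\<^esub> y) = RS X Y h (NM (double_gset Y) Y fold_pt w)"
    unfolding w(2,3) by (simp add: mult_RS[OF Y w(1)])
  also have "\<dots> = NM (double_gset X) X fold_pt ?v"
  proof (rule RS_NM[OF DY Y X DX fold_double[OF Y] h fold_double[OF X] d _ _ w(1)])
    fix p assume "p \<in> points (double_gset X)"
    then show "fold_pt (d p) = h (fold_pt p)" by (auto simp: d_def double_gset_eq sum_gset_points)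
  next
    fix p x assume p: "p \<in> points (double_gset Y)" and x: "x \<in> points X" and e: "fold_pt p = h x"
    then consider "p = inl_pt (h x)" | "p = inr_pt (h x)" by (auto simp: double_gset_eq sum_gset_points)
    then show "\<exists>!q. q \<in> points (double_gset X) \<and> d q = p \<and> fold_pt q = x"
    proof cases
      case 1 then show ?thesis
        using x by (intro ex1I[of _ "inl_pt x"]) (auto simp: d_def double_gset_eq sum_gset_points)
    next
      case 2 then show ?thesis
        using x by (intro ex1I[of _ "inr_pt x"]) (auto simp: d_def double_gset_eq sum_gset_points)
    qed
  qed
  also have "\<dots> = RS X (double_gset X) inl_pt ?v \<otimes>\<^bsub>level_ring G T X\<^esub> RS X (double_gset X) inr_pt ?v"
    by (rule mult_RS[OF X v, symmetric])
  also have "RS X (double_gset X) inl_pt ?v = RS X (double_gset Y) (inl_pt \<circ> h) w"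
    by (subst RS_RS[OF X DX DY inl_double d w(1)]) (simp add: d_def comp_def)
  also have "\<dots> = RS X Y h x" unfolding w(2) by (rule RS_RS[OF X Y DY h inl_double w(1), symmetric])
  also have "RS X (double_gset X) inr_pt ?v = RS X (double_gset Y) (inr_pt \<circ> h) w"
    by (subst RS_RS[OF X DX DY inr_double d w(1)]) (simp add: d_def comp_def)
  also have "\<dots> = RS X Y h y" unfolding w(3) by (rule RS_RS[OF X Y DY h inr_double w(1), symmetric])
  finally show ?thesis .
qed

text \<open>The left side is the norm along \<open>f \<circ> fold_pt\<close> from two copies of
  \<open>X\<close>; splitting it over the copies gives the right side.\<close>

lemma NM_mult:
  assumes X: "finite_gset G X" and Y: "finite_gset G Y" and f: "equivariant G X Y f"
    and x: "x \<in> tob T X" and y: "y \<in> tob T X"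
  shows "NM X Y f (x \<otimes>\<^bsub>level_ring G T X\<^esub> y) = NM X Y f x \<otimes>\<^bsub>level_ring G T Y\<^esub> NM X Y f y"
proof -
  obtain w where w: "w \<in> tob T (double_gset X)" "x = RS X (double_gset X) inl_pt w" "y = RS X (double_gset X) inr_pt w"
    by (rule pair_ex[OF X x y])
  note D = double_gset_finite[OF X]
  have "NM X Y f (x \<otimes>\<^bsub>level_ring G T X\<^esub> y) = NM (double_gset X) Y (f \<circ> fold_pt) w"
    unfolding w(2,3) mult_RS[OF X w(1)] by (rule NM_NM[OF D X Y fold_double[OF X] f w(1)])
  also have "\<dots> = NM X Y ((f \<circ> fold_pt) \<circ> inl_pt) (RS X (double_gset X) inl_pt w)
      \<otimes>\<^bsub>level_ring G T Y\<^esub> NM X Y ((f \<circ> fold_pt) \<circ> inr_pt) (RS X (double_gset X) inr_pt w)"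
    by (rule NM_split[OF D Y equivariant_comp[OF fold_double[OF X] f] X inl_double _ X inr_double _ _ _ w(1)])
      (auto simp: double_gset_eq sum_gset_points inj_on_def)
  finally show ?thesis using w by (simp add: comp_def)
qed

text \<open>The norm along the isomorphism \<open>i\<close> undoes the restriction along it, so the
  intermediate G-set may be reparametrized. This allows an orbit to be replaced by a coset
  space.\<close>

lemma NM_RS_iso:
  assumes A: "finite_gset G A" and B: "finite_gset G B" and X: "finite_gset G X" and Y: "finite_gset G Y"
    and i: "equivariant G A B i" "bij_betw i (points A) (points B)"
    and p: "equivariant G B Y p" and f: "equivariant G B X f" and y: "y \<in> tob T Y"
  shows "NM B X f (RS B Y p y) = NM A X (f \<circ> i) (RS A Y (p \<circ> i) y)"
proof -
  note h = equivariant_inv[OF A i]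
  have hi: "inv_into (points A) i (i a) = a" if "a \<in> points A" for a
    using that i(2) by (simp add: bij_betw_inv_into_left)
  have ih: "i (inv_into (points A) i b) = b" if "b \<in> points B" for b
    using that i(2) by (simp add: bij_betw_inv_into_right)
  have 1: "RS A Y (p \<circ> i) y = RS A B i (RS B Y p y)"
    by (rule RS_RS[OF A B Y i(1) p y, symmetric])
  let ?z = "RS B Y p y"
  have z: "?z \<in> tob T B" by (rule RS_closed[OF B Y p y])
  have "NM A X (f \<circ> i) (RS A B i ?z) = NM B X f (NM A B i (RS A B i ?z))"
    by (rule NM_NM[OF A B X i(1) f RS_closed[OF A B i(1) z], symmetric])
  also have "NM A B i (RS A B i ?z) = RS B A (inv_into (points A) i) (RS A B i ?z)"
    using nm_iso_class[OF A B i(1) h hi ih] by simp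
  also have "\<dots> = RS B B (i \<circ> inv_into (points A) i) ?z" by (rule RS_RS[OF B A B h i(1) z])
  also have "\<dots> = RS B B id ?z" using RS_cong[OF B B equivariant_comp[OF h i(1)], of id] ih by simp
  also have "\<dots> = ?z" by (rule RS_id[OF B z])
  finally show ?thesis unfolding 1 by (rule sym)
qed

end

subsection \<open>Products of nilpotent elements\<close>

text \<open>Products of exactly \<open>k \<ge> 1\<close> factors from \<open>S\<close>. Starting at
  one factor avoids the unit, so that only multiplicativity of restrictions and norms enters and
  never their value at one. The length is an index of a relation, since one element may be a product
  of several lengths.\<close>

inductive prods :: "('r, 'm) monoid_scheme \<Rightarrow> 'r set \<Rightarrow> nat \<Rightarrow> 'r \<Rightarrow> bool" for R S where
  prods_one: "s \<in> S \<Longrightarrow> prods R S 1 s"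
| prods_Suc: "prods R S k x \<Longrightarrow> s \<in> S \<Longrightarrow> prods R S (Suc k) (x \<otimes>\<^bsub>R\<^esub> s)"

lemma prods_closed:
  assumes "monoid R" "S \<subseteq> carrier R" "prods R S k x"
  shows "x \<in> carrier R"
  using assms(3) by induction (use assms(2) monoid.m_closed[OF assms(1)] in \<open>auto simp: subset_iff\<close>)

lemma prods_mult:
  assumes R: "monoid R" and S: "S \<subseteq> carrier R" and x: "prods R S j x" and y: "prods R S k y"
  shows "prods R S (j + k) (x \<otimes>\<^bsub>R\<^esub> y)"
  using y
proof induction
  case (prods_one s)
  then show ?case using prods_Suc[OF x] by simp
next
  case (prods_Suc k z s)
  have "x \<otimes>\<^bsub>R\<^esub> (z \<otimes>\<^bsub>R\<^esub> s) = (x \<otimes>\<^bsub>R\<^esub> z) \<otimes>\<^bsub>R\<^esub> s"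
    using monoid.m_assoc[OF R] prods_closed[OF R S x] prods_closed[OF R S prods_Suc(1)] prods_Suc(2) S by auto
  then show ?case using prods.prods_Suc[OF prods_Suc(3,2)] by simp
qed

lemma prods_monomial:
  assumes R: "comm_monoid R" and S: "S \<subseteq> carrier R" "finite S" and x: "prods R S k x"
  shows "\<exists>e. x = (\<Otimes>\<^bsub>R\<^esub>s\<in>S. s [^]\<^bsub>R\<^esub> (e s :: nat)) \<and> sum e S = k"
  using x
proof induction
  interpret comm_monoid R by (rule R)
  have split: "(\<Otimes>\<^bsub>R\<^esub>s\<in>S. s [^]\<^bsub>R\<^esub> (e s :: nat)) = t [^]\<^bsub>R\<^esub> e t \<otimes>\<^bsub>R\<^esub> (\<Otimes>\<^bsub>R\<^esub>s\<in>S - {t}. s [^]\<^bsub>R\<^esub> e s)"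
    "sum e S = e t + sum e (S - {t})" "(\<Otimes>\<^bsub>R\<^esub>s\<in>S - {t}. s [^]\<^bsub>R\<^esub> (e s :: nat)) \<in> carrier R"
    if "t \<in> S" for e t
    using that S finprod_insert[of "S - {t}" t "\<lambda>s. s [^]\<^bsub>R\<^esub> e s"] insert_Diff[OF that]
    by (auto simp: Pi_def sum.remove intro!: finprod_closed)
  {
    case (prods_one s)
    let ?e = "\<lambda>t. if t = s then 1 else 0 :: nat"
    have s: "s \<in> carrier R" using prods_one S by blast
    have "(\<Otimes>\<^bsub>R\<^esub>t\<in>S - {s}. t [^]\<^bsub>R\<^esub> ?e t) = \<one>\<^bsub>R\<^esub>" by (rule finprod_one_eqI) simp
    then have "(\<Otimes>\<^bsub>R\<^esub>t\<in>S. t [^]\<^bsub>R\<^esub> ?e t) = s" using split(1)[OF prods_one, of ?e] s by simp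
    moreover have "sum ?e S = 1" using prods_one S by (simp add: sum.delta')
    ultimately show ?case by (intro exI[of _ ?e]) simp
  next
    case (prods_Suc k x t)
    then obtain e where e: "x = (\<Otimes>\<^bsub>R\<^esub>s\<in>S. s [^]\<^bsub>R\<^esub> (e s :: nat))" "sum e S = k" by blast
    let ?e = "e(t := Suc (e t))"
    have t: "t \<in> carrier R" using prods_Suc S by blast
    have p: "(\<Otimes>\<^bsub>R\<^esub>s\<in>S - {t}. s [^]\<^bsub>R\<^esub> ?e s) = (\<Otimes>\<^bsub>R\<^esub>s\<in>S - {t}. s [^]\<^bsub>R\<^esub> e s)"
      using S by (intro finprod_cong') auto
    have "sum ?e (S - {t}) = sum e (S - {t})" by (rule sum.cong) auto
    then have "sum ?e S = Suc k" using split(2)[OF prods_Suc(2), of e] split(2)[OF prods_Suc(2), of ?e] e(2) by simp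
    moreover have "x \<otimes>\<^bsub>R\<^esub> t = (\<Otimes>\<^bsub>R\<^esub>s\<in>S. s [^]\<^bsub>R\<^esub> ?e s)"
      unfolding e(1) split(1)[OF prods_Suc(2), of e] split(1)[OF prods_Suc(2), of ?e] p
      using t split(3)[OF prods_Suc(2), of e] by (simp add: m_ac)
    ultimately show ?case by blast
  }
qed

text \<open>Pigeonhole: commutativity collects equal factors into powers. If more than
  \<open>n * card S\<close> factors are spread over \<open>card S\<close> elements, some exponent
  reaches \<open>n\<close>, and the ideal absorbs the rest.\<close>

lemma prods_nilpotent:
  assumes R: "cring R" and I: "ideal I R" and S: "S \<subseteq> carrier R" "finite S"
    and nil: "\<And>s. s \<in> S \<Longrightarrow> s [^]\<^bsub>R\<^esub> (n::nat) \<in> I"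
    and x: "prods R S k x" and k: "k > n * card S"
  shows "x \<in> I"
proof -
  interpret cring R by (rule R)
  interpret ideal I R by (rule I)
  obtain e where e: "x = (\<Otimes>\<^bsub>R\<^esub>s\<in>S. s [^]\<^bsub>R\<^esub> (e s :: nat))" "sum e S = k"
    using prods_monomial[OF comm_monoid_axioms S x] by blast
  obtain t where t: "t \<in> S" "e t \<ge> n"
  proof (rule ccontr)
    assume "\<not> thesis"
    then have "e s \<le> n" if "s \<in> S" for s using that \<open>\<And>t. \<lbrakk>t \<in> S; n \<le> e t\<rbrakk> \<Longrightarrow> thesis\<close> by force
    then have "sum e S \<le> card S * n" using sum_bounded_above[of S e n] by simp
    then show False using e(2) k by (simp add: mult.commute)
  qed
  have tc: "t \<in> carrier R" using t S by blast
  have "t [^]\<^bsub>R\<^esub> n \<otimes>\<^bsub>R\<^esub> t [^]\<^bsub>R\<^esub> (e t - n) = t [^]\<^bsub>R\<^esub> e t" using nat_pow_mult[OF tc, of n "e t - n"] t by simp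
  then have "t [^]\<^bsub>R\<^esub> e t \<in> I" using I_r_closed[OF nil[OF t(1)], of "t [^]\<^bsub>R\<^esub> (e t - n)"] tc by simp
  moreover have "x = t [^]\<^bsub>R\<^esub> e t \<otimes>\<^bsub>R\<^esub> (\<Otimes>\<^bsub>R\<^esub>s\<in>S - {t}. s [^]\<^bsub>R\<^esub> e s)"
    unfolding e(1) using t S finprod_insert[of "S - {t}" t "\<lambda>s. s [^]\<^bsub>R\<^esub> e s"] insert_Diff[OF t(1)]
    by (auto simp: Pi_def)
  moreover have "(\<Otimes>\<^bsub>R\<^esub>s\<in>S - {t}. s [^]\<^bsub>R\<^esub> e s) \<in> carrier R" using S by (intro finprod_closed) auto
  ultimately show ?thesis using I_r_closed by simp
qed

subsection \<open>Admissible maps and pullbacks\<close>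

context group
begin

lemma ts_subgroup:
  assumes "transfer_system G \<O>" "(K, H) \<in> \<O>"
  shows "subgroup K G" "subgroup H G" "K \<subseteq> H"
proof -
  have "\<forall>(K, H)\<in>\<O>. subgroup K G \<and> subgroup H G \<and> K \<subseteq> H"
    using assms(1) unfolding transfer_system_def by (rule conjunct1)
  from bspec[OF this assms(2)] show "subgroup K G" "subgroup H G" "K \<subseteq> H" by simp_all
qed

lemma ts_refl: "transfer_system G \<O> \<Longrightarrow> subgroup H G \<Longrightarrow> (H, H) \<in> \<O>"
  unfolding transfer_system_def by blast

lemma ts_trans: "transfer_system G \<O> \<Longrightarrow> (L, K) \<in> \<O> \<Longrightarrow> (K, H) \<in> \<O> \<Longrightarrow> (L, H) \<in> \<O>"
  unfolding transfer_system_def by blast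

lemma ts_conj: "transfer_system G \<O> \<Longrightarrow> (K, H) \<in> \<O> \<Longrightarrow> g \<in> carrier G \<Longrightarrow> (conjugate G g K, conjugate G g H) \<in> \<O>"
  unfolding transfer_system_def by blast

lemma ts_restrict: "transfer_system G \<O> \<Longrightarrow> (K, H) \<in> \<O> \<Longrightarrow> subgroup L G \<Longrightarrow> L \<subseteq> H \<Longrightarrow> (K \<inter> L, L) \<in> \<O>"
  unfolding transfer_system_def by blast

text \<open>The condition that \<open>admissible\<close> imposes on the maps \<open>n\<close> and
  \<open>t\<close>, isolated for a single map so that it can be composed and pulled back.\<close>

definition adm_map :: "('a set \<times> 'a set) set \<Rightarrow> ('a, 'x) gset \<Rightarrow> ('a, 'y) gset \<Rightarrow> ('x \<Rightarrow> 'y) \<Rightarrow> bool" where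
  "adm_map \<O> X Y f \<longleftrightarrow> (\<forall>x\<in>points X. (stabilizer G (act X) x, stabilizer G (act Y) (f x)) \<in> \<O>)"

lemma adm_map_inj:
  assumes "transfer_system G \<O>" "finite_gset G X" "equivariant G X Y f" "inj_on f (points X)"
  shows "adm_map \<O> X Y f"
  unfolding adm_map_def using assms ts_refl stabilizer_sub stabilizer_inj by metis

lemma adm_map_comp:
  assumes "transfer_system G \<O>" "equivariant G X Y f" "adm_map \<O> X Y f" "adm_map \<O> Y Z h"
  shows "adm_map \<O> X Z (h \<circ> f)"
  using assms(3,4) ts_trans[OF assms(1)] equivariant_closed[OF assms(2)] unfolding adm_map_def
  by (metis comp_apply)

lemma adm_map_coset_proj:
  assumes O: "transfer_system G \<O>" and KH: "(K, H) \<in> \<O>"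
  shows "adm_map \<O> (coset_gset G K) (coset_gset G H) (coset_proj G H)"
proof -
  note s = ts_subgroup[OF O KH]
  show ?thesis
    unfolding adm_map_def coset_gset_points
    using ts_conj[OF O KH] coset_gset_stabilizer[OF s(1)] coset_gset_stabilizer[OF s(2)] coset_proj_eq[OF s] by auto
qed

lemma transport_gset:
  assumes X: "finite_gset G X" and e: "inj_on e (points X)"
  shows "\<exists>Y. finite_gset G Y \<and> points Y = e ` points X \<and> equivariant G X Y e"
proof -
  let ?d = "inv_into (points X) e"
  define Y where "Y = \<lparr>points = e ` points X, act = (\<lambda>g. \<lambda>z\<in>e ` points X. e (act X g (?d z)))\<rparr>"
  have p: "points Y = e ` points X" by (simp add: Y_def)
  have a: "act Y g (e x) = e (act X g x)" if "x \<in> points X" for g x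
    using that e by (simp add: Y_def)
  have "finite_gset G Y"
  proof (rule finite_gsetI)
    show "finite (points Y)" using gset_finite[OF X] p by simp
    show "act Y g \<in> extensional (points Y)" for g by (simp add: Y_def)
  qed (use X in \<open>auto simp: p a gset_closed gset_one gset_mult\<close>)
  moreover have "equivariant G X Y e" by (rule equivariantI) (auto simp: a p)
  ultimately show ?thesis using p by blast
qed

text \<open>A pullback has points in a product type, while objects of the category have points in
  \<open>'a pt\<close>. Numbering the points in the second component of \<open>'a pt\<close> embeds
  any finite G-set.\<close>

lemma ex_pt_gset:
  assumes X: "finite_gset G X"
  shows "\<exists>(Y :: ('a, 'a pt) gset) i. finite_gset G Y \<and> equivariant G Y X i \<and> bij_betw i (points Y) (points X)"
proof -
  obtain h :: "_ \<Rightarrow> nat" where "bij_betw h (points X) {0..<card (points X)}"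
    using ex_bij_betw_finite_nat[OF gset_finite[OF X]] by blast
  then have "inj_on (\<lambda>x. ({}, h x) :: 'a pt) (points X)" by (auto simp: bij_betw_def inj_on_def)
  from transport_gset[OF X this] obtain Y :: "('a, 'a pt) gset" and e where
    Y: "finite_gset G Y" "points Y = e ` points X" "equivariant G X Y e" "inj_on e (points X)" 
    using \<open>inj_on (\<lambda>x. ({}, h x) :: 'a pt) (points X)\<close> by blast
  then have "bij_betw e (points X) (points Y)" by (simp add: bij_betw_def)
  then show ?thesis using Y equivariant_inv[OF X Y(3)] bij_betw_inv_into by blast
qed

lemma pullback_gset_finite:
  assumes X: "finite_gset G X" and Y: "finite_gset G Y" and f: "equivariant G X Z f" and h: "equivariant G Y Z h"
  shows "finite_gset G (pullback_gset X f Y h)"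
proof (rule finite_gsetI)
  have "points (pullback_gset X f Y h) \<subseteq> points X \<times> points Y" by (auto simp: pullback_gset_def Let_def)
  then show "finite (points (pullback_gset X f Y h))"
    by (rule finite_subset) (simp add: gset_finite[OF X] gset_finite[OF Y])
  show "act (pullback_gset X f Y h) g \<in> extensional (points (pullback_gset X f Y h))" for g
    by (simp add: pullback_gset_def Let_def)
qed (auto simp: pullback_gset_def Let_def gset_closed[OF X] gset_closed[OF Y] gset_one[OF X] gset_one[OF Y]
    gset_mult[OF X] gset_mult[OF Y] equivariant_act[OF f] equivariant_act[OF h])

text \<open>The stabilizer of a point \<open>(x, y)\<close> of the pullback is the intersection of
  the stabilizers of \<open>x\<close> and \<open>y\<close>, so admissibility of the base change
  follows from the restriction axiom of a transfer system. The model is then moved to points in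
  \<open>'a pt\<close>.\<close>

lemma ex_pullback:
  fixes X Y Z :: "('a, 'a pt) gset"
  assumes O: "transfer_system G \<O>" and X: "finite_gset G X" and Y: "finite_gset G Y" and f: "equivariant G X Z f"
    and h: "equivariant G Y Z h" and adm: "adm_map \<O> X Z f"
  shows "\<exists>(P :: ('a, 'a pt) gset) p q. finite_gset G P \<and> equivariant G P X p \<and> equivariant G P Y q \<and>
    adm_map \<O> P Y q \<and> (\<forall>z\<in>points P. f (p z) = h (q z)) \<and>
    (\<forall>x\<in>points X. \<forall>y\<in>points Y. f x = h y \<longrightarrow> (\<exists>!z. z \<in> points P \<and> p z = x \<and> q z = y))"
proof -
  let ?Q = "pullback_gset X f Y h"
  have Q: "finite_gset G ?Q" by (rule pullback_gset_finite[OF X Y f h])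
  have Qp: "points ?Q = {(x, y). x \<in> points X \<and> y \<in> points Y \<and> f x = h y}" by (simp add: pullback_gset_def Let_def)
  have Qa: "act ?Q g (x, y) = (act X g x, act Y g y)" if "(x, y) \<in> points ?Q" for g x y
    using that by (simp add: pullback_gset_def Let_def)
  have p: "equivariant G ?Q X fst" and q: "equivariant G ?Q Y snd"
    by (rule equivariantI; use Qa in \<open>auto simp: Qp\<close>)+
  obtain P :: "('a, 'a pt) gset" and i where P: "finite_gset G P" "equivariant G P ?Q i" "bij_betw i (points P) (points ?Q)"
    using ex_pt_gset[OF Q] by blast
  have iQ: "i z \<in> points ?Q" if "z \<in> points P" for z using P(2) that by (rule equivariant_closed)
  have iadm: "adm_map \<O> P ?Q i" using adm_map_inj[OF O P(1,2)] P(3) by (simp add: bij_betw_def)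
  have "adm_map \<O> ?Q Y snd"
    unfolding adm_map_def
  proof
    fix w assume w: "w \<in> points ?Q"
    obtain x y where xy: "w = (x, y)" "x \<in> points X" "y \<in> points Y" "f x = h y" using w Qp by auto
    have "stabilizer G (act ?Q) w = stabilizer G (act X) x \<inter> stabilizer G (act Y) y"
      using Qa w xy by (auto simp: stabilizer_def)
    moreover have "(stabilizer G (act X) x \<inter> stabilizer G (act Y) y, stabilizer G (act Y) y) \<in> \<O>"
      using adm xy stabilizer_sub[OF Y xy(3)] stabilizer_mono[OF h xy(3)]
      by (intro ts_restrict[OF O, of _ "stabilizer G (act Z) (f x)"]) (auto simp: adm_map_def)
    ultimately show "(stabilizer G (act ?Q) w, stabilizer G (act Y) (snd w)) \<in> \<O>" using xy by simp
  qed
  then have a: "adm_map \<O> P Y (snd \<circ> i)" by (rule adm_map_comp[OF O P(2) iadm])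
  have u: "\<exists>!z. z \<in> points P \<and> (fst \<circ> i) z = x \<and> (snd \<circ> i) z = y"
    if "x \<in> points X" "y \<in> points Y" "f x = h y" for x y
  proof -
    have "(x, y) \<in> points ?Q" using that Qp by simp
    then obtain z where z: "z \<in> points P" "i z = (x, y)" using P(3) by (metis bij_betw_imp_surj_on imageE)
    show ?thesis
    proof (rule ex1I[of _ z])
      fix z' assume z': "z' \<in> points P \<and> (fst \<circ> i) z' = x \<and> (snd \<circ> i) z' = y"
      then have "i z' = i z" using z by (simp add: prod_eq_iff)
      then show "z' = z" using z z' P(3) by (metis bij_betw_imp_inj_on inj_onD)
    qed (use z in simp)
  qed
  show ?thesis
  proof (rule exI[of _ P], rule exI[of _ "fst \<circ> i"], rule exI[of _ "snd \<circ> i"], intro conjI ballI impI)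
    show "f ((fst \<circ> i) z) = h ((snd \<circ> i) z)" if "z \<in> points P" for z
      using iQ[OF that] Qp by auto
  qed (use P(1) equivariant_comp[OF P(2) p] equivariant_comp[OF P(2) q] a u in \<open>simp_all del: split_paired_All split_paired_Ex\<close>)
qed

end

subsection \<open>Radicality of prime ideals\<close>

lemma tidealD:
  assumes "tideal G \<O>m \<O>a T I"
  shows tideal_ideal: "subgroup H G \<Longrightarrow> ideal (I H) (level G T H)"
    and tideal_res: "subgroup H G \<Longrightarrow> subgroup K G \<Longrightarrow> K \<subseteq> H \<Longrightarrow> z \<in> I H \<Longrightarrow> res G T H K z \<in> I K"
    and tideal_cj: "subgroup H G \<Longrightarrow> g \<in> carrier G \<Longrightarrow> z \<in> I H \<Longrightarrow> cj G T H g z \<in> I (conjugate G g H)"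
    and tideal_tr: "(K, H) \<in> \<O>a \<Longrightarrow> z \<in> I K \<Longrightarrow> tr G T K H z \<in> I H"
    and tideal_nm: "(K, H) \<in> \<O>m \<Longrightarrow> z \<in> I K \<Longrightarrow> nm G T K H z \<in> I H"
  using assms unfolding tideal_def image_subset_iff by (elim conjE; force)+

text \<open>The exponent is positive because \<open>F\<close> is not assumed to preserve
  one.\<close>

lemma power_hom:
  assumes R: "monoid R" and S: "monoid S" and cl: "\<And>x. x \<in> carrier R \<Longrightarrow> F x \<in> carrier S"
    and F: "\<And>x y. x \<in> carrier R \<Longrightarrow> y \<in> carrier R \<Longrightarrow> F (x \<otimes>\<^bsub>R\<^esub> y) = F x \<otimes>\<^bsub>S\<^esub> F y"
    and x: "x \<in> carrier R"
  shows "F (x [^]\<^bsub>R\<^esub> Suc n) = F x [^]\<^bsub>S\<^esub> Suc n"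
proof (induction n)
  case 0
  show ?case using x cl monoid.nat_pow_Suc[OF R] monoid.nat_pow_Suc[OF S] R S
    by (simp add: monoid.l_one)
next
  case (Suc n)
  have "F (x [^]\<^bsub>R\<^esub> Suc (Suc n)) = F (x [^]\<^bsub>R\<^esub> Suc n \<otimes>\<^bsub>R\<^esub> x)" by simp
  also have "\<dots> = F (x [^]\<^bsub>R\<^esub> Suc n) \<otimes>\<^bsub>S\<^esub> F x"
    by (intro F x monoid.nat_pow_closed[OF R])
  also have "\<dots> = F x [^]\<^bsub>S\<^esub> Suc (Suc n)" by (simp only: Suc.IH monoid.nat_pow_Suc[OF S, of "F x" "Suc n"])
  finally show ?case .
qed

context complete_tambara
begin

abbreviation CG where "CG H \<equiv> coset_gset G H"

lemma CG: "subgroup H G \<Longrightarrow> finite_gset G (CG H)"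
  by (rule coset_gset_finite[OF fin])

lemma level_cring: "subgroup H G \<Longrightarrow> cring (level G T H)"
  by (rule cring_level[OF CG])

lemma level_monoid: "subgroup H G \<Longrightarrow> monoid (level G T H)"
  using level_cring cring.axioms(1) ring.is_monoid by blast

lemma subgroup_conjugate: "subgroup K G \<Longrightarrow> g \<in> carrier G \<Longrightarrow> subgroup (conjugate G g K) G"
  by (rule conjugate_subgroup[OF fin])

text \<open>The map \<open>G/gKg\<^sup>-\<^sup>1 \<rightarrow> G/H\<close> induced by right multiplication with \<open>g\<close>.\<close>

definition twist :: "'a set \<Rightarrow> 'a \<Rightarrow> 'a pt \<Rightarrow> 'a pt" where
  "twist H g = coset_proj G H \<circ> coset_conj G (inv g)"

text \<open>Writes a conjugated restriction as one restriction along a map of coset spaces, so that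
  each factor in \<open>Qcond\<close> becomes a norm of a single restriction.\<close>

lemma twist:
  assumes K: "subgroup K G" and H: "subgroup H G" and KH: "K \<subseteq> H" and g: "g \<in> carrier G"
  shows "equivariant G (CG (conjugate G g K)) (CG H) (twist H g)"
    and "x \<in> carrier G \<Longrightarrow> twist H g (x <# conjugate G g K, 0) = ((x \<otimes> g) <# H, 0)"
    and "y \<in> tob T (CG H) \<Longrightarrow> cj G T K g (res G T H K y) = RS (CG (conjugate G g K)) (CG H) (twist H g) y"
proof -
  let ?C = "conjugate G g K"
  have C: "subgroup ?C G" by (rule subgroup_conjugate[OF K g])
  have e: "equivariant G (CG ?C) (CG K) (coset_conj G (inv g))"
    using coset_conj_equivariant[OF fin C, of "inv g"] g K by (simp add: conjugate_inv)
  show "equivariant G (CG ?C) (CG H) (twist H g)"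
    unfolding twist_def by (rule equivariant_comp[OF e coset_proj_equivariant[OF K H KH]])
  show "twist H g (x <# ?C, 0) = ((x \<otimes> g) <# H, 0)" if "x \<in> carrier G"
    using coset_conj_eq[OF C _ that, of "inv g"] coset_proj_eq[OF K H KH] g that K
    by (simp add: twist_def conjugate_inv)
  show "cj G T K g (res G T H K y) = RS (CG ?C) (CG H) (twist H g) y" if "y \<in> tob T (CG H)"
    unfolding cj_def res_def cj_class[OF fin K g] twist_def
    by (rule RS_RS[OF CG[OF C] CG[OF K] CG[OF H] e coset_proj_equivariant[OF K H KH] that])
qed

text \<open>An equivariant map out of G/J is determined by the image gH of the coset of one, and
  \<open>J\<close> lies in the stabilizer of gH, the conjugate of \<open>H\<close> by
  \<open>g\<close>. So the map is a \<open>twist\<close>, with \<open>K\<close> the conjugate of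
  \<open>J\<close> by \<open>inv g\<close>. Ideals are therefore closed under restriction along all
  such maps.\<close>

lemma equivariant_coset_twist:
  assumes J: "subgroup J G" and H: "subgroup H G" and q: "equivariant G (CG J) (CG H) q"
  obtains K g where "subgroup K G" "K \<subseteq> H" "g \<in> carrier G" "J = conjugate G g K"
    "RS (CG J) (CG H) q = RS (CG J) (CG H) (twist H g)"
proof -
  have o: "(\<one> <# J, 0) \<in> points (CG J)" by (rule coset_gset_point) simp
  obtain g where g: "g \<in> carrier G" "q (\<one> <# J, 0) = (g <# H, 0)"
    using equivariant_closed[OF q o] by (auto simp: coset_gset_points)
  define K where "K = conjugate G (inv g) J"
  have K: "subgroup K G" unfolding K_def using subgroup_conjugate[OF J] g by simp
  have JK: "J = conjugate G g K" unfolding K_def using conjugate_inv[OF J g(1)] by simp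
  have "J \<subseteq> conjugate G g H"
    using stabilizer_mono[OF q o] coset_gset_stabilizer[OF J, of \<one>] coset_gset_stabilizer[OF H g(1)]
    by (simp add: g conjugate_one J)
  then have KH: "K \<subseteq> H"
    unfolding K_def using conjugate_mono[of J _ "inv g"] conjugate_inv(2)[OF H g(1)] by blast
  have "q z = twist H g z" if zJ: "z \<in> points (CG J)" for z
  proof -
    obtain x where x: "x \<in> carrier G" "z = (x <# J, 0)" using zJ by (auto simp: coset_gset_points)
    have "q z = act (CG H) x (q (\<one> <# J, 0))"
      using equivariant_act[OF q x(1) o] coset_gset_act[OF J one_closed x(1)] x by simp
    then show ?thesis
      using twist(2)[OF K H KH g(1) x(1)] g coset_gset_act[OF H g(1) x(1)] x by (simp flip: JK)
  qed
  then show ?thesis using that[OF K KH g(1) JK] RS_cong[OF CG[OF J] CG[OF H] q] by blast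
qed

text \<open>The factors that occur in \<open>Qcond\<close> at level \<open>L\<close>, with the
  conjugated restriction replaced by an arbitrary map of coset spaces. In this form composition and
  base change can be carried out without tracking subgroups and conjugating elements.\<close>

definition norm_terms :: "('a set \<times> 'a set) set \<Rightarrow> 'a set \<Rightarrow> 'c \<Rightarrow> 'a set \<Rightarrow> 'c set" where
  "norm_terms \<O> H y L = {nm G T J L (RS (CG J) (CG H) q y) | J q. (J, L) \<in> \<O> \<and> equivariant G (CG J) (CG H) q}"

context
  fixes \<O> :: "('a set \<times> 'a set) set" and H y
  assumes O: "transfer_system G \<O>" and H: "subgroup H G" and y: "y \<in> tob T (CG H)"
begin

lemma norm_terms_closed:
  assumes L: "subgroup L G"
  shows "norm_terms \<O> H y L \<subseteq> carrier (level G T L)"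
proof
  fix s assume "s \<in> norm_terms \<O> H y L"
  then obtain J q where J: "(J, L) \<in> \<O>" "equivariant G (CG J) (CG H) q" "s = nm G T J L (RS (CG J) (CG H) q y)"
    unfolding norm_terms_def by blast
  note s = ts_subgroup[OF O J(1)]
  show "s \<in> carrier (level G T L)"
    unfolding J(3) nm_def using NM_closed[OF CG[OF s(1)] CG[OF L] coset_proj_equivariant[OF s]
        RS_closed[OF CG[OF s(1)] CG[OF H] J(2) y]] by simp
qed

lemma norm_terms_finite:
  assumes L: "subgroup L G"
  shows "finite (norm_terms \<O> H y L)"
proof -
  have "norm_terms \<O> H y L \<subseteq> (\<lambda>(J, q). nm G T J L (RS (CG J) (CG H) q y)) `
      (SIGMA J:Pow (carrier G). points (CG J) \<rightarrow>\<^sub>E points (CG H))"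
  proof
    fix s assume "s \<in> norm_terms \<O> H y L"
    then obtain J q where J: "(J, L) \<in> \<O>" "equivariant G (CG J) (CG H) q" "s = nm G T J L (RS (CG J) (CG H) q y)"
      unfolding norm_terms_def by blast
    note s = ts_subgroup[OF O J(1)]
    \<comment> \<open>The restriction depends only on the values of \<open>q\<close> on points, so
      \<open>q\<close> may be cut down to an extensional map, of which there are finitely
      many.\<close>
    let ?q = "restrict q (points (CG J))"
    have "RS (CG J) (CG H) q = RS (CG J) (CG H) ?q" by (rule RS_cong[OF CG[OF s(1)] CG[OF H] J(2)]) simp
    moreover have "?q \<in> points (CG J) \<rightarrow>\<^sub>E points (CG H)" using equivariant_closed[OF J(2)] by auto
    ultimately show "s \<in> (\<lambda>(J, q). nm G T J L (RS (CG J) (CG H) q y)) `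
        (SIGMA J:Pow (carrier G). points (CG J) \<rightarrow>\<^sub>E points (CG H))"
      using J(3) subgroup.subset[OF s(1)] by (intro image_eqI[of _ _ "(J, ?q)"]) auto
  qed
  moreover have "finite (points (CG J))" for J
    using fin by (simp add: coset_gset_def Let_def LCOSETS_def)
  then have "finite (SIGMA J:Pow (carrier G). points (CG J) \<rightarrow>\<^sub>E points (CG H))"
    using fin by (intro finite_SigmaI finite_PiE) auto
  ultimately show ?thesis by (meson finite_imageI finite_subset)
qed

text \<open>The norm along \<open>f\<close> is the product of the norms along its restrictions to the orbits of \<open>A\<close>;
  applied to a pullback this gives the double coset formula for the restriction of a norm.\<close>

lemma NM_prods:
  assumes L: "subgroup L G" and "finite_gset G A" "equivariant G A (CG L) f" "adm_map \<O> A (CG L) f"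
    "equivariant G A (CG H) p" "points A \<noteq> {}"
  shows "\<exists>k\<ge>1. prods (level G T L) (norm_terms \<O> H y L) k (NM A (CG L) f (RS A (CG H) p y))"
  using assms(2-)
proof (induction "card (points A)" arbitrary: A f p rule: less_induct)
  case (less A f p)
  note A = less.prems(1) and f = less.prems(2) and adm = less.prems(3) and p = less.prems(4)
  obtain a0 where a0: "a0 \<in> points A" using less.prems(5) by blast
  obtain x where x: "x \<in> carrier G" "f a0 = (x <# L, 0)"
    using equivariant_closed[OF f a0] by (auto simp: coset_gset_points)
  \<comment> \<open>The chosen point is translated to lie over the identity coset, so that its
    stabilizer is a subgroup of \<open>L\<close> itself and not of a conjugate.\<close>
  define a where "a = act A (inv x) a0"
  have a: "a \<in> points A" unfolding a_def using gset_closed[OF A _ a0] x by simp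
  have fa: "f a = (\<one> <# L, 0)"
    unfolding a_def using equivariant_act[OF f _ a0, of "inv x"] x coset_gset_act[OF L x(1), of "inv x"] by simp
  define J where "J = stabilizer G (act A) a"
  have J: "subgroup J G" unfolding J_def by (rule stabilizer_sub[OF A a])
  have JL: "(J, L) \<in> \<O>"
    using adm a fa coset_gset_stabilizer[OF L one_closed] conjugate_one[OF L] by (auto simp: adm_map_def J_def)
  have JL': "J \<subseteq> L" using ts_subgroup[OF O JL] by blast
  define i where "i = orbit_map A a"
  have i: "equivariant G (CG J) A i" unfolding i_def by (rule orbit_map_equivariant[OF A a J]) (simp add: J_def)
  have ig: "i (g <# J, 0) = act A g a" if "g \<in> carrier G" for g
    unfolding i_def using orbit_map_eq[OF A a J _ that] by (simp add: J_def)
  have inj: "inj_on i (points (CG J))"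
  proof (rule inj_onI)
    fix u v assume "u \<in> points (CG J)" "v \<in> points (CG J)" and e: "i u = i v"
    then obtain g h where gh: "g \<in> carrier G" "h \<in> carrier G" "u = (g <# J, 0)" "v = (h <# J, 0)"
      by (auto simp: coset_gset_points)
    then have "act A g a = act A h a" using e ig by simp
    then have "act A (inv g \<otimes> h) a = a" using gh gset_mult[OF A _ _ a, of "inv g" h] gset_inv_act[OF A _ a, of g] by simp
    then have "inv g \<otimes> h \<in> J" using gh by (simp add: J_def stabilizer_def)
    then show "u = v" using gh l_coset_eq[OF J] by simp
  qed
  have fi: "NM (CG J) (CG L) (f \<circ> i) = nm G T J L"
    unfolding nm_def
  proof (rule NM_cong[OF CG[OF J] CG[OF L] equivariant_comp[OF i f]])
    fix u assume "u \<in> points (CG J)"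
    then obtain g where g: "g \<in> carrier G" "u = (g <# J, 0)" by (auto simp: coset_gset_points)
    then show "(f \<circ> i) u = coset_proj G L u"
      using ig equivariant_act[OF f _ a, of g] fa coset_gset_act[OF L one_closed, of g] coset_proj_eq[OF J L JL']
      by simp
  qed
  have trm: "prods (level G T L) (norm_terms \<O> H y L) 1 (NM (CG J) (CG L) (f \<circ> i) (RS (CG J) (CG H) (p \<circ> i) y))"
    unfolding fi using JL equivariant_comp[OF i p] by (intro prods_one) (auto simp: norm_terms_def)
  show ?case
  proof (cases "i ` points (CG J) = points A")
    case True
    then have "bij_betw i (points (CG J)) (points A)" using inj by (simp add: bij_betw_def)
    then show ?thesis using trm NM_RS_iso[OF CG[OF J] A CG[OF L] CG[OF H] i _ p f y] by auto
  next
    case False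
    \<comment> \<open>The complement of the orbit is again invariant and has fewer points, so the
      induction hypothesis supplies its factors.\<close>
    define U where "U = points A - i ` points (CG J)"
    let ?A2 = "sub_gset A U"
    have iA: "i ` points (CG J) \<subseteq> points A" using equivariant_closed[OF i] by blast
    have gU: "act A g b \<in> U" if g: "g \<in> carrier G" and b: "b \<in> U" for g b
    proof -
      have bA: "b \<in> points A" using b by (simp add: U_def)
      have "b \<in> i ` points (CG J)" if "act A g b \<in> i ` points (CG J)"
      proof -
        from that obtain u where u: "u \<in> points (CG J)" "act A g b = i u" by auto
        have "b = act A (inv g) (i u)" using gset_inv_act[OF A g bA] u by simp
        also have "\<dots> = i (act (CG J) (inv g) u)" using equivariant_act[OF i _ u(1)] g by simp
        finally show ?thesis using gset_closed[OF CG[OF J] _ u(1)] g by blast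
      qed
      then show ?thesis using b gset_closed[OF A g bA] by (auto simp: U_def)
    qed
    have U: "U \<subseteq> points A" by (auto simp: U_def)
    have A2: "finite_gset G ?A2" by (rule sub_gset_finite[OF A U gU])
    have i2: "equivariant G ?A2 A id" by (rule sub_gset_incl[OF U])
    have z: "RS A (CG H) p y \<in> tob T A" by (rule RS_closed[OF A CG[OF H] p y])
    have "NM A (CG L) f (RS A (CG H) p y) =
        NM (CG J) (CG L) (f \<circ> i) (RS (CG J) A i (RS A (CG H) p y)) \<otimes>\<^bsub>level G T L\<^esub>
        NM ?A2 (CG L) (f \<circ> id) (RS ?A2 A id (RS A (CG H) p y))"
      using iA U by (intro NM_split[OF A CG[OF L] f CG[OF J] i inj A2 i2 _ _ _ z]) (auto simp: U_def)
    also have "RS (CG J) A i (RS A (CG H) p y) = RS (CG J) (CG H) (p \<circ> i) y"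
      by (rule RS_RS[OF CG[OF J] A CG[OF H] i p y])
    also have "RS ?A2 A id (RS A (CG H) p y) = RS ?A2 (CG H) (p \<circ> id) y"
      by (rule RS_RS[OF A2 A CG[OF H] i2 p y])
    finally have eq: "NM A (CG L) f (RS A (CG H) p y) =
        NM (CG J) (CG L) (f \<circ> i) (RS (CG J) (CG H) (p \<circ> i) y) \<otimes>\<^bsub>level G T L\<^esub>
        NM ?A2 (CG L) (f \<circ> id) (RS ?A2 (CG H) (p \<circ> id) y)" .
    have "(\<one> <# J, 0) \<in> points (CG J)" by (rule coset_gset_point) simp
    then have "U \<subset> points A" using iA by (auto simp: U_def)
    then have "card (points ?A2) < card (points A)" using psubset_card_mono[OF gset_finite[OF A]] by simp
    moreover have "points ?A2 \<noteq> {}" using False iA by (auto simp: U_def)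
    moreover have "adm_map \<O> ?A2 A id" using adm_map_inj[OF O A2 i2] by simp
    then have "adm_map \<O> ?A2 (CG L) (f \<circ> id)" by (rule adm_map_comp[OF O i2 _ adm])
    ultimately obtain k where "k \<ge> 1" "prods (level G T L) (norm_terms \<O> H y L) k
        (NM ?A2 (CG L) (f \<circ> id) (RS ?A2 (CG H) (p \<circ> id) y))"
      using less.hyps[OF _ A2 equivariant_comp[OF i2 f] _ equivariant_comp[OF i2 p]] by blast
    then show ?thesis unfolding eq
      using prods_mult[OF level_monoid[OF L] norm_terms_closed[OF L] trm] by (intro exI[of _ "1 + k"]) simp
  qed
qed

text \<open>Base change turns the restricted norm into a norm from the pullback \<open>P\<close> of
  G/K and G/J over G/L, which is then composed with the norm to \<open>L'\<close>. The orbits of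
  \<open>P\<close> play the part of the double cosets, one factor for each.\<close>

lemma nm_RS_term:
  assumes L: "subgroup L G" and JL': "(J, L') \<in> \<O>" and q: "equivariant G (CG J) (CG L) q"
    and s: "s \<in> norm_terms \<O> H y L"
  shows "\<exists>k\<ge>1. prods (level G T L') (norm_terms \<O> H y L') k (nm G T J L' (RS (CG J) (CG L) q s))"
proof -
  note J = ts_subgroup(1)[OF O JL'] and L' = ts_subgroup(2)[OF O JL']
  note \<pi> = coset_proj_equivariant[OF ts_subgroup[OF O JL']]
  obtain K p where K: "(K, L) \<in> \<O>" "equivariant G (CG K) (CG H) p" "s = nm G T K L (RS (CG K) (CG H) p y)"
    using s unfolding norm_terms_def by blast
  note Ks = ts_subgroup[OF O K(1)]
  have \<pi>K: "equivariant G (CG K) (CG L) (coset_proj G L)" by (rule coset_proj_equivariant[OF Ks])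
  have admK: "adm_map \<O> (CG K) (CG L) (coset_proj G L)" by (rule adm_map_coset_proj[OF O K(1)])
  obtain P :: "('a, 'a pt) gset" and u v where P: "finite_gset G P" "equivariant G P (CG K) u" "equivariant G P (CG J) v"
    "adm_map \<O> P (CG J) v" and sq: "\<forall>z\<in>points P. coset_proj G L (u z) = q (v z)"
    and pb: "\<forall>a\<in>points (CG K). \<forall>b\<in>points (CG J). coset_proj G L a = q b \<longrightarrow> (\<exists>!z. z \<in> points P \<and> u z = a \<and> v z = b)"
    using ex_pullback[OF O CG[OF Ks(1)] CG[OF J] \<pi>K q admK] by blast
  have z: "RS (CG K) (CG H) p y \<in> tob T (CG K)" by (rule RS_closed[OF CG[OF Ks(1)] CG[OF H] K(2) y])
  have "RS (CG J) (CG L) q s = NM P (CG J) v (RS P (CG K) u (RS (CG K) (CG H) p y))"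
    unfolding K(3) nm_def
    by (rule RS_NM[OF CG[OF Ks(1)] CG[OF L] CG[OF J] P(1) \<pi>K q P(3,2) _ _ z])
      (use sq pb in \<open>simp_all del: split_paired_All split_paired_Ex\<close>)
  also have "RS P (CG K) u (RS (CG K) (CG H) p y) = RS P (CG H) (p \<circ> u) y"
    by (rule RS_RS[OF P(1) CG[OF Ks(1)] CG[OF H] P(2) K(2) y])
  finally have "nm G T J L' (RS (CG J) (CG L) q s) = NM P (CG L') (coset_proj G L' \<circ> v) (RS P (CG H) (p \<circ> u) y)"
    unfolding nm_def
    using NM_NM[OF P(1) CG[OF J] CG[OF L'] P(3) \<pi> RS_closed[OF P(1) CG[OF H] equivariant_comp[OF P(2) K(2)] y]] by simp
  \<comment> \<open>The projection from G/K to G/L is surjective, so \<open>P\<close> has a point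
    over the identity coset of \<open>J\<close>. This guarantees at least one factor.\<close>
  moreover have "points P \<noteq> {}"
  proof -
    have o: "(\<one> <# J, 0) \<in> points (CG J)" by (rule coset_gset_point) simp
    obtain g where g: "g \<in> carrier G" "q (\<one> <# J, 0) = (g <# L, 0)"
      using equivariant_closed[OF q o] by (auto simp: coset_gset_points)
    have "coset_proj G L (g <# K, 0) = q (\<one> <# J, 0)" using coset_proj_eq[OF Ks g(1)] g(2) by simp
    with bspec[OF bspec[OF pb coset_gset_point[OF g(1)]] o]
    have "\<exists>!z. z \<in> points P \<and> u z = (g <# K, 0) \<and> v z = (\<one> <# J, 0)" by (rule mp)
    then show ?thesis by blast
  qed
  ultimately show ?thesis
    using NM_prods[OF L' P(1) equivariant_comp[OF P(3) \<pi>] adm_map_comp[OF O P(3,4) adm_map_coset_proj[OF O JL']]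
        equivariant_comp[OF P(2) K(2)]] by simp
qed

lemma nm_RS_closed:
  assumes "(J, L') \<in> \<O>" "equivariant G (CG J) (CG L) q" "subgroup L G" "x \<in> tob T (CG L)"
  shows "nm G T J L' (RS (CG J) (CG L) q x) \<in> tob T (CG L')"
  unfolding nm_def
  using NM_closed[OF CG CG coset_proj_equivariant RS_closed[OF CG CG]] ts_subgroup[OF O assms(1)] assms by blast

lemma nm_RS_mult:
  assumes JL': "(J, L') \<in> \<O>" and q: "equivariant G (CG J) (CG L) q" and L: "subgroup L G"
    and x: "x \<in> tob T (CG L)" and z: "z \<in> tob T (CG L)"
  shows "nm G T J L' (RS (CG J) (CG L) q (x \<otimes>\<^bsub>level G T L\<^esub> z)) =
    nm G T J L' (RS (CG J) (CG L) q x) \<otimes>\<^bsub>level G T L'\<^esub> nm G T J L' (RS (CG J) (CG L) q z)"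
proof -
  note s = ts_subgroup[OF O JL']
  show ?thesis
    unfolding nm_def RS_mult[OF CG[OF s(1)] CG[OF L] q x z]
    by (rule NM_mult[OF CG[OF s(1)] CG[OF s(2)] coset_proj_equivariant[OF s]
          RS_closed[OF CG[OF s(1)] CG[OF L] q x] RS_closed[OF CG[OF s(1)] CG[OF L] q z]])
qed

text \<open>Norms and restrictions are multiplicative and each factor yields at least one new
  factor, so the length cannot drop.\<close>

lemma nm_RS_prods:
  assumes L: "subgroup L G" and JL': "(J, L') \<in> \<O>" and q: "equivariant G (CG J) (CG L) q"
    and x: "prods (level G T L) (norm_terms \<O> H y L) k x"
  shows "\<exists>k'\<ge>k. prods (level G T L') (norm_terms \<O> H y L') k' (nm G T J L' (RS (CG J) (CG L) q x))"
  using x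
proof induction
  case (prods_one s)
  then show ?case by (rule nm_RS_term[OF L JL' q])
next
  case (prods_Suc k x s)
  note L' = ts_subgroup(2)[OF O JL'] and S = norm_terms_closed
  obtain j where j: "j \<ge> k" "prods (level G T L') (norm_terms \<O> H y L') j (nm G T J L' (RS (CG J) (CG L) q x))"
    using prods_Suc by blast
  obtain i where i: "i \<ge> 1" "prods (level G T L') (norm_terms \<O> H y L') i (nm G T J L' (RS (CG J) (CG L) q s))"
    using nm_RS_term[OF L JL' q prods_Suc(2)] by blast
  have "x \<in> tob T (CG L)" using prods_closed[OF level_monoid[OF L] S[OF L] prods_Suc(1)] by simp
  moreover have "s \<in> tob T (CG L)" using S[OF L] prods_Suc(2) by auto
  ultimately show ?case
    using prods_mult[OF level_monoid[OF L'] S[OF L'] j(2) i(2)] nm_RS_mult[OF JL' q L, of x s] j(1) i(1)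
    by (intro exI[of _ "j + i"]) simp
qed

end

text \<open>If all products of \<open>k\<close> norm terms of \<open>y\<close> lie in \<open>P\<close>, then a product \<open>x\<close> of at least
  \<open>k - 1\<close> of them satisfies the condition \<open>Q(P, x, x)\<close>, as the terms of \<open>x\<close> are again products of
  at least \<open>k - 1\<close> norm terms of \<open>y\<close>. So \<open>k\<close> can be lowered to \<open>1\<close>.\<close>

lemma prime_radical:
  assumes Om: "transfer_system G \<O>m" and P: "prime_tideal G \<O>m \<O>a T P" and H: "subgroup H G"
    and y: "y \<in> tob T (CG H)" and yn: "y [^]\<^bsub>level G T H\<^esub> Suc n \<in> P H"
  shows "y \<in> P H"
proof -
  have I: "tideal G \<O>m \<O>a T P" using P by (simp add: prime_tideal_def)
  note idl = tideal_ideal[OF I]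
  let ?R = "\<lambda>L. level G T L" and ?S = "norm_terms \<O>m H y"
  note Scl = norm_terms_closed[OF Om H y] and Sfin = norm_terms_finite[OF Om H y]
  \<comment> \<open>A map of coset spaces is a \<open>twist\<close>, so restriction along it is a
    restriction to a subgroup followed by a conjugation, and the ideal is closed under both.\<close>
  have PRS: "RS (CG J) (CG H) q z \<in> P J" if J: "subgroup J G" and q: "equivariant G (CG J) (CG H) q" and z: "z \<in> P H" for J q z
  proof -
    obtain K g where K: "subgroup K G" "K \<subseteq> H" "g \<in> carrier G" "J = conjugate G g K"
      "RS (CG J) (CG H) q = RS (CG J) (CG H) (twist H g)"
      by (rule equivariant_coset_twist[OF J H q])
    have "z \<in> tob T (CG H)" using ideal.Icarr[OF idl[OF H] z] by simp
    then have "RS (CG J) (CG H) q z = cj G T K g (res G T H K z)" using twist(3)[OF K(1) H K(2,3)] K(4,5) by simp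
    then show ?thesis
      unfolding K(4) using tideal_cj[OF I K(1,3) tideal_res[OF I H K(1,2) z]] by simp
  qed
  \<comment> \<open>By multiplicativity a power of a norm term of \<open>y\<close> is the same term
    formed from the power of \<open>y\<close>, which lies in the ideal.\<close>
  have Snil: "s [^]\<^bsub>?R L\<^esub> Suc n \<in> P L" if L: "subgroup L G" and s: "s \<in> ?S L" for L s
  proof -
    obtain J q where J: "(J, L) \<in> \<O>m" "equivariant G (CG J) (CG H) q" "s = nm G T J L (RS (CG J) (CG H) q y)"
      using s unfolding norm_terms_def by blast
    note Js = ts_subgroup[OF Om J(1)]
    have "s [^]\<^bsub>?R L\<^esub> Suc n = nm G T J L (RS (CG J) (CG H) q (y [^]\<^bsub>?R H\<^esub> Suc n))"
      unfolding J(3)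
      by (rule power_hom[OF level_monoid[OF H] level_monoid[OF L], symmetric])
        (use y nm_RS_closed[OF Om H y J(1,2) H] nm_RS_mult[OF Om H y J(1,2) H] in auto)
    moreover have "RS (CG J) (CG H) q (y [^]\<^bsub>?R H\<^esub> Suc n) \<in> P J" by (rule PRS[OF Js(1) J(2) yn])
    ultimately show ?thesis using tideal_nm[OF I J(1)] by simp
  qed
  \<comment> \<open>All levels are treated at once, because \<open>Qcond\<close> for an element at
    level \<open>L\<close> involves products at other levels \<open>L'\<close>. Taking all lengths
    from \<open>k\<close> on absorbs the growth of lengths in \<open>nm_RS_prods\<close>.\<close>
  define M where "M = (\<lambda>k. \<forall>L x j. subgroup L G \<longrightarrow> k \<le> j \<longrightarrow> prods (?R L) (?S L) j x \<longrightarrow> x \<in> P L)"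
  have "finite {L. subgroup L G}"
    by (rule finite_subset[of _ "Pow (carrier G)"]) (use fin in \<open>auto dest: subgroup.subset\<close>)
  \<comment> \<open>One bound serves all levels, since there are finitely many subgroups.\<close>
  then obtain N where N: "\<And>L. subgroup L G \<Longrightarrow> Suc n * card (?S L) < N"
  proof -
    have "Suc n * card (?S L) < Suc (\<Sum>L | subgroup L G. Suc n * card (?S L))" if "subgroup L G" for L
      using member_le_sum[of L "{L. subgroup L G}" "\<lambda>L. Suc n * card (?S L)"] that \<open>finite {L. subgroup L G}\<close> by simp
    then show ?thesis using that by blast
  qed
  have "M (Suc N)"
    unfolding M_def
  proof (intro allI impI)
    fix L x j assume L: "subgroup L G" and j: "Suc N \<le> j" and x: "prods (?R L) (?S L) j x"
    show "x \<in> P L"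
      by (rule prods_nilpotent[OF level_cring[OF L] idl[OF L] Scl[OF L] Sfin[OF L] Snil[OF L] x]) (use N[OF L] j in auto)
  qed
  have step: "M (Suc k)" if M: "M (Suc (Suc k))" for k
  proof (rule ccontr)
    assume "\<not> M (Suc k)"
    then obtain L x j where L: "subgroup L G" and j: "Suc k \<le> j" and x: "prods (?R L) (?S L) j x" and xP: "x \<notin> P L"
      unfolding M_def by blast
    have xc: "x \<in> tob T (CG L)" using prods_closed[OF level_monoid[OF L] Scl[OF L] x] by simp
    have "Qcond G \<O>m T P L L x x"
      unfolding Qcond_def
    proof (intro allI ballI impI, elim conjE)
      fix K1 K2 L' g1 g2
      assume g: "g1 \<in> carrier G" "g2 \<in> carrier G" and K: "subgroup K1 G" "K1 \<subseteq> L" "subgroup K2 G" "K2 \<subseteq> L"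
        and L': "subgroup L' G" and KL: "(conjugate G g1 K1, L') \<in> \<O>m" "(conjugate G g2 K2, L') \<in> \<O>m"
      have *: "\<exists>k'\<ge>j. prods (?R L') (?S L') k' (nm G T (conjugate G g K) L' (cj G T K g (res G T L K x)))"
        if "subgroup K G" "K \<subseteq> L" "g \<in> carrier G" "(conjugate G g K, L') \<in> \<O>m" for K g
        using nm_RS_prods[OF Om H y L that(4) twist(1)[OF that(1) L that(2,3)] x] twist(3)[OF that(1) L that(2,3) xc]
        by simp
      obtain j1 where j1: "j1 \<ge> j" "prods (?R L') (?S L') j1 (nm G T (conjugate G g1 K1) L' (cj G T K1 g1 (res G T L K1 x)))"
        using *[OF K(1,2) g(1) KL(1)] by blast
      obtain j2 where j2: "j2 \<ge> j" "prods (?R L') (?S L') j2 (nm G T (conjugate G g2 K2) L' (cj G T K2 g2 (res G T L K2 x)))"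
        using *[OF K(3,4) g(2) KL(2)] by blast
      \<comment> \<open>Both factors have length at least \<open>Suc k\<close>, and doubling a
        positive length raises it by at least one. This is why the descent works down to length one
        and no further.\<close>
      have "Suc (Suc k) \<le> j1 + j2" using j j1(1) j2(1) by simp
      then show "nm G T (conjugate G g1 K1) L' (cj G T K1 g1 (res G T L K1 x)) \<otimes>\<^bsub>?R L'\<^esub>
          nm G T (conjugate G g2 K2) L' (cj G T K2 g2 (res G T L K2 x)) \<in> P L'"
        using M L' prods_mult[OF level_monoid[OF L'] Scl[OF L'] j1(2) j2(2)] unfolding M_def by blast
    qed
    moreover have "\<forall>H1 H2. \<forall>x\<in>carrier (level G T H1). \<forall>y\<in>carrier (level G T H2).
        subgroup H1 G \<and> subgroup H2 G \<and> Qcond G \<O>m T P H1 H2 x y \<longrightarrow> x \<in> P H1 \<or> y \<in> P H2"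
      using P unfolding prime_tideal_def by (elim conjE)
    ultimately show False using L xc xP by (metis carrier_level)
  qed
  have "M (Suc 0)"
    by (rule inc_induct[of 0 N "\<lambda>k. M (Suc k)"]) (use \<open>M (Suc N)\<close> step in auto)
  \<comment> \<open>\<open>y\<close> is itself a norm term, for the trivial norm and the identity
    map, so \<open>M (Suc 0)\<close> applies to it as a product of length one.\<close>
  moreover have "y \<in> ?S H"
  proof -
    have "nm G T H H = NM (CG H) (CG H) id"
      unfolding nm_def
    proof (rule NM_cong[OF CG[OF H] CG[OF H] coset_proj_equivariant[OF H H subset_refl]])
      show "coset_proj G H u = id u" if "u \<in> points (CG H)" for u
        using that coset_proj_eq[OF H H subset_refl] by (auto simp: coset_gset_points)
    qed
    then have "y = nm G T H H (RS (CG H) (CG H) id y)" using RS_id[OF CG[OF H] y] NM_id[OF CG[OF H] y] by simp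
    then show ?thesis unfolding norm_terms_def using ts_refl[OF Om H] equivariant_id by blast
  qed
  then have "prods (?R H) (?S H) (Suc 0) y" using prods_one[of y "?S H" "?R H"] by simp
  ultimately show ?thesis using H unfolding M_def by blast
qed

end

subsection \<open>The saturated hull\<close>

context group
begin

text \<open>If \<open>(A, C)\<close> lies in a saturated system and
  \<open>A \<subseteq> B \<subseteq> C\<close>, the restriction axiom gives \<open>(A, B)\<close>
  and two out of three gives \<open>(B, C)\<close>. So all pairs on the right are forced, and they
  already form a saturated transfer system without further iteration.\<close>

lemma Hull_eq:
  assumes fin: "finite (carrier G)" and O: "transfer_system G \<O>"
  shows "Hull G \<O> = {(B, C). subgroup B G \<and> subgroup C G \<and> B \<subseteq> C \<and> (\<exists>A\<subseteq>B. (A, C) \<in> \<O>)}"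
    (is "_ = ?S")
    and "transfer_system G (Hull G \<O>)"
proof -
  note O' = ts_subgroup[OF O]
  have ts: "transfer_system G ?S"
    unfolding transfer_system_def
  proof (intro conjI allI impI ballI)
    show "case z of (K, H) \<Rightarrow> subgroup K G \<and> subgroup H G \<and> K \<subseteq> H" if "z \<in> ?S" for z
      using that by auto
    show "(H, H) \<in> ?S" if "subgroup H G" for H using ts_refl[OF O that] that by auto
    show "(L, H) \<in> ?S" if "(L, K) \<in> ?S \<and> (K, H) \<in> ?S" for L K H
    proof -
      from that obtain A B where A: "A \<subseteq> L" "(A, K) \<in> \<O>" and B: "B \<subseteq> K" "(B, H) \<in> \<O>" by auto
      \<comment> \<open>The witness for a composite is the intersection of the two witnesses:
        restrict the first to \<open>B\<close>, then compose with the second.\<close>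
      have "(A \<inter> B, B) \<in> \<O>" using ts_restrict[OF O A(2) O'(1)[OF B(2)] B(1)] .
      then have "(A \<inter> B, H) \<in> \<O>" using ts_trans[OF O _ B(2)] by blast
      moreover have "A \<inter> B \<subseteq> L" using A(1) by blast
      moreover have "subgroup L G" "subgroup H G" "L \<subseteq> H" using that by auto
      ultimately show ?thesis by blast
    qed
    show "(conjugate G g K, conjugate G g H) \<in> ?S" if g: "g \<in> carrier G" and KH: "(K, H) \<in> ?S" for K H g
    proof -
      from KH obtain A where A: "A \<subseteq> K" "(A, H) \<in> \<O>" by auto
      have s: "subgroup K G" "subgroup H G" "K \<subseteq> H" using KH by auto
      show ?thesis
        using conjugate_subgroup[OF fin s(1) g] conjugate_subgroup[OF fin s(2) g]
          conjugate_mono[OF s(3), of g] conjugate_mono[OF A(1), of g] ts_conj[OF O A(2) g] by blast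
    qed
    show "(K \<inter> L, L) \<in> ?S" if "(K, H) \<in> ?S \<and> subgroup L G \<and> L \<subseteq> H" for K H L
    proof -
      from that obtain A where A: "A \<subseteq> K" "(A, H) \<in> \<O>" by auto
      have "(A \<inter> L, L) \<in> \<O>" using ts_restrict[OF O A(2)] that by blast
      moreover have s: "subgroup K G" "subgroup L G" "K \<inter> L \<subseteq> L" "A \<inter> L \<subseteq> K \<inter> L"
        using that A(1) by auto
      moreover have "subgroup (K \<inter> L) G" by (rule subgroups_Inter_pair[OF s(1,2)])
      ultimately show ?thesis by blast
    qed
  qed
  have sat: "saturated G ?S"
    unfolding saturated_def
  proof (intro allI impI conjI; elim conjE)
    fix A B C assume s: "subgroup A G" "subgroup B G" "subgroup C G" "A \<subseteq> B" "B \<subseteq> C"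
    show "(A, C) \<in> ?S" if "(A, B) \<in> ?S" "(B, C) \<in> ?S" using ts_trans[OF ts that] .
    show "(B, C) \<in> ?S" if "(A, B) \<in> ?S" "(A, C) \<in> ?S" using that(2) s by blast
    show "(A, B) \<in> ?S" if "(B, C) \<in> ?S" "(A, C) \<in> ?S"
      using ts_restrict[OF ts that(2) s(2,5)] s(4) by (simp add: Int_absorb2)
  qed
  show 1: "Hull G \<O> = ?S"
    unfolding Hull_def
  proof (rule hull_unique)
    show "\<O> \<subseteq> ?S"
    proof (rule subrelI)
      fix A B assume "(A, B) \<in> \<O>"
      then show "(A, B) \<in> ?S" using O'[of A B] by blast
    qed
    show "transfer_system G ?S \<and> saturated G ?S" using ts sat by blast
    fix S assume S: "\<O> \<subseteq> S" "transfer_system G S \<and> saturated G S"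
    show "?S \<subseteq> S"
    proof (clarify)
      fix B C A assume s: "subgroup B G" "subgroup C G" "B \<subseteq> C" and A: "A \<subseteq> B" "(A, C) \<in> \<O>"
      have AC: "(A, C) \<in> S" using A S by blast
      have "(A \<inter> B, B) \<in> S" using ts_restrict[OF _ AC s(1,3)] S by blast
      then have "(A, B) \<in> S" using A(1) by (simp add: Int_absorb2)
      then show "(B, C) \<in> S"
        using S(2) AC s A(1) O'(1)[OF A(2)] unfolding saturated_def by blast
    qed
  qed
  show "transfer_system G (Hull G \<O>)" using ts 1 by simp
qed

lemma Hull_superset: "\<O> \<subseteq> Hull G \<O>"
  unfolding Hull_def by (rule hull_subset)

end

subsection \<open>Forgetting norms and transfers\<close>

context complete_tambara
begin

context
  fixes \<O>m \<O>a :: "('a set \<times> 'a set) set"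
  assumes Om: "transfer_system G \<O>m" and Oa: "transfer_system G \<O>a"
begin

abbreviation (input) T' where "T' \<equiv> forget G \<O>m \<O>a T"

text \<open>\<open>forget\<close> leaves the values undefined outside the subcategory, so every
  operation occurring in ideals and primes has to be recognized as admissible before that of
  \<open>T\<close> can replace it. Afterwards both spectra are formed from one functor.\<close>

lemma tmor_forget:
  assumes "is_bispan G \<beta>" "admissible G \<O>m \<O>a \<beta>"
  shows "tmor T' (bispan_class G \<beta>) = tmor T (bispan_class G \<beta>)"
proof -
  have "bispan_class G \<beta> \<in> bispan_hom G \<O>m \<O>a (bX \<beta>) (bY \<beta>)" using assms unfolding bispan_hom_def by blast
  then show ?thesis by (auto simp: forget_def restrict_def)
qed

lemma tob_forget [simp]: "tob T' = tob T"
  by (simp add: forget_def)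

lemma RS_forget:
  assumes "finite_gset G X" "finite_gset G Y" "equivariant G X Y f"
  shows "tmor T' (res_map G X Y f) = RS X Y f"
  unfolding res_map_eq
  by (rule tmor_forget[OF is_bispan_res[OF assms]])
    (simp add: admissible_def ts_refl[OF Om] ts_refl[OF Oa] stabilizer_sub[OF assms(1)])

lemma NM_forget:
  assumes "finite_gset G X" "finite_gset G Y" "equivariant G X Y f" "adm_map \<O>m X Y f"
  shows "tmor T' (nm_map G X Y f) = NM X Y f"
  unfolding nm_map_eq
  by (rule tmor_forget[OF is_bispan_nm[OF assms(1-3)]])
    (use assms(4) in \<open>simp add: admissible_def adm_map_def ts_refl[OF Oa] stabilizer_sub[OF assms(2)]\<close>)

lemma TR_forget:
  assumes "finite_gset G X" "finite_gset G Y" "equivariant G X Y f" "adm_map \<O>a X Y f"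
  shows "tmor T' (tr_map G X Y f) = tmor T (tr_map G X Y f)"
  unfolding tr_map_def
  by (rule tmor_forget)
    (use assms in \<open>auto simp: is_bispan_def equivariant_id admissible_def adm_map_def ts_refl[OF Om] stabilizer_sub[OF assms(1)]\<close>)

text \<open>The fold map preserves stabilizers and a map out of the empty set imposes no condition,
  so the ring structure survives in every such subcategory.\<close>

lemma level_ring_forget:
  assumes X: "finite_gset G X"
  shows "level_ring G T' X = level_ring G T X"
proof -
  note D = double_gset_finite[OF X]
  have f: "adm_map \<O> (double_gset X) X fold_pt" if "transfer_system G \<O>" for \<O>
    unfolding adm_map_def
  proof
    fix z assume z: "z \<in> points (double_gset X)"
    have "stabilizer G (act (double_gset X)) z = stabilizer G (act X) (fold_pt z)" "fold_pt z \<in> points X"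
      using z by (auto simp: double_gset_eq sum_gset_points stabilizer_def)
    then show "(stabilizer G (act (double_gset X)) z, stabilizer G (act X) (fold_pt z)) \<in> \<O>"
      using ts_refl[OF that] stabilizer_sub[OF X] by simp
  qed
  have E: "finite_gset G (empty_gset :: ('a, 'a pt) gset)"
    by (rule finite_gsetI) (simp_all add: empty_gset_def extensional_def)
  have e: "equivariant G empty_gset X id" "adm_map \<O> empty_gset X id" for \<O>
    by (simp_all add: equivariant_def adm_map_def empty_gset_def)
  show ?thesis
    unfolding level_ring_def tpair_def tob_forget RS_forget[OF X D inl_double] RS_forget[OF X D inr_double]
      NM_forget[OF D X fold_double[OF X] f[OF Om]] TR_forget[OF D X fold_double[OF X] f[OF Oa]]
      NM_forget[OF E X e] TR_forget[OF E X e] by (rule refl)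
qed

lemma level_forget: "subgroup H G \<Longrightarrow> level G T' H = level G T H"
  by (rule level_ring_forget[OF CG])

lemma carrier_level_forget: "carrier (level G T' H) = tob T (CG H)"
  by (simp add: level_ring_def)

lemma res_forget: "subgroup H G \<Longrightarrow> subgroup K G \<Longrightarrow> K \<subseteq> H \<Longrightarrow> res G T' H K = res G T H K"
  unfolding res_def by (intro RS_forget CG coset_proj_equivariant)

text \<open>Through \<open>cj_class\<close> a conjugation is a restriction, and restrictions are
  admissible for every pair of transfer systems.\<close>

lemma cj_forget: "subgroup H G \<Longrightarrow> g \<in> carrier G \<Longrightarrow> cj G T' H g = cj G T H g"
  unfolding cj_def cj_class[OF fin]
  using coset_conj_equivariant[OF fin subgroup_conjugate, of H g "inv g"]
  by (intro RS_forget CG subgroup_conjugate) (simp_all add: conjugate_inv)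

lemma nm_forget: "(K, H) \<in> \<O>m \<Longrightarrow> nm G T' K H = nm G T K H"
  unfolding nm_def using ts_subgroup[OF Om]
  by (intro NM_forget CG coset_proj_equivariant adm_map_coset_proj[OF Om]) auto

lemma tr_forget: "(K, H) \<in> \<O>a \<Longrightarrow> tr G T' K H = tr G T K H"
  unfolding tr_def using ts_subgroup[OF Oa]
  by (intro TR_forget CG coset_proj_equivariant adm_map_coset_proj[OF Oa]) auto

lemma tideal_forget: "tideal G \<O>m \<O>a T' I \<longleftrightarrow> tideal G \<O>m \<O>a T I"
proof -
  have "(\<forall>H. subgroup H G \<longrightarrow> ideal (I H) (level G T' H)) \<longleftrightarrow> (\<forall>H. subgroup H G \<longrightarrow> ideal (I H) (level G T H))"
    by (simp add: level_forget)
  moreover have "(\<forall>H K. subgroup H G \<and> subgroup K G \<and> K \<subseteq> H \<longrightarrow> res G T' H K ` I H \<subseteq> I K) \<longleftrightarrow>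
      (\<forall>H K. subgroup H G \<and> subgroup K G \<and> K \<subseteq> H \<longrightarrow> res G T H K ` I H \<subseteq> I K)"
    by (simp add: res_forget)
  moreover have "(\<forall>H. \<forall>g\<in>carrier G. subgroup H G \<longrightarrow> cj G T' H g ` I H \<subseteq> I (conjugate G g H)) \<longleftrightarrow>
      (\<forall>H. \<forall>g\<in>carrier G. subgroup H G \<longrightarrow> cj G T H g ` I H \<subseteq> I (conjugate G g H))"
    by (simp add: cj_forget)
  moreover have "(\<forall>(K, H)\<in>\<O>a. tr G T' K H ` I K \<subseteq> I H) \<longleftrightarrow> (\<forall>(K, H)\<in>\<O>a. tr G T K H ` I K \<subseteq> I H)"
    by (rule ball_cong) (auto simp: tr_forget)
  moreover have "(\<forall>(K, H)\<in>\<O>m. nm G T' K H ` I K \<subseteq> I H) \<longleftrightarrow> (\<forall>(K, H)\<in>\<O>m. nm G T K H ` I K \<subseteq> I H)"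
    by (rule ball_cong) (auto simp: nm_forget)
  ultimately show ?thesis unfolding tideal_def by (simp only:)
qed

lemma Qcond_forget:
  assumes "subgroup H1 G" "subgroup H2 G"
  shows "Qcond G \<O>m T' I H1 H2 x y \<longleftrightarrow> Qcond G \<O>m T I H1 H2 x y"
  unfolding Qcond_def using assms by (simp add: level_forget res_forget cj_forget nm_forget)

lemma prime_tideal_forget: "prime_tideal G \<O>m \<O>a T' P \<longleftrightarrow> prime_tideal G \<O>m \<O>a T P"
  unfolding prime_tideal_def tideal_forget carrier_level_forget carrier_level
  by (simp add: Qcond_forget cong: conj_cong)

lemma Spec_forget: "Spec G \<O>m \<O>a T' = Spec G \<O>m \<O>a T"
proof -
  have "prime_tideal G \<O>m \<O>a T' = prime_tideal G \<O>m \<O>a T" by (rule ext) (rule prime_tideal_forget)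
  then show ?thesis unfolding Spec_def Vset_def by (simp only: tideal_forget)
qed

end

subsection \<open>Comparison with the saturated hull\<close>

text \<open>The two factors in \<open>Qcond\<close> acquire different exponents. The ideal absorbs
  the missing powers, so that radicality can be applied to the product.\<close>

lemma ideal_mult_pow:
  assumes "cring R" and I: "ideal I R" and ab: "a \<in> carrier R" "b \<in> carrier R"
    and "a [^]\<^bsub>R\<^esub> (m::nat) \<otimes>\<^bsub>R\<^esub> b [^]\<^bsub>R\<^esub> (n::nat) \<in> I"
  shows "(a \<otimes>\<^bsub>R\<^esub> b) [^]\<^bsub>R\<^esub> (m + n) \<in> I"
proof -
  interpret cring R by (rule assms)
  have "(a \<otimes>\<^bsub>R\<^esub> b) [^]\<^bsub>R\<^esub> (m + n) =
      (a [^]\<^bsub>R\<^esub> m \<otimes>\<^bsub>R\<^esub> b [^]\<^bsub>R\<^esub> n) \<otimes>\<^bsub>R\<^esub> (a [^]\<^bsub>R\<^esub> n \<otimes>\<^bsub>R\<^esub> b [^]\<^bsub>R\<^esub> m)"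
    using ab by (simp add: nat_pow_distrib nat_pow_mult[symmetric] m_ac)
  then show ?thesis using ideal.I_r_closed[OF I assms(5)] ab by simp
qed

section \<open>Unit ideal and intersections of ideals\<close>

lemma res_nm_closed:
  assumes "subgroup H G" "subgroup K G" "K \<subseteq> H"
  shows "z \<in> tob T (CG H) \<Longrightarrow> res G T H K z \<in> tob T (CG K)"
    and "z \<in> tob T (CG K) \<Longrightarrow> nm G T K H z \<in> tob T (CG H)"
    and "z \<in> tob T (CG K) \<Longrightarrow> tr G T K H z \<in> tob T (CG H)"
proof -
  note \<pi> = coset_proj_equivariant[OF assms(2,1,3)]
  show "z \<in> tob T (CG H) \<Longrightarrow> res G T H K z \<in> tob T (CG K)"
    unfolding res_def by (rule RS_closed[OF CG[OF assms(2)] CG[OF assms(1)] \<pi>])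
  show "z \<in> tob T (CG K) \<Longrightarrow> nm G T K H z \<in> tob T (CG H)"
    unfolding nm_def by (rule NM_closed[OF CG[OF assms(2)] CG[OF assms(1)] \<pi>])
  have "is_bispan G \<lparr>bX = CG K, bA = CG K, bB = CG K, bY = CG H, bp = id, bn = id, bt = coset_proj G H\<rparr>"
    using \<pi> CG assms by (simp add: is_bispan_def equivariant_id)
  from tmor_closed[OF this] show "z \<in> tob T (CG K) \<Longrightarrow> tr G T K H z \<in> tob T (CG H)"
    by (simp add: tr_def tr_map_def)
qed

lemma cj_closed:
  assumes "subgroup H G" "g \<in> carrier G" "z \<in> tob T (CG H)"
  shows "cj G T H g z \<in> tob T (CG (conjugate G g H))"
  unfolding cj_def cj_class[OF fin assms(1,2)]
  using coset_conj_equivariant[OF fin subgroup_conjugate[OF assms(1,2)], of "inv g"] assms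
  by (intro RS_closed CG subgroup_conjugate) (simp_all add: conjugate_inv)

text \<open>The unit ideal keeps the family of hull-ideals above a given ideal nonempty, so that
  their intersection can be formed.\<close>

lemma tideal_carrier:
  assumes Om: "transfer_system G \<O>m" and Oa: "transfer_system G \<O>a"
  shows "tideal G \<O>m \<O>a T (\<lambda>H\<in>{H. subgroup H G}. tob T (CG H))"
  unfolding tideal_def
proof (intro conjI allI impI ballI)
  show "ideal ((\<lambda>H\<in>{H. subgroup H G}. tob T (CG H)) H) (level G T H)" if "subgroup H G" for H
    using ring.oneideal[OF cring.axioms(1)[OF level_cring[OF that]]] that by simp
next
  show "case z of (K, H) \<Rightarrow> tr G T K H ` (\<lambda>H\<in>{H. subgroup H G}. tob T (CG H)) K \<subseteq> (\<lambda>H\<in>{H. subgroup H G}. tob T (CG H)) H"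
    if "z \<in> \<O>a" for z
    using that ts_subgroup[OF Oa] res_nm_closed(3) by (cases z) (auto simp: image_subset_iff)
  show "case z of (K, H) \<Rightarrow> nm G T K H ` (\<lambda>H\<in>{H. subgroup H G}. tob T (CG H)) K \<subseteq> (\<lambda>H\<in>{H. subgroup H G}. tob T (CG H)) H"
    if "z \<in> \<O>m" for z
    using that ts_subgroup[OF Om] res_nm_closed(2) by (cases z) (auto simp: image_subset_iff)
qed (use res_nm_closed(1) cj_closed subgroup_conjugate in auto)

lemma tideal_Inter:
  assumes Om: "transfer_system G \<O>m" and Oa: "transfer_system G \<O>a" and "F \<noteq> {}"
    and F: "\<And>I. I \<in> F \<Longrightarrow> tideal G \<O>m \<O>a T I"
  shows "tideal G \<O>m \<O>a T (\<lambda>H\<in>{H. subgroup H G}. \<Inter>I\<in>F. I H)"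
  unfolding tideal_def
proof (intro conjI allI impI ballI)
  show "ideal ((\<lambda>H\<in>{H. subgroup H G}. \<Inter>I\<in>F. I H) H) (level G T H)" if H: "subgroup H G" for H
  proof -
    have "ideal (\<Inter>((\<lambda>I. I H) ` F)) (level G T H)"
      by (rule ring.i_Intersect[OF cring.axioms(1)[OF level_cring[OF H]]])
        (use assms(3) tideal_ideal[OF F H] in auto)
    then show ?thesis using H by simp
  qed
next
  show "case z of (K, H) \<Rightarrow> tr G T K H ` (\<lambda>H\<in>{H. subgroup H G}. \<Inter>I\<in>F. I H) K \<subseteq> (\<lambda>H\<in>{H. subgroup H G}. \<Inter>I\<in>F. I H) H"
    if "z \<in> \<O>a" for z
    using that ts_subgroup[OF Oa] tideal_tr[OF F] by (cases z) (auto simp: image_subset_iff)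
  show "case z of (K, H) \<Rightarrow> nm G T K H ` (\<lambda>H\<in>{H. subgroup H G}. \<Inter>I\<in>F. I H) K \<subseteq> (\<lambda>H\<in>{H. subgroup H G}. \<Inter>I\<in>F. I H) H"
    if "z \<in> \<O>m" for z
    using that ts_subgroup[OF Om] tideal_nm[OF F] by (cases z) (auto simp: image_subset_iff)
qed (use tideal_res[OF F] tideal_cj[OF F] subgroup_conjugate in \<open>auto simp: image_subset_iff\<close>)

text \<open>The norm from \<open>A\<close> to \<open>C\<close> is the norm from \<open>A\<close> to
  \<open>B\<close> followed by that from \<open>B\<close> to \<open>C\<close>. The first turns a
  restriction into a power, and the second is multiplicative. The exponent is the index of
  \<open>A\<close> in \<open>B\<close>, written as a successor because radicality needs a positive
  power.\<close>

lemma nm_res_power: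
  assumes mc: "mult_cohomological G T" and A: "subgroup A G" and B: "subgroup B G" and C: "subgroup C G"
    and AB: "A \<subseteq> B" and BC: "B \<subseteq> C"
  shows "\<exists>n. \<forall>w\<in>tob T (CG B). nm G T A C (res G T B A w) = nm G T B C w [^]\<^bsub>level G T C\<^esub> Suc n"
proof -
  have 1: "\<exists>n. \<forall>w\<in>tob T (CG B). nm G T A B (res G T B A w) = w [^]\<^bsub>level G T B\<^esub> Suc n"
  \<comment> \<open>\<open>mult_cohomological\<close> speaks of proper subgroups only; for
    \<open>A = B\<close> restriction and norm are identities and the exponent is one.\<close>
  proof (cases "A = B")
    case True
    have id: "coset_proj G B u = id u" if "u \<in> points (CG B)" for u
      using that coset_proj_eq[OF B B subset_refl] by (auto simp: coset_gset_points)
    note e = coset_proj_equivariant[OF B B subset_refl]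
    have "RS (CG B) (CG B) (coset_proj G B) = RS (CG B) (CG B) id"
      "NM (CG B) (CG B) (coset_proj G B) = NM (CG B) (CG B) id"
      by (rule RS_cong[OF CG[OF B] CG[OF B] e id] NM_cong[OF CG[OF B] CG[OF B] e id]; assumption)+
    then have "nm G T A B (res G T B A w) = w [^]\<^bsub>level G T B\<^esub> Suc 0" if "w \<in> tob T (CG B)" for w
      using that RS_id[OF CG[OF B] that] NM_id[OF CG[OF B] that] level_monoid[OF B]
      unfolding True nm_def res_def by (simp add: monoid.l_one)
    then show ?thesis by blast
  next
    case False
    let ?B = "G\<lparr>carrier := B\<rparr>"
    have fB: "finite B" using fin subgroup.subset[OF B] finite_subset by blast
    \<comment> \<open>An infinite set has \<open>card\<close> zero by convention, so finiteness and
      nonemptiness are both needed for the index to be a successor.\<close>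
    have "finite (rcosets\<^bsub>?B\<^esub> A)" "rcosets\<^bsub>?B\<^esub> A \<noteq> {}"
      using fB subgroup.one_closed[OF B] by (auto simp: RCOSETS_def)
    then obtain n where n: "card (rcosets\<^bsub>?B\<^esub> A) = Suc n" by (metis card_eq_0_iff not0_implies_Suc)
    have "nm G T A B (res G T B A w) = w [^]\<^bsub>level G T B\<^esub> Suc n" if "w \<in> tob T (CG B)" for w
      using mc that A B AB False unfolding mult_cohomological_def n[symmetric] by auto
    then show ?thesis by blast
  qed
  then obtain n where n: "\<And>w. w \<in> tob T (CG B) \<Longrightarrow> nm G T A B (res G T B A w) = w [^]\<^bsub>level G T B\<^esub> Suc n" by blast
  note AC = subset_trans[OF AB BC]
  note eAB = coset_proj_equivariant[OF A B AB] and eBC = coset_proj_equivariant[OF B C BC]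
  have "nm G T A C (res G T B A w) = nm G T B C w [^]\<^bsub>level G T C\<^esub> Suc n" if w: "w \<in> tob T (CG B)" for w
  proof -
    let ?z = "res G T B A w"
    have z: "?z \<in> tob T (CG A)" using res_nm_closed(1)[OF B A AB w] .
    have "(coset_proj G C \<circ> coset_proj G B) u = coset_proj G C u" if "u \<in> points (CG A)" for u
      using that coset_proj_eq[OF A B AB] coset_proj_eq[OF B C BC] coset_proj_eq[OF A C AC]
      by (auto simp: coset_gset_points)
    then have "nm G T A C ?z = NM (CG A) (CG C) (coset_proj G C \<circ> coset_proj G B) ?z"
      unfolding nm_def using NM_cong[OF CG[OF A] CG[OF C] equivariant_comp[OF eAB eBC]] by metis
    also have "\<dots> = nm G T B C (nm G T A B ?z)"
      unfolding nm_def by (rule NM_NM[OF CG[OF A] CG[OF B] CG[OF C] eAB eBC z, symmetric])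
    also have "\<dots> = nm G T B C (w [^]\<^bsub>level G T B\<^esub> Suc n)" by (simp only: n[OF w])
    also have "\<dots> = nm G T B C w [^]\<^bsub>level G T C\<^esub> Suc n"
      by (rule power_hom[OF level_monoid[OF B] level_monoid[OF C]])
        (use w res_nm_closed(2)[OF C B BC] NM_mult[OF CG[OF B] CG[OF C] eBC] in \<open>auto simp: nm_def\<close>)
    finally show ?thesis .
  qed
  then show ?thesis by blast
qed

text \<open>A subgroup \<open>A\<close> of the conjugate of \<open>K\<close> is the conjugate of a
  subgroup \<open>K'\<close> of \<open>K\<close>, so restricting after conjugation is conjugating a
  further restriction. This keeps a term in the shape demanded by \<open>Qcond\<close> when a hull
  norm is traded for a norm in \<open>\<O>m\<close>.\<close>

lemma cj_res_conjugate:
  assumes K: "subgroup K G" and H: "subgroup H G" and KH: "K \<subseteq> H" and g: "g \<in> carrier G"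
    and A: "subgroup A G" and AK: "A \<subseteq> conjugate G g K" and y: "y \<in> tob T (CG H)"
  defines "K' \<equiv> conjugate G (inv g) A"
  shows "subgroup K' G" "K' \<subseteq> H" "conjugate G g K' = A"
    and "cj G T K' g (res G T H K' y) = res G T (conjugate G g K) A (cj G T K g (res G T H K y))"
proof -
  let ?C = "conjugate G g K"
  have C: "subgroup ?C G" by (rule subgroup_conjugate[OF K g])
  show K': "subgroup K' G" unfolding K'_def using subgroup_conjugate[OF A] g by simp
  show K'H: "K' \<subseteq> H"
    unfolding K'_def using conjugate_mono[OF AK, of "inv g"] conjugate_inv(2)[OF K g] KH by simp
  show gK': "conjugate G g K' = A" unfolding K'_def using conjugate_inv(1)[OF A g] .
  note e = coset_proj_equivariant[OF A C AK]
  note tw = twist(1)[OF K H KH g]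
  have eq: "(twist H g \<circ> coset_proj G ?C) u = twist H g u" if "u \<in> points (CG A)" for u
    using that coset_proj_eq[OF A C AK] twist(2)[OF K H KH g] twist(2)[OF K' H K'H g]
    by (auto simp: coset_gset_points gK')
  have "res G T ?C A (cj G T K g (res G T H K y)) = RS (CG A) (CG H) (twist H g \<circ> coset_proj G ?C) y"
    unfolding twist(3)[OF K H KH g y] unfolding res_def by (rule RS_RS[OF CG[OF A] CG[OF C] CG[OF H] e tw y])
  also have "\<dots> = RS (CG A) (CG H) (twist H g) y"
    by (rule fun_cong[OF RS_cong[OF CG[OF A] CG[OF H] equivariant_comp[OF e tw] eq]])
  also have "\<dots> = cj G T K' g (res G T H K' y)"
    unfolding twist(3)[OF K' H K'H g y] gK' by (rule refl)
  finally show "cj G T K' g (res G T H K' y) = res G T ?C A (cj G T K g (res G T H K y))" by (rule sym)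
qed

context
  fixes \<O>m \<O>a :: "('a set \<times> 'a set) set"
  assumes Om: "transfer_system G \<O>m" and Oa: "transfer_system G \<O>a" and mc: "mult_cohomological G T"
begin

section \<open>Ideals and primes for the hull\<close>

lemma Hull_ts: "transfer_system G (Hull G \<O>m)"
  by (rule Hull_eq(2)[OF fin Om])

lemma HullE:
  assumes "(B, C) \<in> Hull G \<O>m"
  obtains A where "A \<subseteq> B" "(A, C) \<in> \<O>m"
  using assms unfolding Hull_eq(1)[OF fin Om] by blast

lemma tideal_of_Hull:
  assumes I: "tideal G (Hull G \<O>m) \<O>a T I"
  shows "tideal G \<O>m \<O>a T I"
proof -
  have "\<forall>(K, H)\<in>\<O>m. nm G T K H ` I K \<subseteq> I H"
    using Hull_superset[of \<O>m] tideal_nm[OF I] by (auto simp: image_subset_iff)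
  then show ?thesis using I unfolding tideal_def by (elim conjE, intro conjI)
qed

text \<open>The condition Q for the hull ranges over more norms and is therefore stronger, so
  primality is inherited at once. The content is closure under the norms of the hull, where a
  positive power of the norm is seen to lie in the ideal.\<close>

lemma Hull_prime_of_prime:
  assumes P: "prime_tideal G \<O>m \<O>a T P"
  shows "prime_tideal G (Hull G \<O>m) \<O>a T P"
proof -
  have I: "tideal G \<O>m \<O>a T P" using P by (simp add: prime_tideal_def)
  have "nm G T B C x \<in> P C" if BC: "(B, C) \<in> Hull G \<O>m" and x: "x \<in> P B" for B C x
  proof -
    note s = ts_subgroup[OF Hull_ts BC]
    obtain A where A: "A \<subseteq> B" "(A, C) \<in> \<O>m" by (rule HullE[OF BC])
    note As = ts_subgroup[OF Om A(2)]
    have xc: "x \<in> tob T (CG B)" using ideal.Icarr[OF tideal_ideal[OF I s(1)] x] by simp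
    obtain n where "nm G T A C (res G T B A x) = nm G T B C x [^]\<^bsub>level G T C\<^esub> Suc n"
      using nm_res_power[OF mc As(1) s(1,2) A(1) s(3)] xc by blast
    moreover have "nm G T A C (res G T B A x) \<in> P C"
      by (rule tideal_nm[OF I A(2) tideal_res[OF I s(1) As(1) A(1) x]])
    ultimately show ?thesis
      using prime_radical[OF Om P s(2) res_nm_closed(2)[OF s(2,1,3) xc], of n] by simp
  qed
  then have "\<forall>(K, H)\<in>Hull G \<O>m. nm G T K H ` P K \<subseteq> P H" by auto
  then have "tideal G (Hull G \<O>m) \<O>a T P" using I unfolding tideal_def by (elim conjE, intro conjI)
  moreover have "Qcond G \<O>m T P H1 H2 x y" if "Qcond G (Hull G \<O>m) T P H1 H2 x y" for H1 H2 x y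
    using that Hull_superset[of \<O>m] unfolding Qcond_def by (meson subsetD)
  ultimately show ?thesis using P unfolding prime_tideal_def by blast
qed

text \<open>Every factor for the hull has a positive power that is a factor for
  \<open>\<O>m\<close>. So a product of powers lies in \<open>P\<close>, then a power of the
  product, then the product.\<close>

lemma Qcond_Hull:
  assumes P: "prime_tideal G (Hull G \<O>m) \<O>a T P" and H: "subgroup H1 G" "subgroup H2 G"
    and x: "x \<in> tob T (CG H1)" and y: "y \<in> tob T (CG H2)" and Q: "Qcond G \<O>m T P H1 H2 x y"
  shows "Qcond G (Hull G \<O>m) T P H1 H2 x y"
  unfolding Qcond_def
proof (intro allI ballI impI, elim conjE)
  fix K1 K2 L g1 g2
  assume g: "g1 \<in> carrier G" "g2 \<in> carrier G" and K: "subgroup K1 G" "K1 \<subseteq> H1" "subgroup K2 G" "K2 \<subseteq> H2"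
    and L: "subgroup L G" and KL: "(conjugate G g1 K1, L) \<in> Hull G \<O>m" "(conjugate G g2 K2, L) \<in> Hull G \<O>m"
  let ?R = "level G T L"
  interpret R: cring ?R by (rule level_cring[OF L])
  have "tideal G (Hull G \<O>m) \<O>a T P" using P by (simp add: prime_tideal_def)
  then have I: "ideal (P L) ?R" by (rule tideal_ideal[OF _ L])
  have *: "\<exists>K' n. subgroup K' G \<and> K' \<subseteq> H \<and> (conjugate G g K', L) \<in> \<O>m \<and>
      nm G T (conjugate G g K') L (cj G T K' g (res G T H K' z)) =
      nm G T (conjugate G g K) L (cj G T K g (res G T H K z)) [^]\<^bsub>?R\<^esub> Suc n"
    if K: "subgroup K G" and H: "subgroup H G" and KH: "K \<subseteq> H" and g: "g \<in> carrier G"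
      and KL: "(conjugate G g K, L) \<in> Hull G \<O>m" and z: "z \<in> tob T (CG H)" for K H g z
  proof -
    obtain A where A: "A \<subseteq> conjugate G g K" "(A, L) \<in> \<O>m" by (rule HullE[OF KL])
    note As = ts_subgroup[OF Om A(2)] and s = ts_subgroup[OF Hull_ts KL]
    note c = cj_res_conjugate[OF K H KH g As(1) A(1) z]
    have "cj G T K g (res G T H K z) \<in> tob T (CG (conjugate G g K))"
      using cj_closed[OF K g] res_nm_closed(1)[OF H K KH z] by blast
    then obtain n where "nm G T A L (res G T (conjugate G g K) A (cj G T K g (res G T H K z))) =
        nm G T (conjugate G g K) L (cj G T K g (res G T H K z)) [^]\<^bsub>?R\<^esub> Suc n"
      using nm_res_power[OF mc As(1) s(1,2) A(1) s(3)] by blast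
    then show ?thesis using c A(2)
      by (intro exI[of _ "conjugate G (inv g) A"] exI[of _ n]) (simp only: simp_thms)
  qed
  let ?a = "nm G T (conjugate G g1 K1) L (cj G T K1 g1 (res G T H1 K1 x))"
  let ?b = "nm G T (conjugate G g2 K2) L (cj G T K2 g2 (res G T H2 K2 y))"
  obtain K1' m where K1': "subgroup K1' G" "K1' \<subseteq> H1" "(conjugate G g1 K1', L) \<in> \<O>m"
    "nm G T (conjugate G g1 K1') L (cj G T K1' g1 (res G T H1 K1' x)) = ?a [^]\<^bsub>?R\<^esub> Suc m"
    using *[OF K(1) H(1) K(2) g(1) KL(1) x] by blast
  obtain K2' n where K2': "subgroup K2' G" "K2' \<subseteq> H2" "(conjugate G g2 K2', L) \<in> \<O>m"
    "nm G T (conjugate G g2 K2') L (cj G T K2' g2 (res G T H2 K2' y)) = ?b [^]\<^bsub>?R\<^esub> Suc n"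
    using *[OF K(3) H(2) K(4) g(2) KL(2) y] by blast
  have ab: "?a \<in> tob T (CG L)" "?b \<in> tob T (CG L)"
    using cj_closed[OF K(1) g(1) res_nm_closed(1)[OF H(1) K(1,2) x]]
      cj_closed[OF K(3) g(2) res_nm_closed(1)[OF H(2) K(3,4) y]]
      res_nm_closed(2)[OF L] ts_subgroup[OF Hull_ts KL(1)] ts_subgroup[OF Hull_ts KL(2)] by blast+
  then have ab': "?a \<in> carrier ?R" "?b \<in> carrier ?R" by simp_all
  have "?a [^]\<^bsub>?R\<^esub> Suc m \<otimes>\<^bsub>?R\<^esub> ?b [^]\<^bsub>?R\<^esub> Suc n \<in> P L"
    using Q K1' K2' g L unfolding Qcond_def by metis
  from ideal_mult_pow[OF level_cring[OF L] I ab' this]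
  have "(?a \<otimes>\<^bsub>?R\<^esub> ?b) [^]\<^bsub>?R\<^esub> Suc (m + Suc n) \<in> P L" by (simp only: add_Suc)
  moreover have "?a \<otimes>\<^bsub>?R\<^esub> ?b \<in> tob T (CG L)" using R.m_closed[OF ab'] by simp
  \<comment> \<open>\<open>P\<close> is known to be prime only for the hull, so radicality is
    applied with the hull as the system of norms.\<close>
  ultimately show "?a \<otimes>\<^bsub>?R\<^esub> ?b \<in> P L" using prime_radical[OF Hull_ts P L] by blast
qed

lemma prime_Hull_iff: "prime_tideal G (Hull G \<O>m) \<O>a T P \<longleftrightarrow> prime_tideal G \<O>m \<O>a T P"
proof
  assume P: "prime_tideal G (Hull G \<O>m) \<O>a T P"
  then have "tideal G \<O>m \<O>a T P" using tideal_of_Hull by (simp add: prime_tideal_def)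
  moreover have "\<exists>H. subgroup H G \<and> P H \<noteq> carrier (level G T H)" using P by (simp add: prime_tideal_def)
  moreover have "x \<in> P H1 \<or> y \<in> P H2"
    if "x \<in> tob T (CG H1)" "y \<in> tob T (CG H2)" "subgroup H1 G" "subgroup H2 G" "Qcond G \<O>m T P H1 H2 x y" for H1 H2 x y
    using P Qcond_Hull[OF P that(3,4,1,2,5)] that by (simp add: prime_tideal_def)
  ultimately show "prime_tideal G \<O>m \<O>a T P" by (simp add: prime_tideal_def)
qed (rule Hull_prime_of_prime)

text \<open>An ideal for \<open>\<O>m\<close> is not assumed closed under the norms of the hull;
  \<open>J\<close> is the hull-ideal that it generates. A prime above \<open>I\<close> is itself one
  of the ideals intersected, hence lies above \<open>J\<close>.\<close>

lemma Vset_tideal_Hull: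
  assumes I: "tideal G \<O>m \<O>a T I"
  shows "\<exists>J. tideal G (Hull G \<O>m) \<O>a T J \<and> Vset G (Hull G \<O>m) \<O>a T J = Vset G \<O>m \<O>a T I"
proof -
  define F where "F = {J. tideal G (Hull G \<O>m) \<O>a T J \<and> (\<forall>H. subgroup H G \<longrightarrow> I H \<subseteq> J H)}"
  define J where "J = (\<lambda>H\<in>{H. subgroup H G}. \<Inter>I\<in>F. I H)"
  have "(\<lambda>H\<in>{H. subgroup H G}. tob T (CG H)) \<in> F"
    unfolding F_def using tideal_carrier[OF Hull_ts Oa] ideal.Icarr[OF tideal_ideal[OF I]] by auto
  then have "F \<noteq> {}" by blast
  then have "tideal G (Hull G \<O>m) \<O>a T J"
    unfolding J_def by (rule tideal_Inter[OF Hull_ts Oa]) (simp add: F_def)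
  moreover have "(\<forall>H. subgroup H G \<longrightarrow> J H \<subseteq> P H) \<longleftrightarrow> (\<forall>H. subgroup H G \<longrightarrow> I H \<subseteq> P H)"
    if P: "prime_tideal G (Hull G \<O>m) \<O>a T P" for P
  proof
    assume *: "\<forall>H. subgroup H G \<longrightarrow> J H \<subseteq> P H"
    have "I H \<subseteq> J H" if "subgroup H G" for H using that by (auto simp: J_def F_def)
    then show "\<forall>H. subgroup H G \<longrightarrow> I H \<subseteq> P H" using * by blast
  next
    assume "\<forall>H. subgroup H G \<longrightarrow> I H \<subseteq> P H"
    then have "P \<in> F" using P by (simp add: F_def prime_tideal_def)
    then show "\<forall>H. subgroup H G \<longrightarrow> J H \<subseteq> P H" by (auto simp: J_def)
  qed
  then have "Vset G (Hull G \<O>m) \<O>a T J = Vset G \<O>m \<O>a T I"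
    unfolding Vset_def using prime_Hull_iff by blast
  ultimately show ?thesis by blast
qed

lemma Spec_Hull: "Spec G (Hull G \<O>m) \<O>a T = Spec G \<O>m \<O>a T"
proof -
  have E: "prime_tideal G (Hull G \<O>m) \<O>a T = prime_tideal G \<O>m \<O>a T" by (rule ext) (rule prime_Hull_iff)
  \<comment> \<open>Beyond the family \<open>I\<close> only the set of primes enters, so this holds
    whether or not \<open>I\<close> is an ideal.\<close>
  have V: "Vset G (Hull G \<O>m) \<O>a T I = Vset G \<O>m \<O>a T I" for I
    unfolding Vset_def E by (rule refl)
  have "{Collect (prime_tideal G (Hull G \<O>m) \<O>a T) - Vset G (Hull G \<O>m) \<O>a T I | I. tideal G (Hull G \<O>m) \<O>a T I} =
      {Collect (prime_tideal G \<O>m \<O>a T) - Vset G \<O>m \<O>a T I | I. tideal G \<O>m \<O>a T I}"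
    (is "?L = ?R")
  proof (rule equalityI; rule subsetI)
    fix U assume "U \<in> ?L"
    then obtain I where "tideal G (Hull G \<O>m) \<O>a T I" "U = Collect (prime_tideal G \<O>m \<O>a T) - Vset G \<O>m \<O>a T I"
      unfolding V E by blast
    then show "U \<in> ?R" using tideal_of_Hull by blast
  next
    fix U assume "U \<in> ?R"
    then obtain I where I: "tideal G \<O>m \<O>a T I" "U = Collect (prime_tideal G \<O>m \<O>a T) - Vset G \<O>m \<O>a T I"
      by blast
    obtain J where J: "tideal G (Hull G \<O>m) \<O>a T J" "Vset G (Hull G \<O>m) \<O>a T J = Vset G \<O>m \<O>a T I"
      using Vset_tideal_Hull[OF I(1)] by blast
    have "U = Collect (prime_tideal G (Hull G \<O>m) \<O>a T) - Vset G (Hull G \<O>m) \<O>a T J"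
      unfolding I(2) J(2) E by (rule refl)
    then show "U \<in> ?L" using J(1) by blast
  qed
  then show ?thesis by (simp only: Spec_def)
qed

end

end

theorem theoremC:
  fixes G :: "('g, 'm) monoid_scheme"
    and T :: "('g, 'b) tfunctor"
    and \<O>m \<O>a :: "('g set \<times> 'g set) set"
  assumes "group G" and "finite (carrier G)"
    and "tambara_functor G (complete_ts G) (complete_ts G) T"
    and "mult_cohomological G T"
    and "compatible G \<O>m \<O>a"
  shows "Spec G \<O>m \<O>a (forget G \<O>m \<O>a T) homeomorphic_space
         Spec G (Hull G \<O>m) \<O>a (forget G (Hull G \<O>m) \<O>a T)"
proof -
  interpret complete_tambara G T
    by (intro complete_tambara.intro complete_tambara_axioms.intro assms)
  have Om: "transfer_system G \<O>m" and Oa: "transfer_system G \<O>a"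
    using assms(5) by (simp_all add: compatible_def)
  \<comment> \<open>With the forgetful functors removed, both sides are the same topology on the
    same set of families, and the identity is the homeomorphism.\<close>
  show ?thesis
    unfolding Spec_forget[OF Om Oa] Spec_forget[OF Hull_ts[OF Om Oa assms(4)] Oa] Spec_Hull[OF Om Oa assms(4)]
    by (rule homeomorphic_space_refl)
qed

end
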